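(* Let $p$ be a prime, let $\Bbbk$ be an algebraically closed field of characteristic $p$, and let $H$ be an $n$-step iterated Hopf Ore extension (IHOE) of $\Bbbk$ with defining variables $X_1,\dots,X_n$. Then positive integer degrees $d_1,\dots,d_n$ can be assigned to the defining variables of $H$ so that the corresponding filtration of $H$ is an algebra filtration whose associated graded algebra is the commutative polynomial $\Bbbk$-algebra on $n$ variables.
   Context: An $n$-step iterated Hopf Ore extension ($n$-step IHOE) of a field $\Bbbk$ is a Hopf $\Bbbk$-algebra $H$ which as an algebra is an iterated Ore extension $H=\Bbbk[X_1][X_2;\sigma_2,\delta_2]\cdots[X_n;\sigma_n,\delta_n]$ such that, for each $i$, $H_{(i)}:=\Bbbk\langle X_1,\dots,X_i\rangle$ is a Hopf subalgebra of $H$, $\sigma_i$ is an algebra automorphism of $H_{(i-1)}$ and $\delta_i$ is a $\sigma_i$-derivation of $H_{(i-1)}$ (for $i=2,\dots,n$). Here a $\sigma$-derivation is a $\Bbbk$-linear map with $\delta(ab)=\sigma(a)\delta(b)+\delta(a)b$, and in $R[x;\sigma,\delta]$ one has $xr=\sigma(r)x+\delta(r)$. The ordered monomials $X_1^{m_1}\cdots X_n^{m_n}$ ($m_i\ge 0$) form a $\Bbbk$-basis of $H$ (the PBW basis). Given positive integers $d_1,\dots,d_n$, the corresponding filtration is $\{\mathcal C_m\}_{m\ge 0}$, where $\mathcal C_m$ is the $\Bbbk$-span of the ordered monomials $X_1^{m_1}\cdots X_n^{m_n}$ with $\sum_i m_id_i\le m$; it is an algebra filtration if $\mathcal C_r\mathcal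 C_s\subseteq\mathcal C_{r+s}$ for all $r,s$. *)

theory Defs
  imports
    "HOL-Library.Poly_Mapping"
    "HOL-Library.Set_Algebras"
    "HOL-Computational_Algebra.Computational_Algebra"
    "HOL-Algebra.QuotRing"
    "HOL-Algebra.Module"
begin

definition fscale :: "'k::field \<Rightarrow> ('b \<Rightarrow>\<^sub>0 'k) \<Rightarrow> ('b \<Rightarrow>\<^sub>0 'k)" where
  "fscale c = Poly_Mapping.map ((*) c)"

lemma lookup_fscale [simp]:
  "Poly_Mapping.lookup (fscale c t) x = c * Poly_Mapping.lookup t x"
  by (simp add: fscale_def Poly_Mapping.map.rep_eq when_def)

interpretation free_vs: vector_space "fscale :: 'k::field \<Rightarrow> ('b \<Rightarrow>\<^sub>0 'k) \<Rightarrow> ('b \<Rightarrow>\<^sub>0 'k)"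
  by standard (auto intro!: poly_mapping_eqI simp: lookup_add algebra_simps)

definition lin_ext :: "('k::field \<Rightarrow> 'v \<Rightarrow> 'v) \<Rightarrow> ('b \<Rightarrow> 'v) \<Rightarrow> ('b \<Rightarrow>\<^sub>0 'k) \<Rightarrow> 'v::ab_group_add" where
  "lin_ext scale \<phi> t = (\<Sum>x\<in>Poly_Mapping.keys t. scale (Poly_Mapping.lookup t x) (\<phi> x))"

text \<open>
  An element of the tensor square of a vector space is given by a formal linear combination of
  pairs, the pair \<open>(a, b)\<close> standing for the pure tensor of \<open>a\<close> and \<open>b\<close>; two combinations
  represent the same tensor iff they differ by an element of the subspace \<open>tensor2_null\<close>
  spanned by the bilinearity relations. The tensor cube is treated likewise, with triples. The
  quotients are not formed as types, since they depend on the scalar multiplication.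
\<close>

abbreviation pure :: "'b \<Rightarrow> ('b \<Rightarrow>\<^sub>0 'k::field)" where
  "pure x \<equiv> Poly_Mapping.single x 1"

definition tensor2_null :: "('k::field \<Rightarrow> 'v \<Rightarrow> 'v) \<Rightarrow> ('v \<times> 'v::ab_group_add \<Rightarrow>\<^sub>0 'k) set" where
  "tensor2_null scale = free_vs.span
     ({pure (a + a', b) - pure (a, b) - pure (a', b) | a a' b. True} \<union>
      {pure (a, b + b') - pure (a, b) - pure (a, b') | a b b'. True} \<union>
      {pure (scale c a, b) - fscale c (pure (a, b)) | c a b. True} \<union>
      {pure (a, scale c b) - fscale c (pure (a, b)) | c a b. True})"

definition tensor3_null ::
    "('k::field \<Rightarrow> 'v \<Rightarrow> 'v) \<Rightarrow> ('v \<times> 'v \<times> 'v::ab_group_add \<Rightarrow>\<^sub>0 'k) set" where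
  "tensor3_null scale = free_vs.span
     ({pure (a + a', b, c) - pure (a, b, c) - pure (a', b, c) | a a' b c. True} \<union>
      {pure (a, b + b', c) - pure (a, b, c) - pure (a, b', c) | a b b' c. True} \<union>
      {pure (a, b, c + c') - pure (a, b, c) - pure (a, b, c') | a b c c'. True} \<union>
      {pure (scale s a, b, c) - fscale s (pure (a, b, c)) | s a b c. True} \<union>
      {pure (a, scale s b, c) - fscale s (pure (a, b, c)) | s a b c. True} \<union>
      {pure (a, b, scale s c) - fscale s (pure (a, b, c)) | s a b c. True})"

definition tensor2_eq ::
    "('k::field \<Rightarrow> 'v \<Rightarrow> 'v) \<Rightarrow> ('v \<times> 'v \<Rightarrow>\<^sub>0 'k) \<Rightarrow> ('v \<times> 'v::ab_group_add \<Rightarrow>\<^sub>0 'k) \<Rightarrow> bool" where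
  "tensor2_eq scale s t \<longleftrightarrow> s - t \<in> tensor2_null scale"

definition tensor3_eq ::
    "('k::field \<Rightarrow> 'v \<Rightarrow> 'v) \<Rightarrow> ('v \<times> 'v \<times> 'v \<Rightarrow>\<^sub>0 'k) \<Rightarrow> ('v \<times> 'v \<times> 'v::ab_group_add \<Rightarrow>\<^sub>0 'k) \<Rightarrow> bool" where
  "tensor3_eq scale s t \<longleftrightarrow> s - t \<in> tensor3_null scale"

text \<open>The product of the tensor square of an algebra: \<open>(a, b) \<cdot> (c, d) = (a * c, b * d)\<close>, bilinearly extended.\<close>

definition tensor2_mult ::
    "('h \<times> 'h \<Rightarrow>\<^sub>0 'k::field) \<Rightarrow> ('h \<times> 'h \<Rightarrow>\<^sub>0 'k) \<Rightarrow> ('h \<times> 'h::ring_1 \<Rightarrow>\<^sub>0 'k)" where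
  "tensor2_mult s t =
     lin_ext fscale (\<lambda>(a, b). lin_ext fscale (\<lambda>(c, d). pure (a * c, b * d)) t) s"

locale k_algebra = vector_space scale
  for scale :: "'k::field \<Rightarrow> 'h::ring_1 \<Rightarrow> 'h" (infixr \<open>*s\<close> 75) +
  assumes scale_mult_left: "(c *s x) * y = c *s (x * y)"
    and scale_mult_right: "x * (c *s y) = c *s (x * y)"
begin

definition subalgebra :: "'h set \<Rightarrow> bool" where
  "subalgebra R \<longleftrightarrow> subspace R \<and> 1 \<in> R \<and> (\<forall>a\<in>R. \<forall>b\<in>R. a * b \<in> R)"

definition gen_subalgebra :: "'h set \<Rightarrow> 'h set" where
  "gen_subalgebra S = \<Inter> {R. subalgebra R \<and> S \<subseteq> R}"

definition linear_on_sub :: "'h set \<Rightarrow> ('h \<Rightarrow> 'h) \<Rightarrow> bool" where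
  "linear_on_sub R f \<longleftrightarrow>
     (\<forall>a\<in>R. \<forall>b\<in>R. f (a + b) = f a + f b) \<and> (\<forall>c. \<forall>a\<in>R. f (c *s a) = c *s f a)"

definition algebra_automorphism :: "'h set \<Rightarrow> ('h \<Rightarrow> 'h) \<Rightarrow> bool" where
  "algebra_automorphism R \<sigma> \<longleftrightarrow>
     bij_betw \<sigma> R R \<and> linear_on_sub R \<sigma> \<and> \<sigma> 1 = 1 \<and> (\<forall>a\<in>R. \<forall>b\<in>R. \<sigma> (a * b) = \<sigma> a * \<sigma> b)"

definition skew_derivation :: "'h set \<Rightarrow> ('h \<Rightarrow> 'h) \<Rightarrow> ('h \<Rightarrow> 'h) \<Rightarrow> bool" where
  "skew_derivation R \<sigma> \<delta> \<longleftrightarrow>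
     \<delta> ` R \<subseteq> R \<and> linear_on_sub R \<delta> \<and> (\<forall>a\<in>R. \<forall>b\<in>R. \<delta> (a * b) = \<sigma> a * \<delta> b + \<delta> a * b)"

text \<open>
  \<open>T = R[x; \<sigma>, \<delta>]\<close>, for subalgebras \<open>R \<subseteq> T\<close> of the ambient algebra: \<open>T\<close> is a free left
  \<open>R\<close>-module on the powers of \<open>x\<close>, and \<open>x r = \<sigma>(r) x + \<delta>(r)\<close>.
\<close>

definition ore_extension ::
    "'h set \<Rightarrow> 'h \<Rightarrow> ('h \<Rightarrow> 'h) \<Rightarrow> ('h \<Rightarrow> 'h) \<Rightarrow> 'h set \<Rightarrow> bool" where
  "ore_extension R x \<sigma> \<delta> T \<longleftrightarrow>
     subalgebra R \<and> subalgebra T \<and> R \<subseteq> T \<and> x \<in> T \<and>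
     algebra_automorphism R \<sigma> \<and> skew_derivation R \<sigma> \<delta> \<and>
     (\<forall>r\<in>R. x * r = \<sigma> r * x + \<delta> r) \<and>
     (\<forall>t\<in>T. \<exists>!f :: nat \<Rightarrow> 'h.
        (\<forall>i. f i \<in> R) \<and> finite {i. f i \<noteq> 0} \<and> t = (\<Sum>i | f i \<noteq> 0. f i * x ^ i))"

end

text \<open>
  The comultiplication sends each element to a chosen representative of a tensor; accordingly
  it is required to be linear, multiplicative and so on only up to equality of tensors.
\<close>

locale hopf_algebra = k_algebra scale
  for scale :: "'k::field \<Rightarrow> 'h::ring_1 \<Rightarrow> 'h" (infixr \<open>*s\<close> 75) +
  fixes \<Delta> :: "'h \<Rightarrow> ('h \<times> 'h \<Rightarrow>\<^sub>0 'k)"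
    and \<epsilon> :: "'h \<Rightarrow> 'k"
    and S :: "'h \<Rightarrow> 'h"
  assumes comult_add: "tensor2_eq scale (\<Delta> (x + y)) (\<Delta> x + \<Delta> y)"
    and comult_scale: "tensor2_eq scale (\<Delta> (c *s x)) (fscale c (\<Delta> x))"
    and comult_mult: "tensor2_eq scale (\<Delta> (x * y)) (tensor2_mult (\<Delta> x) (\<Delta> y))"
    and comult_one: "tensor2_eq scale (\<Delta> 1) (pure (1, 1))"
    and counit_add: "\<epsilon> (x + y) = \<epsilon> x + \<epsilon> y"
    and counit_scale: "\<epsilon> (c *s x) = c * \<epsilon> x"
    and counit_mult: "\<epsilon> (x * y) = \<epsilon> x * \<epsilon> y"
    and counit_one: "\<epsilon> 1 = 1"
    and coassoc: "tensor3_eq scale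
       (lin_ext fscale (\<lambda>(a, b). lin_ext fscale (\<lambda>(a1, a2). pure (a1, a2, b)) (\<Delta> a)) (\<Delta> x))
       (lin_ext fscale (\<lambda>(a, b). lin_ext fscale (\<lambda>(b1, b2). pure (a, b1, b2)) (\<Delta> b)) (\<Delta> x))"
    and counit_left: "lin_ext scale (\<lambda>(a, b). \<epsilon> a *s b) (\<Delta> x) = x"
    and counit_right: "lin_ext scale (\<lambda>(a, b). \<epsilon> b *s a) (\<Delta> x) = x"
    and antipode_add: "S (x + y) = S x + S y"
    and antipode_scale: "S (c *s x) = c *s S x"
    and antipode_left: "lin_ext scale (\<lambda>(a, b). S a * b) (\<Delta> x) = \<epsilon> x *s 1"
    and antipode_right: "lin_ext scale (\<lambda>(a, b). a * S b) (\<Delta> x) = \<epsilon> x *s 1"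
begin

text \<open>The condition on \<open>\<Delta>\<close> says that \<open>\<Delta>(K)\<close> lies in the image of the tensor square of \<open>K\<close>.\<close>

definition hopf_subalgebra :: "'h set \<Rightarrow> bool" where
  "hopf_subalgebra K \<longleftrightarrow>
     subalgebra K \<and>
     (\<forall>x\<in>K. \<exists>t. Poly_Mapping.keys t \<subseteq> K \<times> K \<and> tensor2_eq scale (\<Delta> x) t) \<and>
     S ` K \<subseteq> K"

end

text \<open>
  The defining variables are \<open>X 1, \<dots>, X n\<close>; the values of \<open>X\<close> elsewhere, and those of
  \<open>\<sigma> i\<close> and \<open>\<delta> i\<close> for \<open>i\<close> outside \<open>{2..n}\<close>, are irrelevant. \<open>H_sub 0\<close> consists of the scalars;
  the case \<open>n = 0\<close>, where the scalars are the whole algebra, is allowed.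
\<close>

locale ihoe = hopf_algebra scale \<Delta> \<epsilon> S
  for scale :: "'k::field \<Rightarrow> 'h::ring_1 \<Rightarrow> 'h" (infixr \<open>*s\<close> 75)
    and \<Delta> :: "'h \<Rightarrow> ('h \<times> 'h \<Rightarrow>\<^sub>0 'k)"
    and \<epsilon> :: "'h \<Rightarrow> 'k"
    and S :: "'h \<Rightarrow> 'h" +
  fixes n :: nat
    and X :: "nat \<Rightarrow> 'h"
    and \<sigma> :: "nat \<Rightarrow> 'h \<Rightarrow> 'h"
    and \<delta> :: "nat \<Rightarrow> 'h \<Rightarrow> 'h"
    and H_sub :: "nat \<Rightarrow> 'h set"
  defines "H_sub i \<equiv> gen_subalgebra (X ` {1..i})"
  assumes H_sub_n: "H_sub n = UNIV"
    and H_sub_hopf: "i \<in> {1..n} \<Longrightarrow> hopf_subalgebra (H_sub i)"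
    and polynomial_1: "1 \<le> n \<Longrightarrow> ore_extension (H_sub 0) (X 1) (\<lambda>r. r) (\<lambda>r. 0) (H_sub 1)"
    and ore_step: "i \<in> {2..n} \<Longrightarrow> ore_extension (H_sub (i - 1)) (X i) (\<sigma> i) (\<delta> i) (H_sub i)"

context k_algebra
begin

definition ordered_monomial :: "nat \<Rightarrow> (nat \<Rightarrow> 'h) \<Rightarrow> (nat \<Rightarrow> nat) \<Rightarrow> 'h" where
  "ordered_monomial n X m = prod_list (map (\<lambda>i. X i ^ m i) [1..<Suc n])"

definition pbw_filtration :: "nat \<Rightarrow> (nat \<Rightarrow> 'h) \<Rightarrow> (nat \<Rightarrow> nat) \<Rightarrow> nat \<Rightarrow> 'h set" where
  "pbw_filtration n X d r = span {ordered_monomial n X m | m. (\<Sum>i=1..n. m i * d i) \<le> r}"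

definition algebra_filtration :: "(nat \<Rightarrow> 'h set) \<Rightarrow> bool" where
  "algebra_filtration C \<longleftrightarrow> (\<forall>r s. \<forall>a\<in>C r. \<forall>b\<in>C s. a * b \<in> C (r + s))"

definition filt_below :: "(nat \<Rightarrow> 'h set) \<Rightarrow> nat \<Rightarrow> 'h set" where
  "filt_below C r = (if r = 0 then {0} else C (r - 1))"

text \<open>
  The associated graded algebra of a filtration \<open>C\<close> by subspaces is the direct sum of the
  quotients \<open>C r / C (r - 1)\<close>, where \<open>C (-1) = 0\<close>. Its elements are the families \<open>g\<close> of cosets
  \<open>g r\<close> of \<open>C (r - 1)\<close> in \<open>C r\<close>, almost all of them zero. The operations use the sums, products
  and finite sums of sets from \<open>Set_Algebras\<close>; adding \<open>filt_below C r\<close> enlarges the set of all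
  products (or multiples) of representatives to a full coset.
\<close>

definition gr_algebra :: "(nat \<Rightarrow> 'h set) \<Rightarrow> ('k, nat \<Rightarrow> 'h set) module" where
  "gr_algebra C = \<lparr>
     carrier = {g. (\<forall>r. g r \<in> (\<lambda>a. a +o filt_below C r) ` C r) \<and> finite {r. g r \<noteq> filt_below C r}},
     monoid.mult = (\<lambda>g h r. \<Sum>i\<le>r. g i * h (r - i) + filt_below C r),
     one = (\<lambda>r. (if r = 0 then 1 else 0) +o filt_below C r),
     ring.zero = filt_below C,
     add = (\<lambda>g h r. g r + h r),
     smult = (\<lambda>c g r. scale c ` g r + filt_below C r)\<rparr>"

end

text \<open>Commutative polynomials over \<open>'k\<close> in the variables \<open>V\<close>; monomials are exponent vectors.\<close>

definition mpoly_algebra :: "'v set \<Rightarrow> ('k::field, ('v \<Rightarrow>\<^sub>0 nat) \<Rightarrow>\<^sub>0 'k) module" where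
  "mpoly_algebra V = \<lparr>
     carrier = {P. \<forall>m\<in>Poly_Mapping.keys P. Poly_Mapping.keys m \<subseteq> V},
     monoid.mult = (*),
     one = 1,
     ring.zero = 0,
     add = (+),
     smult = fscale\<rparr>"

definition algebra_iso :: "('k, 'a) module \<Rightarrow> ('k, 'b) module \<Rightarrow> ('a \<Rightarrow> 'b) set" where
  "algebra_iso A B =
     {\<phi> \<in> ring_iso A B. \<forall>c. \<forall>x\<in>carrier A. \<phi> (c \<odot>\<^bsub>A\<^esub> x) = c \<odot>\<^bsub>B\<^esub> \<phi> x}"

end

theory Submission
  imports Defs
begin

text \<open>
  Let \<open>H\<^sub>i\<close> be the subalgebra generated by the first \<open>i\<close> variables. The key point is that
  \<open>\<sigma>\<^sub>i(X\<^sub>j) - X\<^sub>j\<close> lies in \<open>H\<^sub>j\<^sub>-\<^sub>1\<close> for \<open>j < i\<close>. Then the degrees \<open>d\<^sub>i = b\<^sup>i\<close> with \<open>b\<close> large make all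
  commutators \<open>[X\<^sub>i, X\<^sub>j]\<close> drop in degree, so that words may be sorted modulo lower degree.

  For the key point, put \<open>R = H\<^sub>i\<^sub>-\<^sub>1\<close> and \<open>x = X\<^sub>i\<close>. All the rings \<open>H\<^sub>i \<otimes> H\<close> are iterated Ore extensions,
  hence domains in which the \<open>x\<close>-degree is additive. If \<open>a\<close> is the degree of \<open>\<Delta>(x)\<close> in the first tensor
  factor, then coassociativity forces \<open>a\<^sup>2 \<le> a\<close>, so \<open>a = 1\<close>; the same argument with the smaller variables
  shows that the coefficient of \<open>x\<close> has the form \<open>1 \<otimes> y\<close>, where \<open>y\<close> is group-like, hence a unit, hence a
  scalar, hence \<open>1\<close>. So \<open>\<Delta>(x) - x \<otimes> 1\<close> lies in \<open>R \<otimes> H\<close>, and symmetrically \<open>\<Delta>(x) - 1 \<otimes> x\<close> in \<open>H \<otimes> R\<close>.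
  Comparing the coefficients of \<open>x \<otimes> 1\<close> in \<open>\<Delta>(x r) = \<Delta>(\<sigma>(r) x + \<delta>(r))\<close> gives
  \<open>\<Delta> \<circ> \<sigma> = (\<sigma> \<otimes> 1) \<circ> \<Delta>\<close> on \<open>R\<close>, so \<open>\<sigma>(r)\<close> is \<open>\<Delta>(r)\<close> evaluated at the character \<open>\<epsilon> \<circ> \<sigma>\<close> in the first
  factor; now take \<open>r = X\<^sub>j\<close>.
\<close>

text \<open>For j < i the commutator of \<open>X\<^sub>i\<close> and \<open>X\<^sub>j\<close> is
  \<open>(\<sigma>\<^sub>i(X\<^sub>j) - X\<^sub>j) X\<^sub>i + \<delta>\<^sub>i(X\<^sub>j)\<close>.
  About \<open>\<delta>\<^sub>i(X\<^sub>j)\<close> nothing is known except that it involves smaller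
  variables only, so \<open>X\<^sub>i\<close> has to outweigh the polynomials in them that occur;
  hence the powers of \<open>b\<close>. The first summand still contains \<open>X\<^sub>i\<close>,
  so there the other factor must weigh less than \<open>X\<^sub>j\<close>. For Ore extensions in
  general this fails, as the quantum plane shows; the comultiplication has to exclude it.

  Both one-sided forms of \<Delta> are needed. The coefficient of x \<otimes> 1 controls \<sigma>,
  but evaluating a character in the first factor of \<Delta>(r) for \<open>r = X\<^sub>j\<close>
  calls for the other form: the character maps 1 to 1, and the remaining second factors lie in
  \<open>H\<^sub>j\<^sub>-\<^sub>1\<close>. The analysis of coefficients is therefore done in an
  abstract model that is instantiated twice, with the tensor factors exchanged.\<close>

section \<open>Degrees in Ore extensions\<close>

text \<open>Only what makes degrees additive is kept from an Ore extension: moving \<open>x\<close>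
  past a nonzero coefficient leaves a nonzero one. No automorphism is named, so that the same lemmas
  apply to subalgebras of H and to R \<otimes> H inside a ring of operators.\<close>

locale ore_polynomials =
  fixes R :: "'a::ring_1 set" and x :: 'a
  assumes zero_mem: "0 \<in> R" and one_mem: "1 \<in> R"
    and add_mem: "a \<in> R \<Longrightarrow> b \<in> R \<Longrightarrow> a + b \<in> R"
    and uminus_mem: "a \<in> R \<Longrightarrow> - a \<in> R"
    and mult_mem: "a \<in> R \<Longrightarrow> b \<in> R \<Longrightarrow> a * b \<in> R"
    and no_zero_divisors: "a \<in> R \<Longrightarrow> b \<in> R \<Longrightarrow> a * b = 0 \<Longrightarrow> a = 0 \<or> b = 0"
    and push: "r \<in> R \<Longrightarrow> r \<noteq> 0 \<Longrightarrow> \<exists>s\<in>R. s \<noteq> 0 \<and> x * r - s * x \<in> R"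
    and free: "(\<And>i. f i \<in> R) \<Longrightarrow> (\<Sum>i<d. f i * x ^ i) = 0 \<Longrightarrow> i < d \<Longrightarrow> f i = 0"
begin

text \<open>The bound on the degree is strict, so \<open>Pl 0\<close> is zero and the remainder of a
  leading term of degree 0 needs no separate case.\<close>

definition Pl :: "nat \<Rightarrow> 'a set" where
  "Pl d = {\<Sum>i<d. f i * x ^ i | f. \<forall>i. f i \<in> R}"

definition polys :: "'a set" where
  "polys = (\<Union>d. Pl d)"

definition has_lead :: "nat \<Rightarrow> 'a \<Rightarrow> 'a \<Rightarrow> bool" where
  "has_lead d r t \<longleftrightarrow> r \<in> R \<and> r \<noteq> 0 \<and> t - r * x ^ d \<in> Pl d"

lemma diff_mem: "a \<in> R \<Longrightarrow> b \<in> R \<Longrightarrow> a - b \<in> R"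
  using add_mem[of a "- b"] uminus_mem[of b] by simp

lemma Pl_I: "(\<And>i. f i \<in> R) \<Longrightarrow> (\<Sum>i<d. f i * x ^ i) \<in> Pl d"
  by (auto simp: Pl_def)

lemma Pl_E:
  assumes "t \<in> Pl d"
  obtains f where "\<And>i. f i \<in> R" "t = (\<Sum>i<d. f i * x ^ i)"
  using assms by (auto simp: Pl_def)

lemma Pl_zero: "0 \<in> Pl d"
  using Pl_I[of "\<lambda>_. 0" d] by (simp add: zero_mem)

lemma Pl_0: "Pl 0 = {0}"
  using zero_mem by (auto simp: Pl_def)

lemma Pl_add: "t \<in> Pl d \<Longrightarrow> u \<in> Pl d \<Longrightarrow> t + u \<in> Pl d"
proof (elim Pl_E)
  fix f g assume "\<And>i. f i \<in> R" "\<And>i. g i \<in> R"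
    "t = (\<Sum>i<d. f i * x ^ i)" "u = (\<Sum>i<d. g i * x ^ i)"
  then show "t + u \<in> Pl d"
    using Pl_I[of "\<lambda>i. f i + g i" d] by (simp add: add_mem sum.distrib ring_distribs)
qed

lemma Pl_uminus: "t \<in> Pl d \<Longrightarrow> - t \<in> Pl d"
proof (elim Pl_E)
  fix f assume "\<And>i. f i \<in> R" "t = (\<Sum>i<d. f i * x ^ i)"
  then show "- t \<in> Pl d"
    using Pl_I[of "\<lambda>i. - f i" d] by (simp add: uminus_mem sum_negf)
qed

lemma Pl_diff: "t \<in> Pl d \<Longrightarrow> u \<in> Pl d \<Longrightarrow> t - u \<in> Pl d"
  using Pl_add[of t d "- u"] Pl_uminus[of u d] by simp

lemma Pl_sum: "(\<And>i. i \<in> A \<Longrightarrow> f i \<in> Pl d) \<Longrightarrow> sum f A \<in> Pl d"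
  by (induction A rule: infinite_finite_induct) (auto intro: Pl_add simp: Pl_zero)

lemma Pl_SucI: "r \<in> R \<Longrightarrow> t - r * x ^ d \<in> Pl d \<Longrightarrow> t \<in> Pl (Suc d)"
proof (elim Pl_E)
  fix f assume *: "r \<in> R" "\<And>i. f i \<in> R" "t - r * x ^ d = (\<Sum>i<d. f i * x ^ i)"
  then have "t = (\<Sum>i<Suc d. (if i = d then r else f i) * x ^ i)"
    by (simp add: algebra_simps)
  then show "t \<in> Pl (Suc d)"
    using * Pl_I[of "\<lambda>i. if i = d then r else f i" "Suc d"] by simp
qed

lemma Pl_SucE:
  assumes "t \<in> Pl (Suc d)"
  obtains r where "r \<in> R" "t - r * x ^ d \<in> Pl d"
  using assms
proof (elim Pl_E)
  fix f assume "\<And>i. f i \<in> R" "t = (\<Sum>i<Suc d. f i * x ^ i)"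
  then show thesis
    using that[of "f d"] Pl_I[of f d] by simp
qed

lemma Pl_mono: "d \<le> e \<Longrightarrow> t \<in> Pl d \<Longrightarrow> t \<in> Pl e"
  by (induction e rule: dec_induct) (use Pl_SucI[of 0] zero_mem in auto)

lemma Pl_monom: "r \<in> R \<Longrightarrow> r * x ^ i \<in> Pl (Suc i)"
  using Pl_SucI[of r "r * x ^ i" i] Pl_zero by simp

lemma Pl_x_power: "x ^ i \<in> Pl (Suc i)"
  using Pl_monom[OF one_mem] by simp

lemma Pl_R_mult: "r \<in> R \<Longrightarrow> t \<in> Pl d \<Longrightarrow> r * t \<in> Pl d"
proof (elim Pl_E)
  fix f assume "r \<in> R" "\<And>i. f i \<in> R" "t = (\<Sum>i<d. f i * x ^ i)"
  then show "r * t \<in> Pl d"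
    using Pl_I[of "\<lambda>i. r * f i" d] by (simp add: mult_mem sum_distrib_left mult.assoc)
qed

lemma push_all: "r \<in> R \<Longrightarrow> \<exists>s\<in>R. x * r - s * x \<in> R"
  using push[of r] zero_mem by (cases "r = 0") force+

lemma Pl_x_mult: "t \<in> Pl d \<Longrightarrow> x * t \<in> Pl (Suc d)"
proof (induction d arbitrary: t)
  case 0
  then show ?case by (simp add: Pl_0 Pl_zero)
next
  case (Suc d)
  then obtain r where r: "r \<in> R" "t - r * x ^ d \<in> Pl d" by (elim Pl_SucE)
  then obtain s where s: "s \<in> R" "x * r - s * x \<in> R" using push_all by blast
  have "x * t - s * x ^ Suc d = x * (t - r * x ^ d) + (x * r - s * x) * x ^ d"
    by (simp add: algebra_simps)
  then have "x * t - s * x ^ Suc d \<in> Pl (Suc d)"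
    using Suc.IH[OF r(2)] Pl_monom[OF s(2)] Pl_add by simp
  then show ?case using s(1) Pl_SucI by blast
qed

lemma Pl_x_power_mult: "t \<in> Pl d \<Longrightarrow> x ^ k * t \<in> Pl (d + k)"
  by (induction k) (auto dest: Pl_x_mult simp: mult.assoc)

lemma push_power: "r \<in> R \<Longrightarrow> r \<noteq> 0 \<Longrightarrow> \<exists>s\<in>R. s \<noteq> 0 \<and> x ^ k * r - s * x ^ k \<in> Pl k"
proof (induction k)
  case 0
  then show ?case using Pl_zero by auto
next
  case (Suc k)
  then obtain s where s: "s \<in> R" "s \<noteq> 0" "x ^ k * r - s * x ^ k \<in> Pl k" by blast
  then obtain s' where s': "s' \<in> R" "s' \<noteq> 0" "x * s - s' * x \<in> R" using push by blast
  have "x ^ Suc k * r - s' * x ^ Suc k = x * (x ^ k * r - s * x ^ k) + (x * s - s' * x) * x ^ k"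
    by (simp add: algebra_simps)
  then have "x ^ Suc k * r - s' * x ^ Suc k \<in> Pl (Suc k)"
    using Pl_x_mult[OF s(3)] Pl_monom[OF s'(3)] Pl_add by simp
  then show ?case using s' by blast
qed

lemma Pl_mult:
  assumes "t \<in> Pl d" "u \<in> Pl e"
  shows "t * u \<in> Pl (d + e - 1)"
proof -
  obtain f where f: "\<And>i. f i \<in> R" "t = (\<Sum>i<d. f i * x ^ i)"
    using assms(1) by (auto simp: Pl_def)
  have "f i * (x ^ i * u) \<in> Pl (d + e - 1)" if "i < d" for i
    using Pl_R_mult[OF f(1) Pl_mono[OF _ Pl_x_power_mult[OF assms(2), of i], of "d + e - 1"]] that
    by simp
  then show ?thesis
    by (auto simp: f(2) sum_distrib_right mult.assoc intro: Pl_sum)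
qed

lemma has_lead_Pl: "has_lead d r t \<Longrightarrow> t \<in> Pl (Suc d)"
  by (auto simp: has_lead_def intro: Pl_SucI)

text \<open>\<open>q\<close> is what \<open>s\<close> becomes when \<open>x ^ d\<close> is moved
  past it. Since \<open>R\<close> has no zero divisors, \<open>r * q\<close> survives and degrees
  add.\<close>

lemma has_lead_mult:
  assumes "has_lead d r t" "has_lead e s u"
  obtains q where "q \<in> R" "q \<noteq> 0" "has_lead (d + e) (r * q) (t * u)"
proof -
  note t = assms(1)[unfolded has_lead_def] and u = assms(2)[unfolded has_lead_def]
  obtain q where q: "q \<in> R" "q \<noteq> 0" "x ^ d * s - q * x ^ d \<in> Pl d"
    using push_power u by blast
  have "t * u - (r * q) * x ^ (d + e) =
      r * ((x ^ d * s - q * x ^ d) * x ^ e) + (r * x ^ d) * (u - s * x ^ e) + (t - r * x ^ d) * u"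
    by (simp add: algebra_simps power_add)
  moreover have "r * ((x ^ d * s - q * x ^ d) * x ^ e) \<in> Pl (d + e)"
    using Pl_mult[OF q(3) Pl_x_power[of e]] t by (simp add: Pl_R_mult)
  moreover have "(r * x ^ d) * (u - s * x ^ e) \<in> Pl (d + e)"
    using Pl_mult[OF Pl_monom[of r d], of "u - s * x ^ e" e] t u by simp
  moreover have "(t - r * x ^ d) * u \<in> Pl (d + e)"
    using Pl_mult[of "t - r * x ^ d" d u "Suc e"] t has_lead_Pl[OF assms(2)] by simp
  ultimately have "t * u - (r * q) * x ^ (d + e) \<in> Pl (d + e)"
    by (simp add: Pl_add)
  then have "has_lead (d + e) (r * q) (t * u)"
    using t q no_zero_divisors[of r q] mult_mem by (auto simp: has_lead_def)
  with q that show thesis by blast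
qed

text \<open>Freeness in the form used later: for degree 1 it cancels a right factor \<open>x\<close>
  modulo terms of degree 0.\<close>

lemma monom_Pl_zero: "r \<in> R \<Longrightarrow> r * x ^ d \<in> Pl d \<Longrightarrow> r = 0"
proof (elim Pl_E)
  fix f assume *: "r \<in> R" "\<And>i. f i \<in> R" "r * x ^ d = (\<Sum>i<d. f i * x ^ i)"
  then have "(\<Sum>i<Suc d. (if i = d then - r else f i) * x ^ i) = 0"
    by simp
  then show "r = 0"
    using free[of "\<lambda>i. if i = d then - r else f i" "Suc d" d] * uminus_mem by auto
qed

lemma has_lead_less:
  assumes "has_lead d r t" "t \<in> Pl e"
  shows "d < e"
proof (rule ccontr)
  assume "\<not> d < e"
  then have "t \<in> Pl d" using assms(2) Pl_mono[of e d] by simp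
  then have "r * x ^ d \<in> Pl d"
    using assms(1) Pl_diff[of t d "t - r * x ^ d"] by (simp add: has_lead_def)
  then show False using assms(1) monom_Pl_zero by (auto simp: has_lead_def)
qed

lemma has_lead_exists:
  assumes "t \<in> Pl e" "t \<noteq> 0"
  obtains d r where "d < e" "has_lead d r t"
proof -
  have "\<exists>d<e. \<exists>r. has_lead d r t"
    using assms(1)
  proof (induction e)
    case 0
    then show ?case using assms(2) by (simp add: Pl_0)
  next
    case (Suc e)
    then obtain r where r: "r \<in> R" "t - r * x ^ e \<in> Pl e" by (elim Pl_SucE)
    show ?case
    proof (cases "r = 0")
      case True
      with r Suc.IH show ?thesis using less_Suc_eq by auto
    next
      case False
      with r show ?thesis by (auto simp: has_lead_def)
    qed
  qed
  with that show thesis by blast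
qed

lemma polys_no_zero_divisors:
  assumes "t \<in> polys" "u \<in> polys" "t * u = 0"
  shows "t = 0 \<or> u = 0"
proof (rule ccontr)
  assume "\<not> (t = 0 \<or> u = 0)"
  then have "t \<noteq> 0" "u \<noteq> 0" by auto
  obtain d' e' where "t \<in> Pl d'" "u \<in> Pl e'"
    using assms(1,2) by (auto simp: polys_def)
  obtain d r where t: "has_lead d r t"
    using has_lead_exists[OF \<open>t \<in> Pl d'\<close> \<open>t \<noteq> 0\<close>] .
  obtain e s where u: "has_lead e s u"
    using has_lead_exists[OF \<open>u \<in> Pl e'\<close> \<open>u \<noteq> 0\<close>] .
  obtain q where "has_lead (d + e) (r * q) (t * u)"
    using has_lead_mult[OF t u] .
  then have "has_lead (d + e) (r * q) 0" using assms(3) by simp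
  then show False
    using has_lead_less[of "d + e" "r * q" 0 0] Pl_zero by auto
qed

lemma has_lead_power:
  assumes "has_lead d r t"
  shows "\<exists>q. has_lead (d * k) q (t ^ k)"
proof (induction k)
  case 0
  have "(1::'a) \<noteq> 0" by simp
  then show ?case using Pl_zero one_mem by (auto simp: has_lead_def)
next
  case (Suc k)
  then show ?case using has_lead_mult[OF assms] by (metis power_Suc mult_Suc_right)
qed

lemma has_lead_R_mult:
  assumes "r \<in> R" "r \<noteq> 0" "has_lead d s t"
  shows "has_lead d (r * s) (r * t)"
  using assms no_zero_divisors[of r s] mult_mem[of r s] Pl_R_mult[of r "t - s * x ^ d" d]
  by (auto simp: has_lead_def right_diff_distrib mult.assoc)

lemma has_lead_add:
  "has_lead d r t \<Longrightarrow> u \<in> Pl d \<Longrightarrow> has_lead d r (t + u)"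
  using Pl_add[of "t - r * x ^ d" d u] by (simp add: has_lead_def algebra_simps)

text \<open>Substituting \<open>y\<close> multiplies degrees by \<open>a\<close>. As
  \<open>a\<close> is positive, the terms of index i < m have degree at most a (m - 1) and cannot
  cancel the leading one.\<close>

lemma has_lead_eval:
  assumes y: "has_lead a q y" "a \<ge> 1" and f: "\<And>i. f i \<in> R" "f m \<noteq> 0"
  shows "\<exists>r. has_lead (a * m) r (\<Sum>i<Suc m. f i * y ^ i)"
proof -
  obtain r where r: "has_lead (a * m) r (y ^ m)"
    using has_lead_power[OF y(1)] by blast
  have "f i * y ^ i \<in> Pl (a * m)" if "i < m" for i
  proof -
    obtain r where "has_lead (a * i) r (y ^ i)"
      using has_lead_power[OF y(1)] by blast
    then have "f i * y ^ i \<in> Pl (Suc (a * i))"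
      using has_lead_Pl f(1) Pl_R_mult by blast
    moreover have "Suc (a * i) \<le> a * m"
      using y(2) that mult_le_mono2[of "Suc i" m a] by simp
    ultimately show ?thesis using Pl_mono by blast
  qed
  then have "(\<Sum>i<m. f i * y ^ i) \<in> Pl (a * m)"
    by (auto intro: Pl_sum)
  then show ?thesis
    using has_lead_add[OF has_lead_R_mult[OF f(1) f(2) r]] by (fastforce simp: add.commute)
qed

end

section \<open>Linear maps out of tensor products\<close>

lemma linearI':
  assumes "vector_space s1" "vector_space s2"
    "\<And>x y. f (x + y) = f x + f y" "\<And>c x. f (s1 c x) = s2 c (f x)"
  shows "Vector_Spaces.linear s1 s2 f"
  using assms by (simp add: Vector_Spaces.linear_def module_hom_def module_hom_axioms_def
      module_iff_vector_space)

context vector_space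
begin

lemma lin_ext_superset:
  assumes "finite A" "Poly_Mapping.keys t \<subseteq> A"
  shows "lin_ext scale \<phi> t = (\<Sum>x\<in>A. scale (Poly_Mapping.lookup t x) (\<phi> x))"
  unfolding lin_ext_def
  by (rule sum.mono_neutral_left) (use assms in \<open>auto simp: in_keys_iff\<close>)

lemma lin_ext_zero [simp]: "lin_ext scale \<phi> 0 = 0"
  by (simp add: lin_ext_def)

lemma lin_ext_add: "lin_ext scale \<phi> (s + t) = lin_ext scale \<phi> s + lin_ext scale \<phi> t"
proof -
  let ?A = "Poly_Mapping.keys s \<union> Poly_Mapping.keys t"
  show ?thesis
    using lin_ext_superset[of ?A "s + t" \<phi>] lin_ext_superset[of ?A s \<phi>] lin_ext_superset[of ?A t \<phi>]
      Poly_Mapping.keys_add[of s t]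
    by (simp add: lookup_add scale_left_distrib sum.distrib)
qed

lemma lin_ext_fscale: "lin_ext scale \<phi> (fscale c t) = scale c (lin_ext scale \<phi> t)"
proof -
  have "Poly_Mapping.keys (fscale c t) \<subseteq> Poly_Mapping.keys t"
    by (auto simp: in_keys_iff)
  then show ?thesis
    using lin_ext_superset[of "Poly_Mapping.keys t" "fscale c t" \<phi>]
    by (simp add: lin_ext_def scale_sum_right)
qed

lemma linear_lin_ext: "Vector_Spaces.linear fscale scale (lin_ext scale \<phi>)"
  by (rule linearI') (auto simp: lin_ext_add lin_ext_fscale free_vs.vector_space_axioms vector_space_axioms)

lemma lin_ext_uminus: "lin_ext scale \<phi> (- s) = - lin_ext scale \<phi> s"
  using lin_ext_add[of \<phi> s "- s"] by (simp add: add_eq_0_iff)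

lemma lin_ext_diff: "lin_ext scale \<phi> (s - t) = lin_ext scale \<phi> s - lin_ext scale \<phi> t"
  using lin_ext_add[of \<phi> s "- t"] by (simp add: lin_ext_uminus)

lemma lin_ext_pure [simp]: "lin_ext scale \<phi> (pure x) = \<phi> x"
  by (simp add: lin_ext_def)

lemma lin_ext_cong:
  "(\<And>x. x \<in> Poly_Mapping.keys t \<Longrightarrow> \<phi> x = \<psi> x) \<Longrightarrow> lin_ext scale \<phi> t = lin_ext scale \<psi> t"
  by (simp add: lin_ext_def)

lemma lin_ext_mem_subspace:
  assumes "subspace U" "\<And>x. x \<in> Poly_Mapping.keys t \<Longrightarrow> \<phi> x \<in> U"
  shows "lin_ext scale \<phi> t \<in> U"
  unfolding lin_ext_def using assms by (auto intro: subspace_sum subspace_scale)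

lemma lin_ext_scaled:
  assumes "\<And>x. \<phi> x = scale c (\<psi> x)"
  shows "lin_ext scale \<phi> t = scale c (lin_ext scale \<psi> t)"
  by (simp add: lin_ext_def assms scale_sum_right mult.commute)

end

lemma linear_lin_ext_comp:
  assumes "Vector_Spaces.linear s1 s2 g"
  shows "g (lin_ext s1 \<phi> t) = lin_ext s2 (\<lambda>x. g (\<phi> x)) t"
proof -
  interpret g: Vector_Spaces.linear s1 s2 g by fact
  show ?thesis by (simp add: lin_ext_def g.sum g.scale)
qed

lemma linear_zero_on_span:
  assumes "Vector_Spaces.linear fscale s f" "t \<in> free_vs.span G" "\<And>x. x \<in> G \<Longrightarrow> f x = 0"
  shows "f t = 0"
proof -
  interpret f: Vector_Spaces.linear fscale s f by fact
  show ?thesis using f.eq_0_on_span assms(2,3) by blast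
qed

definition bilinear_map ::
    "('k::field \<Rightarrow> 'h::ab_group_add \<Rightarrow> 'h) \<Rightarrow> ('k \<Rightarrow> 'v::ab_group_add \<Rightarrow> 'v) \<Rightarrow> ('h \<Rightarrow> 'h \<Rightarrow> 'v) \<Rightarrow> bool" where
  "bilinear_map s s' \<beta> \<longleftrightarrow>
     (\<forall>a. Vector_Spaces.linear s s' (\<beta> a)) \<and> (\<forall>b. Vector_Spaces.linear s s' (\<lambda>a. \<beta> a b))"

lemma bilinear_mapI:
  assumes "vector_space s" "vector_space s'"
    "\<And>a a' b. \<beta> (a + a') b = \<beta> a b + \<beta> a' b" "\<And>c a b. \<beta> (s c a) b = s' c (\<beta> a b)"
    "\<And>a b b'. \<beta> a (b + b') = \<beta> a b + \<beta> a b'" "\<And>c a b. \<beta> a (s c b) = s' c (\<beta> a b)"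
  shows "bilinear_map s s' \<beta>"
  unfolding bilinear_map_def using assms by (auto intro!: linearI')

lemma bilinear_mapD:
  assumes "bilinear_map s s' \<beta>"
  shows "\<beta> (a + a') b = \<beta> a b + \<beta> a' b" "\<beta> (s c a) b = s' c (\<beta> a b)"
    "\<beta> a (b + b') = \<beta> a b + \<beta> a b'" "\<beta> a (s c b) = s' c (\<beta> a b)"
proof -
  have l: "Vector_Spaces.linear s s' (\<beta> a)" "Vector_Spaces.linear s s' (\<lambda>a. \<beta> a b)"
    using assms by (auto simp: bilinear_map_def)
  interpret l: Vector_Spaces.linear s s' "\<beta> a" by fact
  interpret r: Vector_Spaces.linear s s' "\<lambda>a. \<beta> a b" by fact
  show "\<beta> (a + a') b = \<beta> a b + \<beta> a' b" "\<beta> (s c a) b = s' c (\<beta> a b)"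
    "\<beta> a (b + b') = \<beta> a b + \<beta> a b'" "\<beta> a (s c b) = s' c (\<beta> a b)"
    by (rule r.add r.scale l.add l.scale)+
qed

lemma bilinear_vector_space:
  assumes "bilinear_map s s' \<beta>"
  shows "vector_space s" "vector_space s'"
  using assms by (auto simp: bilinear_map_def Vector_Spaces.linear_def)

text \<open>The universal property of the tensor product: a bilinear map kills the generators of
  \<open>tensor2_null\<close>. Through it an equality of formal tensors becomes an equality in an
  actual vector space.\<close>

lemma lin_ext_tensor2_eq:
  assumes \<beta>: "bilinear_map s s' \<beta>" and "tensor2_eq s t u"
  shows "lin_ext s' (\<lambda>(a, b). \<beta> a b) t = lin_ext s' (\<lambda>(a, b). \<beta> a b) u"
proof -
  interpret V: vector_space s' using bilinear_vector_space[OF \<beta>] by simp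
  have "lin_ext s' (\<lambda>(a, b). \<beta> a b) (t - u) = 0"
    using assms(2) unfolding tensor2_eq_def tensor2_null_def
    by (rule linear_zero_on_span[OF V.linear_lin_ext])
       (auto simp: V.lin_ext_diff V.lin_ext_fscale bilinear_mapD[OF \<beta>])
  then show ?thesis by (simp add: V.lin_ext_diff)
qed

lemma lin_ext_tensor3_eq:
  assumes "vector_space s'"
    and l: "\<And>b c. Vector_Spaces.linear s s' (\<lambda>a. \<beta> a b c)" "\<And>a c. Vector_Spaces.linear s s' (\<lambda>b. \<beta> a b c)"
      "\<And>a b. Vector_Spaces.linear s s' (\<lambda>c. \<beta> a b c)"
    and "tensor3_eq s t u"
  shows "lin_ext s' (\<lambda>(a, b, c). \<beta> a b c) t = lin_ext s' (\<lambda>(a, b, c). \<beta> a b c) u"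
proof -
  interpret V: vector_space s' by fact
  note * = l[THEN Vector_Spaces.linear.axioms(3)]
  have "lin_ext s' (\<lambda>(a, b, c). \<beta> a b c) (t - u) = 0"
    using assms(5) unfolding tensor3_eq_def tensor3_null_def
    by (rule linear_zero_on_span[OF V.linear_lin_ext])
       (auto simp: V.lin_ext_diff V.lin_ext_fscale module_hom.add[OF *(1)] module_hom.add[OF *(2)]
          module_hom.add[OF *(3)] module_hom.scale[OF *(1)] module_hom.scale[OF *(2)]
          module_hom.scale[OF *(3)])
  then show ?thesis by (simp add: V.lin_ext_diff)
qed

text \<open>
  The tensor square of \<open>H\<close> depends on the scalar multiplication and cannot be a type. It is embedded
  instead into a ring of operators that is one.
\<close>

typedef (overloaded) 'h endo =
  "{f :: ('h \<Rightarrow> 'h::ring_1) \<Rightarrow> 'h \<Rightarrow> 'h. \<forall>u v. f (\<lambda>i. u i + v i) = (\<lambda>i. f u i + f v i)}"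
  morphisms endo_apply Abs_endo
  by (rule exI[of _ "\<lambda>u. u"]) simp

setup_lifting type_definition_endo

instantiation endo :: (ring_1) ring_1
begin

lift_definition zero_endo :: "'a endo" is "\<lambda>_ _. 0" by simp
lift_definition one_endo :: "'a endo" is "\<lambda>u. u" by simp
lift_definition plus_endo :: "'a endo \<Rightarrow> 'a endo \<Rightarrow> 'a endo" is "\<lambda>f g u i. f u i + g u i"
  by (simp add: algebra_simps)
lift_definition minus_endo :: "'a endo \<Rightarrow> 'a endo \<Rightarrow> 'a endo" is "\<lambda>f g u i. f u i - g u i"
  by (simp add: algebra_simps)
lift_definition uminus_endo :: "'a endo \<Rightarrow> 'a endo" is "\<lambda>f u i. - f u i"
  by simp
lift_definition times_endo :: "'a endo \<Rightarrow> 'a endo \<Rightarrow> 'a endo" is "\<lambda>f g u. f (g u)"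
  by simp

instance
proof
  show "(0 :: 'a endo) \<noteq> 1"
  proof
    assume "(0 :: 'a endo) = 1"
    then have "endo_apply (0 :: 'a endo) (\<lambda>_. 1) 0 = endo_apply 1 (\<lambda>_. 1 :: 'a) 0" by simp
    then show False by (simp add: zero_endo.rep_eq one_endo.rep_eq)
  qed
qed (transfer; simp add: algebra_simps)+

end

lemma endo_eqI: "(\<And>u i. endo_apply f u i = endo_apply g u i) \<Longrightarrow> f = g"
  by (auto simp: endo_apply_inject[symmetric] fun_eq_iff)

lemma endo_apply_sum: "endo_apply (\<Sum>x\<in>A. f x) u i = (\<Sum>x\<in>A. endo_apply (f x) u i)"
  by (induction A rule: infinite_finite_induct) (simp_all add: zero_endo.rep_eq plus_endo.rep_eq)

section \<open>Ore extensions and the tensor square of an algebra\<close>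

context k_algebra
begin

lemma scale_one_mult [simp]: "(c *s 1) * x = c *s x" "x * (c *s 1) = c *s x"
  by (simp_all add: scale_mult_left scale_mult_right)

lemma subalgebraD:
  assumes "subalgebra R"
  shows "subspace R" "1 \<in> R" "\<And>a b. a \<in> R \<Longrightarrow> b \<in> R \<Longrightarrow> a * b \<in> R" "0 \<in> R"
    "\<And>a b. a \<in> R \<Longrightarrow> b \<in> R \<Longrightarrow> a + b \<in> R" "\<And>a b. a \<in> R \<Longrightarrow> b \<in> R \<Longrightarrow> a - b \<in> R"
    "\<And>a. a \<in> R \<Longrightarrow> - a \<in> R" "\<And>c a. a \<in> R \<Longrightarrow> c *s a \<in> R" "\<And>c. c *s 1 \<in> R"
  using assms unfolding subalgebra_def
  by (auto intro: subspace_0 subspace_add subspace_diff subspace_neg subspace_scale)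

lemma subalgebra_power: "subalgebra R \<Longrightarrow> a \<in> R \<Longrightarrow> a ^ i \<in> R"
  by (induction i) (auto dest: subalgebraD)

lemma subalgebra_sum: "subalgebra R \<Longrightarrow> (\<And>i. i \<in> A \<Longrightarrow> f i \<in> R) \<Longrightarrow> sum f A \<in> R"
  by (rule subspace_sum) (auto dest: subalgebraD)

lemma subalgebra_gen_subalgebra: "subalgebra (gen_subalgebra A)"
  unfolding gen_subalgebra_def subalgebra_def subspace_def by blast

lemma gen_subalgebra_empty: "gen_subalgebra {} = span {1}"
proof
  have "a * b \<in> span {1}" if "a \<in> span {1}" "b \<in> span {1}" for a b
    using that by (auto simp: span_singleton)
  then have "subalgebra (span {1})"
    by (auto simp: subalgebra_def intro: span_base)
  then show "gen_subalgebra {} \<subseteq> span {1}"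
    unfolding gen_subalgebra_def by blast
  show "span {1} \<subseteq> gen_subalgebra {}"
    using subalgebraD[OF subalgebra_gen_subalgebra[of "{}"]] by (intro span_minimal) auto
qed

context
  fixes R :: "'h set" and x :: 'h and \<sigma> \<delta> :: "'h \<Rightarrow> 'h" and T :: "'h set"
  assumes ore: "ore_extension R x \<sigma> \<delta> T"
begin

lemma ore_extension_subalgebra: "subalgebra R" "subalgebra T" "R \<subseteq> T" "x \<in> T"
  using ore by (auto simp: ore_extension_def)

lemma ore_extension_rule:
  assumes "r \<in> R"
  shows "x * r = \<sigma> r * x + \<delta> r" "\<sigma> r \<in> R" "\<delta> r \<in> R"
  using ore assms
  by (auto simp: ore_extension_def algebra_automorphism_def skew_derivation_def bij_betw_def)

lemma ore_extension_sigma_0 [simp]: "\<sigma> 0 = 0"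
proof -
  have "0 \<in> R" using subalgebraD ore_extension_subalgebra by blast
  then have "\<sigma> (0 + 0) = \<sigma> 0 + \<sigma> 0"
    using ore unfolding ore_extension_def algebra_automorphism_def linear_on_sub_def by blast
  then show ?thesis by simp
qed

lemma ore_extension_sigma_eq_0: "r \<in> R \<Longrightarrow> \<sigma> r = 0 \<longleftrightarrow> r = 0"
proof -
  assume "r \<in> R"
  have "0 \<in> R" using subalgebraD ore_extension_subalgebra by blast
  moreover have "inj_on \<sigma> R"
    using ore by (simp add: ore_extension_def algebra_automorphism_def bij_betw_def)
  ultimately show ?thesis using \<open>r \<in> R\<close> inj_on_eq_iff[of \<sigma> R r 0] by simp
qed

text \<open>Zero lies in \<open>T\<close> and its expansion is unique. Uniqueness concerns finitely
  supported families, hence the truncation \<open>?g\<close>.\<close>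

lemma ore_extension_free:
  assumes "\<And>i. f i \<in> R" "(\<Sum>i<d. f i * x ^ i) = 0" "i < d"
  shows "f i = 0"
proof -
  let ?P = "\<lambda>f. (\<forall>i. f i \<in> R) \<and> finite {i. f i \<noteq> 0} \<and> 0 = (\<Sum>i | f i \<noteq> 0. f i * x ^ i)"
  let ?g = "\<lambda>i. if i < d then f i else 0"
  have 0: "0 \<in> R" "0 \<in> T" using subalgebraD ore_extension_subalgebra by blast+
  have *: "finite {i. ?g i \<noteq> 0}" by (rule finite_subset[of _ "{..<d}"]) auto
  have "(\<Sum>i | ?g i \<noteq> 0. ?g i * x ^ i) = (\<Sum>i<d. ?g i * x ^ i)"
    by (rule sum.mono_neutral_left) auto
  then have g: "?P ?g" using assms 0 * by auto
  have "\<exists>!f. ?P f" using ore 0(2) unfolding ore_extension_def by blast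
  then obtain h where h: "\<And>f. ?P f \<Longrightarrow> f = h" by (elim ex1E) blast
  have "?g = h" "(\<lambda>_. 0) = h" by (rule h, rule g, rule h, simp add: 0)
  then have "?g = (\<lambda>_. 0)" by simp
  then show ?thesis using assms(3) by (auto simp: fun_eq_iff split: if_splits)
qed

lemma ore_polynomials_ore_extension:
  assumes dom: "\<And>a b. a \<in> R \<Longrightarrow> b \<in> R \<Longrightarrow> a * b = 0 \<Longrightarrow> a = 0 \<or> b = 0"
  shows "ore_polynomials R x"
proof
  fix r assume "r \<in> R" "r \<noteq> 0"
  then show "\<exists>s\<in>R. s \<noteq> 0 \<and> x * r - s * x \<in> R"
    using ore_extension_rule[of r] ore_extension_sigma_eq_0[of r] by (intro bexI[of _ "\<sigma> r"]) auto
next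
  fix f :: "nat \<Rightarrow> 'h" and d i
  assume "\<And>i. f i \<in> R" "(\<Sum>i<d. f i * x ^ i) = 0" "i < d"
  then show "f i = 0" by (rule ore_extension_free)
qed (simp_all add: subalgebraD[OF ore_extension_subalgebra(1)] dom)

lemma ore_extension_polys:
  assumes "ore_polynomials R x"
  shows "ore_polynomials.polys R x = T"
proof -
  interpret ore_polynomials R x by fact
  show ?thesis
  proof
    show "polys \<subseteq> T"
    proof
      fix t assume "t \<in> polys"
      then obtain d f where "\<And>i. f i \<in> R" "t = (\<Sum>i<d. f i * x ^ i)"
        by (auto simp: polys_def Pl_def)
      then show "t \<in> T"
        using ore_extension_subalgebra
        by (auto intro!: subalgebra_sum subalgebraD(3) subalgebra_power)
    qed
    show "T \<subseteq> polys"
    proof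
      fix t assume "t \<in> T"
      then obtain f where f: "\<forall>i. f i \<in> R" "finite {i. f i \<noteq> 0}" "t = (\<Sum>i | f i \<noteq> 0. f i * x ^ i)"
        using ore unfolding ore_extension_def by blast
      then obtain d where d: "{i. f i \<noteq> 0} \<subseteq> {..<d}"
        using finite_nat_bounded by blast
      have "t = (\<Sum>i<d. f i * x ^ i)"
        unfolding f(3) by (rule sum.mono_neutral_left) (use d in auto)
      then show "t \<in> polys" using f(1) by (auto simp: polys_def Pl_def)
    qed
  qed
qed

end

end

text \<open>
  \<open>\<iota>\<close> and \<open>\<kappa>\<close> embed the two factors of \<open>H \<otimes> H\<close> into a ring, \<open>D\<close> is the comultiplication, and \<open>c b\<close> is
  \<open>(1 \<otimes> b\<^sup>*) \<circ> \<Delta>\<close> for \<open>b\<close> in the basis \<open>B\<close>. Exchanging \<open>\<iota>\<close> and \<open>\<kappa>\<close> yields the model of the opposite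
  comultiplication; this is why the antipode only enters through the symmetric last axiom.
\<close>

locale comult_model = k_algebra scale
  for scale :: "'k::field \<Rightarrow> 'h::ring_1 \<Rightarrow> 'h" (infixr \<open>*s\<close> 75) +
  fixes B :: "'h set" and \<iota> \<kappa> D :: "'h \<Rightarrow> 'e::ring_1" and c :: "'h \<Rightarrow> 'h \<Rightarrow> 'h" and \<epsilon> :: "'h \<Rightarrow> 'k"
  assumes indep: "independent B" and span_B: "span B = UNIV" and one_B: "1 \<in> B"
    and iota_add: "\<iota> (x + y) = \<iota> x + \<iota> y" and iota_mult: "\<iota> (x * y) = \<iota> x * \<iota> y" and iota_one: "\<iota> 1 = 1"
    and kappa_add: "\<kappa> (x + y) = \<kappa> x + \<kappa> y" and kappa_mult: "\<kappa> (x * y) = \<kappa> x * \<kappa> y" and kappa_one: "\<kappa> 1 = 1"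
    and D_add: "D (x + y) = D x + D y" and D_mult: "D (x * y) = D x * D y" and D_one: "D 1 = 1"
    and kappa_scalar: "\<kappa> (a *s 1) = \<iota> (a *s 1)" and D_scalar: "D (a *s 1) = \<iota> (a *s 1)"
    and commute: "\<kappa> y * \<iota> x = \<iota> x * \<kappa> y"
    and freeB: "finite F \<Longrightarrow> F \<subseteq> B \<Longrightarrow> (\<Sum>b\<in>F. \<iota> (\<alpha> b) * \<kappa> b) = 0 \<Longrightarrow> b \<in> F \<Longrightarrow> \<alpha> b = 0"
    and c_finite: "finite {b. c b h \<noteq> 0}" and c_B: "c b h \<noteq> 0 \<Longrightarrow> b \<in> B"
    and D_eq: "D h = (\<Sum>b | c b h \<noteq> 0. \<iota> (c b h) * \<kappa> b)"
    and coassoc: "b \<in> B \<Longrightarrow> b' \<in> B \<Longrightarrow>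
          c b' (c b h) = (\<Sum>b'' | c b'' h \<noteq> 0. representation B (c b b'') b' *s c b'' h)"
    and counit: "(\<Sum>b | c b h \<noteq> 0. \<epsilon> b *s c b h) = h"
    and eps_one: "\<epsilon> 1 = 1"
    and grouplike_unit: "(\<And>b. b \<in> B \<Longrightarrow> c b y = representation B y b *s y) \<Longrightarrow> y \<noteq> 0 \<Longrightarrow> \<exists>z. y * z = 1"
begin

lemma iota_0 [simp]: "\<iota> 0 = 0" and kappa_0 [simp]: "\<kappa> 0 = 0" and D_0 [simp]: "D 0 = 0"
  using iota_add[of 0 0] kappa_add[of 0 0] D_add[of 0 0] by simp_all

lemma iota_uminus: "\<iota> (- x) = - \<iota> x"
  using iota_add[of x "- x"] by (simp add: add_eq_0_iff)

lemma iota_sum: "\<iota> (sum f A) = (\<Sum>i\<in>A. \<iota> (f i))"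
  by (induction A rule: infinite_finite_induct) (simp_all add: iota_add)

lemma kappa_sum: "\<kappa> (sum f A) = (\<Sum>i\<in>A. \<kappa> (f i))"
  by (induction A rule: infinite_finite_induct) (simp_all add: kappa_add)

lemma D_sum: "D (sum f A) = (\<Sum>i\<in>A. D (f i))"
  by (induction A rule: infinite_finite_induct) (simp_all add: D_add)

lemma iota_power: "\<iota> (x ^ i) = \<iota> x ^ i"
  by (induction i) (simp_all add: iota_one iota_mult)

lemma D_power: "D (x ^ i) = D x ^ i"
  by (induction i) (simp_all add: D_one D_mult)

lemma D_diff: "D (x - y) = D x - D y"
  using D_add[of "x - y" y] by simp

lemma kappa_scale: "\<kappa> (a *s h) = \<iota> (a *s 1) * \<kappa> h"
  using kappa_mult[of "a *s 1" h] by (simp add: kappa_scalar)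

lemma D_scale: "D (a *s h) = \<iota> (a *s 1) * D h"
  using D_mult[of "a *s 1" h] by (simp add: D_scalar)

abbreviation coord :: "'h \<Rightarrow> 'h \<Rightarrow> 'k" where
  "coord b v \<equiv> representation B v b"

lemma coord_add: "coord b (u + v) = coord b u + coord b v"
  and coord_scale: "coord b (a *s v) = a * coord b v"
  and coord_sum: "coord b (sum f A) = (\<Sum>i\<in>A. coord b (f i))"
  by (simp_all add: representation_add representation_scale representation_sum indep span_B)

lemma coord_basis: "b \<in> B \<Longrightarrow> coord b' b = (if b' = b then 1 else 0)"
  by (simp add: representation_basis indep)

lemma sum_coord: "(\<Sum>b | coord b v \<noteq> 0. coord b v *s b) = v"
  by (rule sum_nonzero_representation_eq) (simp_all add: indep span_B)

lemma coord_eqI: "(\<And>b. b \<in> B \<Longrightarrow> coord b u = coord b v) \<Longrightarrow> u = v"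
proof -
  assume "\<And>b. b \<in> B \<Longrightarrow> coord b u = coord b v"
  then have "coord b u = coord b v" for b
    using representation_ne_zero[of B u b] representation_ne_zero[of B v b] by metis
  then have "(\<Sum>b | coord b u \<noteq> 0. coord b u *s b) = (\<Sum>b | coord b v \<noteq> 0. coord b v *s b)"
    by presburger
  then show "u = v" by (simp only: sum_coord)
qed

text \<open>\<open>tens \<alpha>\<close> is \<open>\<Sum>b. \<alpha> b \<otimes> b\<close>, and \<open>RE K\<close> is \<open>K \<otimes> H\<close>.\<close>

definition finsupp :: "('h \<Rightarrow> 'h) \<Rightarrow> bool" where
  "finsupp \<alpha> \<longleftrightarrow> finite {b. \<alpha> b \<noteq> 0} \<and> {b. \<alpha> b \<noteq> 0} \<subseteq> B"

definition tens :: "('h \<Rightarrow> 'h) \<Rightarrow> 'e" where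
  "tens \<alpha> = (\<Sum>b | \<alpha> b \<noteq> 0. \<iota> (\<alpha> b) * \<kappa> b)"

definition RE :: "'h set \<Rightarrow> 'e set" where
  "RE K = {tens \<alpha> | \<alpha>. finsupp \<alpha> \<and> (\<forall>b. \<alpha> b \<in> K)}"

lemma finsupp_c: "finsupp (\<lambda>b. c b h)"
  using c_finite c_B by (auto simp: finsupp_def)

lemma D_tens: "D h = tens (\<lambda>b. c b h)"
  by (simp add: D_eq tens_def)

lemma tens_superset: "finite F \<Longrightarrow> {b. \<alpha> b \<noteq> 0} \<subseteq> F \<Longrightarrow> tens \<alpha> = (\<Sum>b\<in>F. \<iota> (\<alpha> b) * \<kappa> b)"
  unfolding tens_def by (rule sum.mono_neutral_left) auto

lemma finsupp_subset:
  assumes "finsupp \<alpha>" "\<And>b. \<alpha> b = 0 \<Longrightarrow> \<beta> b = 0"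
  shows "finsupp \<beta>"
proof -
  have "{b. \<beta> b \<noteq> 0} \<subseteq> {b. \<alpha> b \<noteq> 0}" using assms(2) by auto
  then show ?thesis using assms(1) unfolding finsupp_def by (meson finite_subset order_trans)
qed

lemma finsupp_add: "finsupp \<alpha> \<Longrightarrow> finsupp \<beta> \<Longrightarrow> finsupp (\<lambda>b. \<alpha> b + \<beta> b)"
proof -
  assume *: "finsupp \<alpha>" "finsupp \<beta>"
  have "{b. \<alpha> b + \<beta> b \<noteq> 0} \<subseteq> {b. \<alpha> b \<noteq> 0} \<union> {b. \<beta> b \<noteq> 0}" by auto
  with * show ?thesis unfolding finsupp_def by (meson finite_subset finite_UnI order_trans Un_least)
qed

lemma finsupp_zero: "finsupp (\<lambda>_. 0)"
  by (simp add: finsupp_def)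

lemma finsupp_sum: "(\<And>i. i \<in> A \<Longrightarrow> finsupp (\<alpha> i)) \<Longrightarrow> finsupp (\<lambda>b. \<Sum>i\<in>A. \<alpha> i b)"
  by (induction A rule: infinite_finite_induct) (auto intro: finsupp_add simp: finsupp_zero)

lemma finsupp_coord: "finsupp (\<lambda>b. coord b h *s v)"
proof -
  have "{b. coord b h *s v \<noteq> 0} \<subseteq> {b. coord b h \<noteq> 0}" by auto
  moreover have "{b. coord b h \<noteq> 0} \<subseteq> B" using representation_ne_zero by blast
  ultimately show ?thesis
    unfolding finsupp_def using finite_representation[of B h] by (meson finite_subset order_trans)
qed

lemma tens_zero [simp]: "tens (\<lambda>_. 0) = 0"
  by (simp add: tens_def)

lemma tens_add: "finsupp \<alpha> \<Longrightarrow> finsupp \<beta> \<Longrightarrow> tens (\<lambda>b. \<alpha> b + \<beta> b) = tens \<alpha> + tens \<beta>"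
proof -
  assume *: "finsupp \<alpha>" "finsupp \<beta>"
  let ?F = "{b. \<alpha> b \<noteq> 0} \<union> {b. \<beta> b \<noteq> 0}"
  have "finite ?F" using * by (simp add: finsupp_def)
  then show ?thesis
    by (subst (1 2 3) tens_superset[of ?F]) (auto simp: iota_add ring_distribs sum.distrib)
qed

lemma tens_sum: "(\<And>i. i \<in> A \<Longrightarrow> finsupp (\<alpha> i)) \<Longrightarrow> tens (\<lambda>b. \<Sum>i\<in>A. \<alpha> i b) = (\<Sum>i\<in>A. tens (\<alpha> i))"
  by (induction A rule: infinite_finite_induct) (simp_all add: tens_add finsupp_sum)

lemma tens_left_mult: "finsupp \<alpha> \<Longrightarrow> \<iota> a * tens \<alpha> = tens (\<lambda>b. a * \<alpha> b)"
proof -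
  assume "finsupp \<alpha>"
  then have "tens (\<lambda>b. a * \<alpha> b) = (\<Sum>b | \<alpha> b \<noteq> 0. \<iota> (a * \<alpha> b) * \<kappa> b)"
    by (intro tens_superset) (auto simp: finsupp_def)
  then show ?thesis by (simp add: tens_def sum_distrib_left iota_mult mult.assoc)
qed

lemma tens_right_mult: "finsupp \<alpha> \<Longrightarrow> tens \<alpha> * \<iota> a = tens (\<lambda>b. \<alpha> b * a)"
proof -
  assume "finsupp \<alpha>"
  then have "tens (\<lambda>b. \<alpha> b * a) = (\<Sum>b | \<alpha> b \<noteq> 0. \<iota> (\<alpha> b * a) * \<kappa> b)"
    by (intro tens_superset) (auto simp: finsupp_def)
  then show ?thesis by (simp add: tens_def sum_distrib_right iota_mult mult.assoc commute)
qed

lemma finsupp_left_mult: "finsupp \<alpha> \<Longrightarrow> finsupp (\<lambda>b. a * \<alpha> b)" and finsupp_right_mult: "finsupp \<alpha> \<Longrightarrow> finsupp (\<lambda>b. \<alpha> b * a)"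
  and finsupp_uminus: "finsupp \<alpha> \<Longrightarrow> finsupp (\<lambda>b. - \<alpha> b)"
  by (erule finsupp_subset, simp)+

lemma tens_uminus: "finsupp \<alpha> \<Longrightarrow> tens (\<lambda>b. - \<alpha> b) = - tens \<alpha>"
  using tens_left_mult[of \<alpha> "- 1"] by (simp add: iota_uminus iota_one)

lemma tens_diff: "finsupp \<alpha> \<Longrightarrow> finsupp \<beta> \<Longrightarrow> tens (\<lambda>b. \<alpha> b - \<beta> b) = tens \<alpha> - tens \<beta>"
  using tens_add[of \<alpha> "\<lambda>b. - \<beta> b"] by (simp add: finsupp_uminus tens_uminus)

lemma finsupp_diff: "finsupp \<alpha> \<Longrightarrow> finsupp \<beta> \<Longrightarrow> finsupp (\<lambda>b. \<alpha> b - \<beta> b)"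
  using finsupp_add[of \<alpha> "\<lambda>b. - \<beta> b"] by (simp add: finsupp_uminus)

lemma tens_eq_0: "finsupp \<alpha> \<Longrightarrow> tens \<alpha> = 0 \<Longrightarrow> \<alpha> b = 0"
  unfolding tens_def finsupp_def using freeB[of "{b. \<alpha> b \<noteq> 0}" \<alpha> b] by auto

lemma tens_inject: "finsupp \<alpha> \<Longrightarrow> finsupp \<beta> \<Longrightarrow> tens \<alpha> = tens \<beta> \<Longrightarrow> \<alpha> b = \<beta> b"
  using tens_eq_0[OF finsupp_diff, of \<alpha> \<beta> b] by (simp add: tens_diff)

lemma c_add: "c b (h + h') = c b h + c b h'"
  using tens_inject[OF finsupp_c finsupp_add[OF finsupp_c finsupp_c], of "h + h'" h h' b] D_add[of h h']
  by (simp add: D_tens tens_add finsupp_c)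

lemma c_scale: "c b (a *s h) = a *s c b h"
  using tens_inject[OF finsupp_c finsupp_left_mult[OF finsupp_c], of "a *s h" "a *s 1" h b] D_scale[of a h]
  by (simp add: D_tens tens_left_mult finsupp_c)

lemma c_0 [simp]: "c b 0 = 0"
  using c_add[of b 0 0] by simp

lemma c_sum: "c b (sum f A) = (\<Sum>i\<in>A. c b (f i))"
  by (induction A rule: infinite_finite_induct) (simp_all add: c_add)

text \<open>The counit recovers \<open>h\<close> from the coefficients of \<open>D h\<close>. This
  keeps leading coefficients nonzero under \<open>D\<close>.\<close>

lemma D_eq_0: "D h = 0 \<Longrightarrow> h = 0"
  using tens_eq_0[OF finsupp_c, of h] counit[of h] by (simp add: D_tens)

lemma iota_kappa_tens: "\<iota> a * \<kappa> h = tens (\<lambda>b. coord b h *s a)"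
proof -
  have "\<kappa> h = \<kappa> (\<Sum>b | coord b h \<noteq> 0. coord b h *s b)" by (simp add: sum_coord)
  also have "\<dots> = (\<Sum>b | coord b h \<noteq> 0. \<iota> (coord b h *s 1) * \<kappa> b)"
    by (simp add: kappa_sum kappa_scale)
  also have "\<iota> a * \<dots> = (\<Sum>b | coord b h \<noteq> 0. \<iota> (coord b h *s a) * \<kappa> b)"
    using iota_mult[of a "_ *s 1"] by (simp add: sum_distrib_left mult.assoc[symmetric])
  also have "\<dots> = tens (\<lambda>b. coord b h *s a)"
    by (rule tens_superset[symmetric]) (auto simp: finite_representation)
  finally show ?thesis .
qed

lemma RE_I: "finsupp \<alpha> \<Longrightarrow> (\<And>b. \<alpha> b \<in> K) \<Longrightarrow> tens \<alpha> \<in> RE K"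
  by (auto simp: RE_def)

lemma RE_E:
  assumes "e \<in> RE K"
  obtains \<alpha> where "finsupp \<alpha>" "\<And>b. \<alpha> b \<in> K" "e = tens \<alpha>"
  using assms by (auto simp: RE_def)

context
  fixes K assumes K: "subalgebra K"
begin

lemma RE_zero: "0 \<in> RE K"
  using RE_I[of "\<lambda>_. 0" K] subalgebraD[OF K] by (simp add: finsupp_zero)

lemma RE_add: "e \<in> RE K \<Longrightarrow> e' \<in> RE K \<Longrightarrow> e + e' \<in> RE K"
  by (elim RE_E) (auto simp: tens_add[symmetric] intro!: RE_I finsupp_add subalgebraD[OF K])

lemma RE_uminus: "e \<in> RE K \<Longrightarrow> - e \<in> RE K"
  by (elim RE_E) (auto simp: tens_uminus[symmetric] intro!: RE_I finsupp_uminus subalgebraD[OF K])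

lemma RE_sum: "(\<And>i. i \<in> A \<Longrightarrow> f i \<in> RE K) \<Longrightarrow> sum f A \<in> RE K"
  by (induction A rule: infinite_finite_induct) (auto intro: RE_add simp: RE_zero)

lemma RE_iota_kappa: "a \<in> K \<Longrightarrow> \<iota> a * \<kappa> h \<in> RE K"
  by (auto simp: iota_kappa_tens intro!: RE_I finsupp_coord subalgebraD[OF K])

lemma RE_iota: "a \<in> K \<Longrightarrow> \<iota> a \<in> RE K"
  using RE_iota_kappa[of a 1] by (simp add: kappa_one)

lemma RE_one: "1 \<in> RE K"
  using RE_iota[of 1] subalgebraD[OF K] by (simp add: iota_one)

lemma RE_mult: "e \<in> RE K \<Longrightarrow> e' \<in> RE K \<Longrightarrow> e * e' \<in> RE K"
proof (elim RE_E)
  fix \<alpha> \<beta> assume *: "finsupp \<alpha>" "\<And>b. \<alpha> b \<in> K" "e = tens \<alpha>" "finsupp \<beta>" "\<And>b. \<beta> b \<in> K" "e' = tens \<beta>"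
  have eq: "\<iota> a * \<kappa> b * (\<iota> a' * \<kappa> b') = \<iota> (a * a') * \<kappa> (b * b')" for a b a' b'
    using commute[of b a'] by (simp add: iota_mult kappa_mult mult.assoc) (simp flip: mult.assoc)
  have "e * e' = (\<Sum>b | \<alpha> b \<noteq> 0. \<Sum>b' | \<beta> b' \<noteq> 0. \<iota> (\<alpha> b * \<beta> b') * \<kappa> (b * b'))"
    by (simp add: * tens_def sum_product eq)
  also have "\<dots> \<in> RE K"
    using * subalgebraD[OF K] by (auto intro!: RE_sum RE_iota_kappa)
  finally show ?thesis .
qed

end

end

section \<open>The comultiplication on an Ore extension\<close>

text \<open>One step of the tower. The domain hypotheses come from inductions in
  \<open>comult_chain\<close>; \<open>RE_T_no_zero_divisors\<close> hands the one on tensors to the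
  next step.\<close>

locale comult_ore_step = comult_model scale B \<iota> \<kappa> D c \<epsilon>
  for scale :: "'k::field \<Rightarrow> 'h::ring_1 \<Rightarrow> 'h" (infixr \<open>*s\<close> 75)
    and B and \<iota> \<kappa> D :: "'h \<Rightarrow> 'e::ring_1" and c and \<epsilon> :: "'h \<Rightarrow> 'k" +
  fixes R :: "'h set" and x :: 'h and \<sigma> \<delta> :: "'h \<Rightarrow> 'h" and T :: "'h set"
  assumes ore: "ore_extension R x \<sigma> \<delta> T"
    and R_no_zero_divisors: "a \<in> R \<Longrightarrow> b \<in> R \<Longrightarrow> a * b = 0 \<Longrightarrow> a = 0 \<or> b = 0"
    and RE_no_zero_divisors: "e \<in> RE R \<Longrightarrow> e' \<in> RE R \<Longrightarrow> e * e' = 0 \<Longrightarrow> e = 0 \<or> e' = 0"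
    and c_R: "r \<in> R \<Longrightarrow> c b r \<in> R"
    and c_T: "t \<in> T \<Longrightarrow> c b t \<in> T"
begin

lemmas R_T = ore_extension_subalgebra[OF ore]
lemmas R_closed = subalgebraD[OF R_T(1)]

sublocale H: ore_polynomials R x
  by (rule ore_polynomials_ore_extension[OF ore R_no_zero_divisors])

text \<open>The automorphism belonging to R \<otimes> H and x \<otimes> 1 is \<sigma> \<otimes> 1,
  which acts on the coefficients with respect to \<open>B\<close>.\<close>

lemma tens_sigma:
  assumes "finsupp \<alpha>" "\<And>b. \<alpha> b \<in> R"
  shows "finsupp (\<lambda>b. \<sigma> (\<alpha> b))" "tens (\<lambda>b. \<sigma> (\<alpha> b)) \<in> RE R"
    "\<iota> x * tens \<alpha> - tens (\<lambda>b. \<sigma> (\<alpha> b)) * \<iota> x \<in> RE R"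
proof -
  show finsupp: "finsupp (\<lambda>b. \<sigma> (\<alpha> b))"
    by (rule finsupp_subset[OF assms(1)]) (simp add: ore_extension_sigma_0[OF ore])
  then show "tens (\<lambda>b. \<sigma> (\<alpha> b)) \<in> RE R"
    using assms ore_extension_rule[OF ore] by (auto intro: RE_I)
  have "\<iota> x * tens \<alpha> - tens (\<lambda>b. \<sigma> (\<alpha> b)) * \<iota> x = tens (\<lambda>b. x * \<alpha> b - \<sigma> (\<alpha> b) * x)"
    using assms(1) finsupp by (simp add: tens_left_mult tens_right_mult tens_diff finsupp_left_mult finsupp_right_mult)
  moreover have "x * \<alpha> b - \<sigma> (\<alpha> b) * x \<in> R" for b
    using ore_extension_rule[OF ore assms(2)[of b]] by simp
  ultimately show "\<iota> x * tens \<alpha> - tens (\<lambda>b. \<sigma> (\<alpha> b)) * \<iota> x \<in> RE R"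
    using assms(1) finsupp by (auto intro!: RE_I finsupp_diff finsupp_left_mult finsupp_right_mult)
qed

lemma sum_tens_power:
  assumes "\<And>i. finsupp (\<alpha> i)"
  shows "(\<Sum>i<d. tens (\<alpha> i) * \<iota> x ^ i) = tens (\<lambda>b. \<Sum>i<d. \<alpha> i b * x ^ i)"
  using assms by (simp add: tens_sum finsupp_right_mult flip: iota_power tens_right_mult)

sublocale E: ore_polynomials "RE R" "\<iota> x"
proof
  fix e assume "e \<in> RE R" "e \<noteq> 0"
  then obtain \<alpha> where \<alpha>: "finsupp \<alpha>" "\<And>b. \<alpha> b \<in> R" "e = tens \<alpha>" by (auto simp: RE_def)
  have "tens (\<lambda>b. \<sigma> (\<alpha> b)) \<noteq> 0"
  proof
    assume "tens (\<lambda>b. \<sigma> (\<alpha> b)) = 0"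
    then have "\<sigma> (\<alpha> b) = 0" for b using tens_eq_0[OF tens_sigma(1)[OF \<alpha>(1,2)]] by simp
    then have "\<alpha> = (\<lambda>_. 0)" using ore_extension_sigma_eq_0[OF ore \<alpha>(2)] by auto
    with \<open>e \<noteq> 0\<close> \<alpha>(3) show False by simp
  qed
  then show "\<exists>s\<in>RE R. s \<noteq> 0 \<and> \<iota> x * e - s * \<iota> x \<in> RE R"
    using tens_sigma[OF \<alpha>(1,2)] \<alpha>(3) by blast
next
  fix f :: "nat \<Rightarrow> 'e" and d i assume f: "\<And>i. f i \<in> RE R" "(\<Sum>i<d. f i * \<iota> x ^ i) = 0" "i < d"
  have "\<exists>\<alpha>. finsupp \<alpha> \<and> (\<forall>b. \<alpha> b \<in> R) \<and> f i = tens \<alpha>" for i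
    using f(1)[of i] by (auto simp: RE_def)
  then obtain \<alpha> where \<alpha>: "\<And>i. finsupp (\<alpha> i)" "\<And>i b. \<alpha> i b \<in> R" "\<And>i. f i = tens (\<alpha> i)" by metis
  have "tens (\<lambda>b. \<Sum>i<d. \<alpha> i b * x ^ i) = 0"
    using f(2) by (simp add: \<alpha>(3) sum_tens_power[OF \<alpha>(1)])
  then have "(\<Sum>i<d. \<alpha> i b * x ^ i) = 0" for b
    using \<alpha>(1) tens_eq_0[of "\<lambda>b. \<Sum>i<d. \<alpha> i b * x ^ i" b] by (simp add: finsupp_sum finsupp_right_mult)
  then have "\<alpha> i b = 0" for b
    using H.free[of "\<lambda>i. \<alpha> i b" d i] \<alpha>(2) f(3) by simp
  then show "f i = 0" by (simp add: \<alpha>(3) tens_def)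
qed (simp_all add: RE_zero RE_one RE_add RE_uminus RE_mult R_T RE_no_zero_divisors)

lemma H_polys: "H.polys = T"
  by (rule ore_extension_polys[OF ore H.ore_polynomials_axioms])

text \<open>The elements of \<open>B\<close> sit in the second factor and commute with
  \<open>\<iota> x\<close>, so degrees of tensors can be read off coefficient by
  coefficient.\<close>

lemma Pl_tens: "finsupp \<alpha> \<Longrightarrow> tens \<alpha> \<in> E.Pl d \<longleftrightarrow> (\<forall>b. \<alpha> b \<in> H.Pl d)"
proof
  assume \<alpha>: "finsupp \<alpha>" and *: "\<forall>b. \<alpha> b \<in> H.Pl d"
  have "\<iota> a * \<kappa> b \<in> E.Pl d" if "a \<in> H.Pl d" for a b
  proof -
    obtain f where f: "\<And>i. f i \<in> R" "a = (\<Sum>i<d. f i * x ^ i)" using \<open>a \<in> H.Pl d\<close> by (auto simp: H.Pl_def)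
    have "\<iota> a * \<kappa> b = (\<Sum>i<d. (\<iota> (f i) * \<kappa> b) * \<iota> x ^ i)"
      using commute[of b "x ^ _"]
      by (simp add: f(2) iota_sum iota_mult sum_distrib_right mult.assoc flip: iota_power)
    then show ?thesis using f(1) RE_iota_kappa[OF R_T(1)] by (auto intro: E.Pl_I)
  qed
  then show "tens \<alpha> \<in> E.Pl d" unfolding tens_def using * by (intro E.Pl_sum) simp
next
  assume \<alpha>: "finsupp \<alpha>" and "tens \<alpha> \<in> E.Pl d"
  then obtain f where f: "\<And>i. f i \<in> RE R" "tens \<alpha> = (\<Sum>i<d. f i * \<iota> x ^ i)" by (auto simp: E.Pl_def)
  have "\<exists>\<alpha>. finsupp \<alpha> \<and> (\<forall>b. \<alpha> b \<in> R) \<and> f i = tens \<alpha>" for i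
    using f(1)[of i] by (auto simp: RE_def)
  then obtain \<beta> where \<beta>: "\<And>i. finsupp (\<beta> i)" "\<And>i b. \<beta> i b \<in> R" "\<And>i. f i = tens (\<beta> i)" by metis
  have "\<alpha> b = (\<Sum>i<d. \<beta> i b * x ^ i)" for b
    using f(2) \<alpha> \<beta>(1) tens_inject[of \<alpha> "\<lambda>b. \<Sum>i<d. \<beta> i b * x ^ i" b]
    by (simp add: \<beta>(3) sum_tens_power finsupp_sum finsupp_right_mult)
  then show "\<forall>b. \<alpha> b \<in> H.Pl d" using \<beta>(2) by (auto intro: H.Pl_I)
qed

lemma D_Pl_iff: "D h \<in> E.Pl d \<longleftrightarrow> (\<forall>b. c b h \<in> H.Pl d)"
  by (simp add: D_tens Pl_tens finsupp_c)

lemma Pl_scale: "t \<in> H.Pl d \<Longrightarrow> a *s t \<in> H.Pl d"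
  using H.Pl_R_mult[of "a *s 1" t d] R_closed by simp

lemma H_Pl_1: "H.Pl (Suc 0) = R"
  by (auto simp: H.Pl_def)

lemma E_Pl_1: "E.Pl (Suc 0) = RE R"
  by (auto simp: E.Pl_def)

lemma D_R: "r \<in> R \<Longrightarrow> D r \<in> RE R"
  using c_R by (auto simp: D_tens intro: RE_I finsupp_c)

lemma x_has_lead: "H.has_lead 1 1 x"
  using R_closed H.Pl_zero by (simp add: H.has_lead_def)

lemma x_not_R: "x \<notin> R"
  using H.has_lead_less[OF x_has_lead, of "Suc 0"] by (auto simp: H_Pl_1)

lemma RE_T_polys: "RE T \<subseteq> E.polys"
proof
  fix e assume "e \<in> RE T"
  then obtain \<alpha> where \<alpha>: "finsupp \<alpha>" "\<And>b. \<alpha> b \<in> T" "e = tens \<alpha>" by (auto simp: RE_def)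
  then have "\<exists>d. \<alpha> b \<in> H.Pl d" for b using \<alpha>(2)[of b] by (auto simp: H_polys[symmetric] H.polys_def)
  then obtain d where d: "\<And>b. \<alpha> b \<in> H.Pl (d b)" by metis
  \<comment> \<open>The support is finite, so the sum of the individual bounds is a common
    one.\<close>
  have "\<alpha> b \<in> H.Pl (\<Sum>b | \<alpha> b \<noteq> 0. d b)" for b
  proof (cases "\<alpha> b = 0")
    case False
    then have "d b \<le> (\<Sum>b | \<alpha> b \<noteq> 0. d b)" using \<alpha>(1) by (intro member_le_sum) (auto simp: finsupp_def)
    then show ?thesis using d H.Pl_mono by blast
  qed (simp add: H.Pl_zero)
  then show "e \<in> E.polys" using Pl_tens[OF \<alpha>(1)] \<alpha>(3) by (auto simp: E.polys_def)
qed

lemma RE_T_no_zero_divisors: "e \<in> RE T \<Longrightarrow> e' \<in> RE T \<Longrightarrow> e * e' = 0 \<Longrightarrow> e = 0 \<or> e' = 0"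
  using E.polys_no_zero_divisors RE_T_polys by blast

lemma coassoc_Pl:
  assumes "\<And>b. c b h \<in> H.Pl d" "b \<in> B"
  shows "c b' (c b h) \<in> H.Pl d"
proof (cases "b' \<in> B")
  case True
  then show ?thesis using assms by (auto simp: coassoc intro!: H.Pl_sum Pl_scale)
next
  case False
  then show ?thesis using c_B[of b'] H.Pl_zero by metis
qed

text \<open>\<open>D\<close> is a homomorphism mapping \<open>R\<close> into \<open>RE R\<close>, so
  \<open>D t\<close> is a polynomial in \<open>D x\<close> with coefficients in \<open>RE R\<close>;
  the top one is nonzero because \<open>D\<close> is injective. Now \<open>has_lead_eval\<close>
  applies.\<close>

lemma has_lead_D_eval:
  assumes "E.has_lead a q (D x)" "a \<ge> 1" "H.has_lead d r t"
  shows "\<exists>q. E.has_lead (a * d) q (D t)"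
proof -
  obtain f where f: "\<And>i. f i \<in> R" "t - r * x ^ d = (\<Sum>i<d. f i * x ^ i)"
    using assms(3) by (auto simp: H.has_lead_def H.Pl_def)
  let ?f = "\<lambda>i. if i = d then r else f i"
  have "t = (\<Sum>i<Suc d. ?f i * x ^ i)" using f(2) by (simp add: algebra_simps)
  then have "D t = (\<Sum>i<Suc d. D (?f i) * D x ^ i)" by (simp only: D_sum D_mult D_power)
  moreover have "D (?f i) \<in> RE R" for i using f(1) assms(3) D_R by (auto simp: H.has_lead_def)
  moreover have "D (?f d) \<noteq> 0" using assms(3) D_eq_0 by (auto simp: H.has_lead_def)
  ultimately show ?thesis
    using E.has_lead_eval[OF assms(1,2), of "\<lambda>i. D (?f i)" d] by simp
qed

text \<open>
  Let \<open>a\<close> be the degree of \<open>D x\<close> and \<open>c b x\<close> a coefficient of degree \<open>a\<close>. Then \<open>D (c b x)\<close> has degree \<open>a\<^sup>2\<close>,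
  but by coassociativity its coefficients are combinations of those of \<open>D x\<close>.
\<close>

lemma D_x_degree: "\<exists>q. E.has_lead 1 q (D x)"
proof -
  have "D x \<in> RE T" using c_T R_T(4) by (auto simp: D_tens intro: RE_I finsupp_c)
  then obtain e where "D x \<in> E.Pl e" using RE_T_polys by (auto simp: E.polys_def)
  moreover have "D x \<noteq> 0" using D_eq_0[of x] x_not_R R_closed by auto
  ultimately obtain a q where a: "E.has_lead a q (D x)" using E.has_lead_exists by metis
  then have Pl: "\<And>b. c b x \<in> H.Pl (Suc a)" using E.has_lead_Pl D_Pl_iff by blast
  have "D x \<notin> E.Pl a" using E.has_lead_less[OF a] by blast
  then obtain b where b: "c b x \<notin> H.Pl a" using D_Pl_iff by blast
  then have "b \<in> B" using c_B[of b x] H.Pl_zero by metis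
  obtain r where r: "r \<in> R" "c b x - r * x ^ a \<in> H.Pl a" using Pl[of b] by (rule H.Pl_SucE)
  with b have lead: "H.has_lead a r (c b x)" by (auto simp: H.has_lead_def)
  \<comment> \<open>In degree 0 all coefficients of \<open>D x\<close> would lie in
    \<open>R\<close>, and the counit would recover \<open>x\<close> from them.\<close>
  have "a \<ge> 1"
  proof (rule ccontr)
    assume "\<not> a \<ge> 1"
    then have "c b x \<in> R" for b using Pl[of b] H_Pl_1 by (simp add: not_less_eq_eq)
    then have "(\<Sum>b | c b x \<noteq> 0. \<epsilon> b *s c b x) \<in> R"
      using R_closed R_T(1) by (auto intro: subalgebra_sum)
    then show False using x_not_R by (simp add: counit)
  qed
  obtain q' where "E.has_lead (a * a) q' (D (c b x))"
    using has_lead_D_eval[OF a \<open>a \<ge> 1\<close> lead] by blast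
  moreover have "D (c b x) \<in> E.Pl (Suc a)"
    using coassoc_Pl[OF Pl \<open>b \<in> B\<close>] D_Pl_iff by blast
  ultimately have "a * a < Suc a" by (rule E.has_lead_less)
  then have "a * a \<le> a * 1" by (simp only: mult_1_right less_Suc_eq_le)
  then have "a = 1" using \<open>a \<ge> 1\<close> mult_le_cancel1[of a a 1] by linarith
  with a show ?thesis by blast
qed

lemma has_lead_D: "H.has_lead d r t \<Longrightarrow> \<exists>q. E.has_lead d q (D t)"
  using D_x_degree has_lead_D_eval[of 1 _ d r t] by auto

end

section \<open>Comultiplication along the whole tower of Ore extensions\<close>

locale comult_chain = comult_model scale B \<iota> \<kappa> D c \<epsilon>
  for scale :: "'k::field \<Rightarrow> 'h::ring_1 \<Rightarrow> 'h" (infixr \<open>*s\<close> 75)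
    and B and \<iota> \<kappa> D :: "'h \<Rightarrow> 'e::ring_1" and c and \<epsilon> :: "'h \<Rightarrow> 'k" +
  fixes n :: nat and X :: "nat \<Rightarrow> 'h" and \<sigma> \<delta> :: "nat \<Rightarrow> 'h \<Rightarrow> 'h" and K :: "nat \<Rightarrow> 'h set"
  assumes K_0: "K 0 = span {1}" and K_n: "K n = UNIV"
    and c_K: "i \<le> n \<Longrightarrow> h \<in> K i \<Longrightarrow> c b h \<in> K i"
    and ore_K: "i < n \<Longrightarrow> ore_extension (K i) (X (Suc i)) (\<sigma> (Suc i)) (\<delta> (Suc i)) (K (Suc i))"
begin

lemma K_0E:
  assumes "v \<in> K 0"
  obtains a where "v = a *s 1"
  using assms by (auto simp: K_0 span_singleton)

lemma K_no_zero_divisors: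
  "i \<le> n \<Longrightarrow> a \<in> K i \<Longrightarrow> b \<in> K i \<Longrightarrow> a * b = 0 \<Longrightarrow> a = 0 \<or> b = 0"
proof (induction i arbitrary: a b)
  case 0
  then show ?case by (auto elim!: K_0E)
next
  case (Suc i)
  interpret ore_polynomials "K i" "X (Suc i)"
    by (rule ore_polynomials_ore_extension[OF ore_K]) (use Suc in auto)
  show ?case
    using Suc.prems polys_no_zero_divisors ore_extension_polys[OF ore_K ore_polynomials_axioms]
    by auto
qed

lemma kappa_eq_0: "\<kappa> h = 0 \<Longrightarrow> h = 0"
proof -
  assume "\<kappa> h = 0"
  then have "coord b h *s 1 = 0" for b
    using tens_eq_0[OF finsupp_coord[of h 1], of b] iota_kappa_tens[of 1 h] by simp
  then show "h = 0" by (intro coord_eqI) (simp add: representation_zero)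
qed

lemma RE_K_0E:
  assumes "e \<in> RE (K 0)"
  obtains h where "e = \<kappa> h"
proof -
  obtain \<alpha> where \<alpha>: "finsupp \<alpha>" "\<And>b. \<alpha> b \<in> K 0" "e = tens \<alpha>"
    using assms by (auto simp: RE_def)
  then have "\<exists>a. \<alpha> b = a *s 1" for b by (auto elim: K_0E)
  then obtain a where "\<And>b. \<alpha> b = a b *s 1" by metis
  then have "e = \<kappa> (\<Sum>b | \<alpha> b \<noteq> 0. a b *s b)"
    by (simp add: \<alpha>(3) tens_def kappa_sum kappa_scale)
  then show thesis by (rule that)
qed

text \<open>Over the scalars, \<open>RE (K 0)\<close> is a copy of H, which is the top
  \<open>K n\<close> of the tower and thus already known to be a domain. Each further step adjoins
  one variable in the first factor.\<close>

lemma RE_K_no_zero_divisors: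
  "i \<le> n \<Longrightarrow> e \<in> RE (K i) \<Longrightarrow> e' \<in> RE (K i) \<Longrightarrow> e * e' = 0 \<Longrightarrow> e = 0 \<or> e' = 0"
proof (induction i arbitrary: e e')
  case 0
  obtain h h' where h: "e = \<kappa> h" "e' = \<kappa> h'"
    using RE_K_0E[OF 0(2)] RE_K_0E[OF 0(3)] by metis
  then have "h * h' = 0" using 0(4) kappa_eq_0 by (simp add: kappa_mult)
  then show ?case using K_no_zero_divisors[of n h h'] h by (auto simp: K_n)
next
  case (Suc i)
  interpret S: comult_ore_step scale B \<iota> \<kappa> D c \<epsilon> "K i" "X (Suc i)" "\<sigma> (Suc i)" "\<delta> (Suc i)" "K (Suc i)"
  proof
    fix a b assume "a \<in> K i" "b \<in> K i" "a * b = 0"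
    then show "a = 0 \<or> b = 0" using K_no_zero_divisors[of i a b] Suc.prems by simp
  qed (use Suc ore_K[of i] c_K[of i] c_K[of "Suc i"] in auto)
  show ?case using S.RE_T_no_zero_divisors Suc.prems by blast
qed

lemma step:
  "i < n \<Longrightarrow> comult_ore_step scale B \<iota> \<kappa> D c \<epsilon> (K i) (X (Suc i)) (\<sigma> (Suc i)) (\<delta> (Suc i)) (K (Suc i))"
proof unfold_locales
  fix a b assume "i < n" "a \<in> K i" "b \<in> K i" "a * b = 0"
  then show "a = 0 \<or> b = 0" using K_no_zero_divisors[of i a b] by simp
next
  fix e e' assume "i < n" "e \<in> RE (K i)" "e' \<in> RE (K i)" "e * e' = 0"
  then show "e = 0 \<or> e' = 0" using RE_K_no_zero_divisors[of i e e'] by simp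
qed (use ore_K[of i] c_K[of i] c_K[of "Suc i"] in auto)

lemma K_mono: "i \<le> j \<Longrightarrow> j \<le> n \<Longrightarrow> K i \<subseteq> K j"
proof (induction j rule: dec_induct)
  case (step j)
  then have "K i \<subseteq> K j" "K j \<subseteq> K (Suc j)"
    using ore_extension_subalgebra(3)[OF ore_K[of j]] by auto
  then show ?case by blast
qed simp

text \<open>The degrees of \<open>y\<close> and \<open>z\<close> in the last variable add up to the
  degree 0 of 1, so both descend one step, and finally to the scalars.\<close>

lemma unit_scalar: "i \<le> n \<Longrightarrow> y \<in> K i \<Longrightarrow> z \<in> K i \<Longrightarrow> y * z = 1 \<Longrightarrow> y \<in> K 0"
proof (induction i)
  case (Suc i)
  interpret S: comult_ore_step scale B \<iota> \<kappa> D c \<epsilon> "K i" "X (Suc i)" "\<sigma> (Suc i)" "\<delta> (Suc i)" "K (Suc i)"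
    using Suc.prems by (intro step) simp
  obtain d' e' where *: "y \<in> S.H.Pl d'" "z \<in> S.H.Pl e'"
    using Suc.prems by (auto simp: S.H_polys[symmetric] S.H.polys_def)
  have "y \<noteq> 0" "z \<noteq> 0" using Suc.prems(4) by auto
  then obtain d r e s where lead: "S.H.has_lead d r y" "S.H.has_lead e s z"
    using * S.H.has_lead_exists by metis
  then obtain q where "S.H.has_lead (d + e) (r * q) 1"
    using S.H.has_lead_mult[OF lead] Suc.prems(4) by metis
  moreover have "1 \<in> S.H.Pl (Suc 0)" by (simp add: S.H_Pl_1 S.H.one_mem)
  ultimately have "d + e < Suc 0" by (rule S.H.has_lead_less)
  then have "y \<in> K i" "z \<in> K i"
    using S.H.has_lead_Pl[OF lead(1)] S.H.has_lead_Pl[OF lead(2)] by (auto simp: S.H_Pl_1)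
  then show ?case using Suc by simp
qed

context
  fixes i assumes i: "i < n"
begin

abbreviation (input) x where "x \<equiv> X (Suc i)"

interpretation S: comult_ore_step scale B \<iota> \<kappa> D c \<epsilon> "K i" x "\<sigma> (Suc i)" "\<delta> (Suc i)" "K (Suc i)"
  by (rule step[OF i])

text \<open>\<open>tens l\<close> is the leading coefficient of \<open>D x\<close>. The last clause
  compares the coefficients of \<open>\<iota> x\<close> in \<open>D (c b x)\<close>:
  multiplicativity of \<open>D\<close> gives one side and coassociativity the other. Once the
  \<open>l b\<close> are known to be scalars, it turns into the group-like equation in
  \<open>comult_X\<close>.\<close>

lemma comult_lead:
  "\<exists>l. finsupp l \<and> (\<forall>b. l b \<in> K i) \<and> tens l \<noteq> 0 \<and>
     (\<forall>b. c b x - l b * x \<in> K i) \<and> (\<forall>b. c b x = 0 \<longrightarrow> l b = 0) \<and>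
     (\<forall>b\<in>B. D (l b) * tens l = tens (\<lambda>b'. \<Sum>b'' | c b'' x \<noteq> 0. coord b' (c b b'') *s l b''))"
proof -
  obtain q where q: "S.E.has_lead 1 q (D x)" using S.D_x_degree by blast
  then have "q \<in> RE (K i)" by (simp add: S.E.has_lead_def)
  then obtain l where l: "finsupp l" "\<And>b. l b \<in> K i" "q = tens l"
    by (auto simp: RE_def)
  have "tens (\<lambda>b. c b x - l b * x) = D x - q * \<iota> x"
    by (simp add: D_tens l tens_right_mult tens_diff finsupp_c finsupp_right_mult)
  also have "\<dots> \<in> S.E.Pl 1" using q by (simp add: S.E.has_lead_def)
  finally have rem: "c b x - l b * x \<in> K i" for b
    by (simp add: S.Pl_tens finsupp_diff finsupp_c finsupp_right_mult l S.H_Pl_1)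
  \<comment> \<open>Hence a sum over the \<open>b\<close> with \<open>c b x \<noteq> 0\<close> omits
    no nonzero \<open>l b\<close>.\<close>
  have supp: "l b = 0" if "c b x = 0" for b
    using S.H.monom_Pl_zero[of "l b" 1] rem[of b] that l(2) S.H.uminus_mem[of "- (l b * x)"]
    by (simp add: S.H_Pl_1)
  have "D (l b) * q = tens (\<lambda>b'. \<Sum>b'' | c b'' x \<noteq> 0. coord b' (c b b'') *s l b'')"
    (is "_ = tens ?G") if b: "b \<in> B" for b
  proof -
    have G: "finsupp ?G" by (rule finsupp_sum) (rule finsupp_coord)
    have "?G b' \<in> K i" for b'
      using l(2) S.R_T(1) S.R_closed by (auto intro!: subalgebra_sum)
    then have GR: "tens ?G \<in> RE (K i)" using G by (auto intro: RE_I)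
    \<comment> \<open>The coefficient according to multiplicativity of \<open>D\<close>.\<close>
    have "D (c b x) - (D (l b) * q) * \<iota> x = D (l b) * (D x - q * \<iota> x) + D (c b x - l b * x)"
      by (simp add: D_diff D_mult algebra_simps)
    also have "\<dots> \<in> S.E.Pl 1"
      using q l(2) S.D_R[OF rem[of b]] S.D_R[of "l b"] S.E_Pl_1
      by (auto simp: S.E.has_lead_def intro!: S.E.Pl_add S.E.Pl_R_mult)
    finally have 1: "D (c b x) - (D (l b) * q) * \<iota> x \<in> S.E.Pl 1" .
    \<comment> \<open>The coefficient according to coassociativity.\<close>
    have "c b' (c b x) - ?G b' * x \<in> K i" for b'
    proof (cases "b' \<in> B")
      case True
      have "c b' (c b x) - ?G b' * x = (\<Sum>b'' | c b'' x \<noteq> 0. coord b' (c b b'') *s (c b'' x - l b'' * x))"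
        using coassoc[OF b True, of x]
        by (simp add: sum_distrib_right scale_mult_left scale_right_diff_distrib sum_subtractf)
      then show ?thesis using rem S.R_T(1) S.R_closed by (auto intro!: subalgebra_sum)
    next
      case False
      then have "coord b' v = 0" for v using representation_ne_zero[of B v b'] by blast
      moreover have "c b' v = 0" for v using c_B[of b' v] False by blast
      ultimately show ?thesis using S.R_closed by simp
    qed
    then have "tens (\<lambda>b'. c b' (c b x) - ?G b' * x) \<in> S.E.Pl 1"
      using G S.Pl_tens by (simp add: finsupp_diff finsupp_c finsupp_right_mult S.H_Pl_1)
    then have "D (c b x) - tens ?G * \<iota> x \<in> S.E.Pl 1"
      using G by (simp add: tens_diff tens_right_mult D_tens finsupp_c finsupp_right_mult)
    from S.E.Pl_diff[OF this 1] have "(D (l b) * q - tens ?G) * \<iota> x ^ 1 \<in> S.E.Pl 1"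
      by (simp add: algebra_simps)
    moreover have "D (l b) * q - tens ?G \<in> RE (K i)"
      using S.E.diff_mem S.E.mult_mem GR S.D_R[OF l(2)] q by (simp add: S.E.has_lead_def)
    ultimately show ?thesis using S.E.monom_Pl_zero by fastforce
  qed
  then show ?thesis using l q rem supp by (intro exI[of _ l]) (auto simp: S.E.has_lead_def)
qed

text \<open>
  Let \<open>m\<close> be the largest degree of the \<open>l b\<close> in the last variable that occurs in them. In the hypothesis
  \<open>lead\<close>, the left-hand side has degree \<open>2 m\<close> for a suitable \<open>b\<close>, the right-hand side at most \<open>m\<close>.
\<close>

lemma comult_lead_scalar:
  assumes "finsupp l" "\<And>b. l b \<in> K i" "tens l \<noteq> 0"
    and lead: "\<And>b. b \<in> B \<Longrightarrow>
       D (l b) * tens l = tens (\<lambda>b'. \<Sum>b'' | c b'' x \<noteq> 0. coord b' (c b b'') *s l b'')"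
  shows "l b \<in> K 0"
proof -
  define j where "j = (LEAST j. \<forall>b. l b \<in> K j)"
  have j: "l b \<in> K j" for b
    using LeastI[of "\<lambda>j. \<forall>b. l b \<in> K j" i] assms(2) by (auto simp: j_def)
  have "j \<le> i" unfolding j_def using assms(2) by (intro Least_le) auto
  have "j = 0"
  proof (rule ccontr)
    assume "j \<noteq> 0"
    then obtain j' where j': "j = Suc j'" using not0_implies_Suc by blast
    interpret J: comult_ore_step scale B \<iota> \<kappa> D c \<epsilon> "K j'" "X (Suc j')" "\<sigma> (Suc j')" "\<delta> (Suc j')" "K (Suc j')"
      using i \<open>j \<le> i\<close> by (intro step) (simp add: j')
    have "\<not> (\<forall>b. l b \<in> K j')"
      using not_less_Least[of j' "\<lambda>j. \<forall>b. l b \<in> K j"] j' by (auto simp: j_def)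
    then have notPl: "tens l \<notin> J.E.Pl 1" using J.Pl_tens[OF assms(1)] by (simp add: J.H_Pl_1)
    have "tens l \<in> J.E.polys" using J.RE_T_polys RE_I[OF assms(1) j] by (auto simp: j')
    then obtain m q where m: "J.E.has_lead m q (tens l)"
      using assms(3) J.E.has_lead_exists by (metis J.E.polys_def UN_E)
    then have Pl: "l b \<in> J.H.Pl (Suc m)" for b
      using J.E.has_lead_Pl J.Pl_tens[OF assms(1)] by blast
    have "m \<ge> 1" using notPl J.E.has_lead_Pl[OF m] by (cases m) auto
    obtain b where b: "l b \<notin> J.H.Pl m"
      using J.E.has_lead_less[OF m, of m] J.Pl_tens[OF assms(1)] by blast
    then have "l b \<noteq> 0" using J.H.Pl_zero by metis
    then have "b \<in> B" using assms(1) by (auto simp: finsupp_def)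
    obtain r where r: "r \<in> K j'" "l b - r * X (Suc j') ^ m \<in> J.H.Pl m"
      using Pl[of b] by (rule J.H.Pl_SucE)
    with b have "J.H.has_lead m r (l b)" by (auto simp: J.H.has_lead_def)
    then obtain q' where "J.E.has_lead m q' (D (l b))" using J.has_lead_D by blast
    then obtain q'' where "J.E.has_lead (m + m) q'' (D (l b) * tens l)"
      using J.E.has_lead_mult[OF _ m] by metis
    moreover have "D (l b) * tens l \<in> J.E.Pl (Suc m)"
      unfolding lead[OF \<open>b \<in> B\<close>] using Pl
      by (subst J.Pl_tens) (auto intro!: finsupp_sum finsupp_coord J.H.Pl_sum J.Pl_scale)
    ultimately have "m + m < Suc m" by (rule J.E.has_lead_less)
    with \<open>m \<ge> 1\<close> show False by simp
  qed
  with j show ?thesis by simp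
qed

text \<open>Coordinate form, for a basis containing 1, of the fact that \<Delta>(x) - x \<otimes> 1
  lies in \<open>K i\<close> \<otimes> H. The scalars \<open>a b\<close> assemble to an element
  \<open>y\<close> with \<open>tens l = \<kappa> y\<close>, and the proof identifies
  \<open>y\<close> with 1.\<close>

lemma comult_X: "c b x - (if b = 1 then x else 0) \<in> K i"
proof -
  obtain l where l: "finsupp l" "\<And>b. l b \<in> K i" "tens l \<noteq> 0"
    and rem: "\<And>b. c b x - l b * x \<in> K i" and supp: "\<And>b. c b x = 0 \<Longrightarrow> l b = 0"
    and lead: "\<And>b. b \<in> B \<Longrightarrow>
       D (l b) * tens l = tens (\<lambda>b'. \<Sum>b'' | c b'' x \<noteq> 0. coord b' (c b b'') *s l b'')"
    using comult_lead by blast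
  have "\<exists>a. l b = a *s 1" for b using comult_lead_scalar[OF l lead] K_0E by metis
  then obtain a where a: "\<And>b. l b = a b *s 1" by metis
  let ?A = "{b. c b x \<noteq> 0}"
  have A: "finite ?A" "?A \<subseteq> B" using c_finite c_B by auto
  have a0: "a b = 0" if "b \<notin> ?A" for b using supp[of b] a[of b] that by simp
  define y where "y = (\<Sum>b\<in>?A. a b *s b)"
  have coord_y: "coord b y = a b" for b
  proof -
    have "coord b y = (\<Sum>b'\<in>?A. a b' * (if b = b' then 1 else 0))"
      using A(2) by (auto simp: y_def coord_sum coord_scale coord_basis intro!: sum.cong)
    also have "\<dots> = (if b \<in> ?A then a b else 0)" using A(1) by (simp add: if_distrib cong: if_cong)
    finally show ?thesis using a0 by auto
  qed
  \<comment> \<open>Over all of \<open>B\<close> this says \<Delta>(y) = y \<otimes> y.\<close>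
  have "c b y = coord b y *s y" if b: "b \<in> B" for b
  proof (rule coord_eqI)
    fix b' assume "b' \<in> B"
    have "tens (\<lambda>b'. a b *s l b') = D (l b) * tens l"
      using l(1) by (simp add: a D_scalar tens_left_mult mult.commute)
    also have "\<dots> = tens (\<lambda>b'. \<Sum>b''\<in>?A. coord b' (c b b'') *s l b'')" by (rule lead[OF b])
    finally have eq: "tens (\<lambda>b'. a b *s l b') = tens (\<lambda>b'. \<Sum>b''\<in>?A. coord b' (c b b'') *s l b'')" .
    have "finsupp (\<lambda>b'. a b *s l b')" by (rule finsupp_subset[OF l(1)]) simp
    then have "a b *s l b' = (\<Sum>b''\<in>?A. coord b' (c b b'') *s l b'')"
      by (rule tens_inject[OF _ _ eq]) (intro finsupp_sum finsupp_coord)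
    then have "(a b * a b') *s 1 = (\<Sum>b''\<in>?A. coord b' (c b b'') * a b'') *s (1 :: 'h)"
      by (simp add: a scale_sum_left)
    then have "a b * a b' = (\<Sum>b''\<in>?A. coord b' (c b b'') * a b'')" by simp
    then show "coord b' (c b y) = coord b' (coord b y *s y)"
      by (simp add: coord_scale coord_y) (simp add: y_def c_sum c_scale coord_sum coord_scale mult.commute)
  qed
  moreover have "y \<noteq> 0"
  proof
    assume "y = 0"
    then have "l = (\<lambda>_. 0)" using coord_y by (auto simp: a representation_zero)
    then show False using l(3) by simp
  qed
  ultimately obtain z where "y * z = 1" using grouplike_unit by blast
  then have "y \<in> K 0" using unit_scalar[of n y z] by (simp add: K_n)
  then obtain u where "y = u *s 1" by (rule K_0E)
  then have l_eq: "l b = (if b = 1 then u *s 1 else 0)" for b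
    using coord_y[of b] by (cases "b = 1") (simp_all add: a coord_scale coord_basis one_B)
  \<comment> \<open>Applying the counit in the second factor leaves (1 - u) x in \<open>K i\<close>,
    where no nonzero multiple of \<open>x\<close> lies; so u = 1.\<close>
  have "(\<Sum>b\<in>?A. \<epsilon> b *s (c b x - l b * x)) \<in> K i"
    using rem S.R_T(1) S.R_closed by (auto intro!: subalgebra_sum)
  also have "(\<Sum>b\<in>?A. \<epsilon> b *s (c b x - l b * x)) = x - (\<Sum>b\<in>?A. \<epsilon> b *s l b * x)"
    using counit[of x] by (simp add: scale_right_diff_distrib sum_subtractf scale_mult_left)
  also have "(\<Sum>b\<in>?A. \<epsilon> b *s l b * x) = (\<Sum>b\<in>?A. if b = 1 then u *s x else 0)"
    by (rule sum.cong) (auto simp: l_eq eps_one)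
  also have "\<dots> = u *s x" using A(1) supp[of 1] by (auto simp: l_eq)
  finally have "(1 - u) *s x \<in> K i" by (simp add: scale_left_diff_distrib)
  then have "((1 - u) *s 1) * x ^ 1 \<in> S.H.Pl 1" by (simp add: S.H_Pl_1)
  then have "(1 - u) *s (1 :: 'h) = 0" using S.H.monom_Pl_zero[of "(1 - u) *s 1" 1] S.R_closed by simp
  then have "u = 1" by simp
  then show ?thesis using rem[of b] by (auto simp: l_eq)
qed

lemma comult_sigma:
  assumes r: "r \<in> K i"
  shows "c b (\<sigma> (Suc i) r) = \<sigma> (Suc i) (c b r)"
proof -
  let ?s = "\<sigma> (Suc i)"
  have one: "\<iota> x = tens (\<lambda>b. if b = 1 then x else 0)" and finsupp1: "finsupp (\<lambda>b. if b = 1 then x else 0)"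
  proof -
    have eq: "(\<lambda>b. coord b 1 *s x) = (\<lambda>b. if b = 1 then x else 0)"
      by (auto simp: coord_basis one_B)
    show "\<iota> x = tens (\<lambda>b. if b = 1 then x else 0)"
      using iota_kappa_tens[of x 1] by (simp add: eq kappa_one)
    show "finsupp (\<lambda>b. if b = 1 then x else 0)" using finsupp_coord[of 1 x] by (simp add: eq)
  qed
  have "D x - \<iota> x = tens (\<lambda>b. c b x - (if b = 1 then x else 0))"
    by (simp add: D_tens one tens_diff finsupp_c finsupp1)
  also have "\<dots> \<in> RE (K i)" using comult_X by (intro RE_I finsupp_diff finsupp_c finsupp1)
  finally have w: "D x - \<iota> x \<in> RE (K i)" .
  note rule = ore_extension_rule[OF S.ore r]
  note sig = S.tens_sigma[OF finsupp_c, of r, OF S.c_R[OF r]]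
  have eq: "D x * D r = D (?s r) * D x + D (\<delta> (Suc i) r)"
    using rule(1) by (metis D_add D_mult)
  \<comment> \<open>Replacing \<open>D x\<close> by \<open>\<iota> x\<close> costs only elements of
    \<open>RE (K i)\<close>, so the two candidates for the coefficient of \<open>\<iota> x\<close>
    agree modulo degree 0.\<close>
  have "(D (?s r) - tens (\<lambda>b. ?s (c b r))) * \<iota> x =
      (\<iota> x * D r - tens (\<lambda>b. ?s (c b r)) * \<iota> x) + (D x - \<iota> x) * D r - D (?s r) * (D x - \<iota> x)
      - D (\<delta> (Suc i) r)"
    using eq by (simp add: algebra_simps)
  also have "\<dots> \<in> RE (K i)"
  proof -
    have "\<iota> x * D r - tens (\<lambda>b. ?s (c b r)) * \<iota> x \<in> RE (K i)" using sig(3) by (simp add: D_tens)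
    moreover have "(D x - \<iota> x) * D r \<in> RE (K i)" using w S.D_R[OF r] by (rule S.E.mult_mem)
    moreover have "D (?s r) * (D x - \<iota> x) \<in> RE (K i)" using S.D_R[OF rule(2)] w by (rule S.E.mult_mem)
    moreover have "D (\<delta> (Suc i) r) \<in> RE (K i)" using rule(3) by (rule S.D_R)
    ultimately show ?thesis using S.E.diff_mem S.E.add_mem by presburger
  qed
  finally have "(D (?s r) - tens (\<lambda>b. ?s (c b r))) * \<iota> x ^ 1 \<in> S.E.Pl 1" by (simp add: S.E_Pl_1)
  moreover have "D (?s r) - tens (\<lambda>b. ?s (c b r)) \<in> RE (K i)"
    using sig(2) S.D_R rule by (intro S.E.diff_mem) auto
  ultimately have "D (?s r) = tens (\<lambda>b. ?s (c b r))" using S.E.monom_Pl_zero by fastforce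
  then show ?thesis unfolding D_tens by (rule tens_inject[OF finsupp_c sig(1)])
qed

end

end

section \<open>The two models given by a Hopf algebra\<close>

lemma linearD:
  assumes "Vector_Spaces.linear s1 s2 f"
  shows "f (x + y) = f x + f y" "f (s1 c x) = s2 c (f x)"
proof -
  interpret Vector_Spaces.linear s1 s2 f by fact
  show "f (x + y) = f x + f y" "f (s1 c x) = s2 c (f x)" by (rule add, rule scale)
qed

context k_algebra
begin

text \<open>Taking \<open>u\<close> and \<open>v\<close> to be the two projections, in either order,
  yields the expansion of a tensor along a basis of its second or of its first factor with a single
  proof.\<close>

definition tcoef :: "'h set \<Rightarrow> ('p \<Rightarrow> 'h) \<Rightarrow> ('p \<Rightarrow> 'h) \<Rightarrow> 'h \<Rightarrow> ('p \<Rightarrow>\<^sub>0 'k) \<Rightarrow> 'h" where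
  "tcoef B u v b t = lin_ext scale (\<lambda>x. scale (representation B (v x) b) (u x)) t"

lemma tcoef_notin: "b \<notin> B \<Longrightarrow> tcoef B u v b t = 0"
  using representation_ne_zero[of B _ b] by (fastforce simp: tcoef_def lin_ext_def intro!: sum.neutral)

lemma
  assumes B: "independent B" "span B = UNIV"
  shows finite_tcoef: "finite {b. tcoef B u v b t \<noteq> 0}"
    and lin_ext_tcoef: "bilinear_map scale s' \<beta> \<Longrightarrow>
      lin_ext s' (\<lambda>x. \<beta> (u x) (v x)) t = (\<Sum>b | tcoef B u v b t \<noteq> 0. \<beta> (tcoef B u v b t) b)"
proof -
  let ?F = "\<Union>x\<in>Poly_Mapping.keys t. {b. representation B (v x) b \<noteq> 0}"
  let ?r = "\<lambda>b x. representation B (v x) b"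
  have F: "finite ?F" by (simp add: finite_representation)
  have "tcoef B u v b t = 0" if "b \<notin> ?F" for b
    using that by (auto simp: tcoef_def lin_ext_def intro!: sum.neutral)
  then have sub: "{b. tcoef B u v b t \<noteq> 0} \<subseteq> ?F" by blast
  show "finite {b. tcoef B u v b t \<noteq> 0}" by (rule finite_subset[OF sub F])
  assume \<beta>: "bilinear_map scale s' \<beta>"
  interpret V: vector_space s' using bilinear_vector_space[OF \<beta>] by simp
  have lin: "Vector_Spaces.linear scale s' (\<beta> a)" "Vector_Spaces.linear scale s' (\<lambda>a. \<beta> a b)" for a b
    using \<beta> by (auto simp: bilinear_map_def)
  interpret l: Vector_Spaces.linear scale s' "\<beta> a" for a by (rule lin)
  interpret r: Vector_Spaces.linear scale s' "\<lambda>a. \<beta> a b" for b by (rule lin)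
  have "(\<Sum>b | tcoef B u v b t \<noteq> 0. \<beta> (tcoef B u v b t) b) = (\<Sum>b\<in>?F. \<beta> (tcoef B u v b t) b)"
    by (rule sum.mono_neutral_left[OF F sub]) (simp add: r.zero)
  also have "\<dots> = (\<Sum>b\<in>?F. \<Sum>x\<in>Poly_Mapping.keys t. s' (Poly_Mapping.lookup t x) (s' (?r b x) (\<beta> (u x) b)))"
    by (simp add: tcoef_def lin_ext_def r.sum r.scale)
  also have "\<dots> = (\<Sum>x\<in>Poly_Mapping.keys t. \<Sum>b\<in>?F. s' (Poly_Mapping.lookup t x) (s' (?r b x) (\<beta> (u x) b)))"
    by (rule sum.swap)
  also have "\<dots> = (\<Sum>x\<in>Poly_Mapping.keys t. s' (Poly_Mapping.lookup t x) (\<beta> (u x) (v x)))"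
  proof (rule sum.cong[OF refl])
    fix x assume x: "x \<in> Poly_Mapping.keys t"
    have "(\<Sum>b\<in>?F. scale (?r b x) b) = (\<Sum>b | ?r b x \<noteq> 0. scale (?r b x) b)"
      by (rule sum.mono_neutral_right[OF F]) (use x in auto)
    also have "\<dots> = v x" by (rule sum_nonzero_representation_eq) (simp_all add: B)
    finally have "\<beta> (u x) (v x) = \<beta> (u x) (\<Sum>b\<in>?F. scale (?r b x) b)" by simp
    then show "(\<Sum>b\<in>?F. s' (Poly_Mapping.lookup t x) (s' (?r b x) (\<beta> (u x) b))) =
        s' (Poly_Mapping.lookup t x) (\<beta> (u x) (v x))"
      by (simp add: l.sum l.scale V.scale_sum_right)
  qed
  finally show "lin_ext s' (\<lambda>x. \<beta> (u x) (v x)) t = (\<Sum>b | tcoef B u v b t \<noteq> 0. \<beta> (tcoef B u v b t) b)"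
    by (simp add: lin_ext_def)
qed

text \<open>The map \<epsilon> \<circ> \<sigma> is linear only on the domain of \<sigma>, whereas a
  representative of a coproduct may involve elements outside of it. A linear extension to H can be
  applied to any representative.\<close>

lemma linear_extension:
  assumes K: "subspace K" and f: "\<And>a b. a \<in> K \<Longrightarrow> b \<in> K \<Longrightarrow> f (a + b) = f a + f b"
    "\<And>c a. a \<in> K \<Longrightarrow> f (scale c a) = c * f a"
  obtains g where "Vector_Spaces.linear scale (*) g" "\<And>v. v \<in> K \<Longrightarrow> g v = f v"
proof -
  interpret P: vector_space_pair scale "(*) :: 'k \<Rightarrow> 'k \<Rightarrow> 'k"
    by unfold_locales (auto simp: algebra_simps)
  obtain C where C: "C \<subseteq> K" "independent C" "K \<subseteq> span C"
    using basis_exists by metis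
  obtain g where g: "Vector_Spaces.linear scale (*) g" "\<forall>x\<in>C. g x = f x"
    using P.linear_independent_extend[OF C(2)] by blast
  interpret g: Vector_Spaces.linear scale "(*)" g by (rule g(1))
  have "f 0 = 0" using f(2)[of 0 0] K by (simp add: subspace_0)
  have "v \<in> K \<and> g v = f v" if "v \<in> span C" for v
    using that
  proof (induction rule: span_induct_alt)
    case base
    then show ?case using \<open>f 0 = 0\<close> K by (simp add: subspace_0 g.zero)
  next
    case (step c x y)
    then have "x \<in> K" using C(1) by blast
    then have "scale c x \<in> K" using K by (rule_tac subspace_scale)
    then show ?case using step g(2) K f \<open>x \<in> K\<close> by (simp add: subspace_add g.add g.scale)
  qed
  with g(1) C(3) that show thesis by blast
qed

definition left_mult :: "'h \<Rightarrow> 'h endo" where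
  "left_mult a = Abs_endo (\<lambda>F i. a * F i)"

lemma left_mult_apply [simp]: "endo_apply (left_mult a) F i = a * F i"
  by (simp add: left_mult_def Abs_endo_inverse distrib_left)

lemma left_mult_hom:
  "left_mult (a + b) = left_mult a + left_mult b" "left_mult (a * b) = left_mult a * left_mult b"
  "left_mult 1 = 1"
  by (auto intro!: endo_eqI simp: plus_endo.rep_eq times_endo.rep_eq one_endo.rep_eq algebra_simps)

definition endo_scale :: "'k \<Rightarrow> 'h endo \<Rightarrow> 'h endo" where
  "endo_scale a e = left_mult (a *s 1) * e"

lemma vector_space_endo_scale: "vector_space endo_scale"
  by standard
    (simp_all add: endo_scale_def left_mult_hom scale_left_distrib algebra_simps flip: mult.assoc left_mult_hom(2))

end

section \<open>The ring of operators that contains the tensor square\<close>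

locale pointed_algebra = k_algebra scale
  for scale :: "'k::field \<Rightarrow> 'h::ring_1 \<Rightarrow> 'h" (infixr \<open>*s\<close> 75) +
  fixes B :: "'h set" and \<epsilon> :: "'h \<Rightarrow> 'k"
  assumes indep: "independent B" and span_B: "span B = UNIV" and one_B: "1 \<in> B"
    and eps_add: "\<epsilon> (x + y) = \<epsilon> x + \<epsilon> y" and eps_mult: "\<epsilon> (x * y) = \<epsilon> x * \<epsilon> y"
    and eps_scale: "\<epsilon> (c *s x) = c * \<epsilon> x" and eps_one: "\<epsilon> 1 = 1"
begin

interpretation P: vector_space_pair scale scale ..

abbreviation "evB \<equiv> P.construct B"

lemma linear_evB: "Vector_Spaces.linear scale scale (evB F)"
  by (rule P.linear_construct[OF indep])

lemma evB_basis: "b \<in> B \<Longrightarrow> evB F b = F b"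
  by (rule P.construct_basis[OF indep])

lemma evB_eq: "Vector_Spaces.linear scale scale g \<Longrightarrow> (\<And>b. b \<in> B \<Longrightarrow> g b = F b) \<Longrightarrow> evB F v = g v"
  by (rule P.linear_eq_on[OF linear_evB, where B = B]) (simp_all add: span_B evB_basis)

lemma linear_left: "Vector_Spaces.linear scale scale g \<Longrightarrow> Vector_Spaces.linear scale scale (\<lambda>v. a * g v)"
  by (rule linearI') (simp_all add: vector_space_axioms linearD distrib_left scale_mult_right)

lemma linear_right: "Vector_Spaces.linear scale scale g \<Longrightarrow> Vector_Spaces.linear scale scale (\<lambda>v. g (v * a))"
  by (rule linearI') (simp_all add: vector_space_axioms linearD distrib_right scale_mult_left)

text \<open>
  Functions on \<open>B\<close> represent linear maps \<open>f\<close> on \<open>H\<close>, and \<open>right_mult h\<close> sends \<open>f\<close> to \<open>f(\<cdot> h)\<close>. The values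
  outside of \<open>B\<close> are irrelevant; the counit is used there to make \<open>right_mult\<close> a unital homomorphism.
\<close>

definition right_mult :: "'h \<Rightarrow> 'h endo" where
  "right_mult h = Abs_endo (\<lambda>F i. if i \<in> B then evB F (i * h) else \<epsilon> h *s F i)"

lemma right_mult_apply:
  "endo_apply (right_mult h) F i = (if i \<in> B then evB F (i * h) else \<epsilon> h *s F i)"
  unfolding right_mult_def
  by (subst Abs_endo_inverse) (auto simp: P.construct_add[OF indep] scale_right_distrib fun_eq_iff)

lemma right_mult_hom:
  "right_mult (a + b) = right_mult a + right_mult b"
  "right_mult (a * b) = right_mult a * right_mult b"
  "right_mult 1 = 1"
proof -
  show "right_mult (a + b) = right_mult a + right_mult b"
    by (rule endo_eqI)
       (simp add: right_mult_apply plus_endo.rep_eq distrib_left linearD[OF linear_evB] eps_add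
          scale_left_distrib)
  show "right_mult (a * b) = right_mult a * right_mult b"
  proof (rule endo_eqI)
    fix F i
    have "evB (endo_apply (right_mult b) F) (i * a) = evB F (i * a * b)"
      by (rule evB_eq[OF linear_right[OF linear_evB]]) (simp add: right_mult_apply)
    then show "endo_apply (right_mult (a * b)) F i = endo_apply (right_mult a * right_mult b) F i"
      by (simp add: times_endo.rep_eq right_mult_apply eps_mult mult.assoc)
  qed
  show "right_mult 1 = 1"
    by (rule endo_eqI) (simp add: right_mult_apply one_endo.rep_eq evB_basis eps_one)
qed

lemma right_mult_scalar: "right_mult (a *s 1) = left_mult (a *s 1)"
  by (rule endo_eqI)
    (simp add: right_mult_apply evB_basis eps_scale eps_one linearD[OF linear_evB])

lemma right_left_commute: "right_mult b * left_mult a = left_mult a * right_mult b"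
proof (rule endo_eqI)
  fix F i
  have "evB (endo_apply (left_mult a) F) v = a * evB F v" for v
    by (rule evB_eq[OF linear_left[OF linear_evB]]) (simp add: evB_basis)
  then show "endo_apply (right_mult b * left_mult a) F i = endo_apply (left_mult a * right_mult b) F i"
    by (simp add: times_endo.rep_eq right_mult_apply scale_mult_right)
qed

text \<open>Applied to the indicator function of \<open>b\<close> and evaluated at 1, the operator
  sum returns \<open>\<alpha> b\<close>.\<close>

lemma left_free:
  assumes "finite F" "F \<subseteq> B" "(\<Sum>b\<in>F. left_mult (\<alpha> b) * right_mult b) = 0" "b \<in> F"
  shows "\<alpha> b = 0"
proof -
  let ?u = "\<lambda>j. if j = b then 1 else 0 :: 'h"
  have "0 = endo_apply (\<Sum>b\<in>F. left_mult (\<alpha> b) * right_mult b) ?u 1"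
    by (simp add: assms(3) zero_endo.rep_eq)
  also have "\<dots> = (\<Sum>b'\<in>F. \<alpha> b' * ?u b')"
    unfolding endo_apply_sum
    by (rule sum.cong) (use assms(2) one_B in \<open>auto simp: times_endo.rep_eq right_mult_apply evB_basis\<close>)
  also have "\<dots> = \<alpha> b" using assms(1,4) by (simp add: if_distrib cong: if_cong)
  finally show ?thesis by simp
qed

lemma linear_coord: "Vector_Spaces.linear scale scale (\<lambda>v. representation B v j *s u)"
  by (rule linearI')
    (simp_all add: vector_space_axioms representation_add representation_scale indep span_B scale_left_distrib)

text \<open>Applied to the indicator function of \<open>j\<close> and evaluated at 1, the operator
  sum returns a linear combination of \<open>F\<close> whose coefficients are the coordinates of the
  \<open>\<alpha> b\<close> at \<open>j\<close>. Independence of \<open>B\<close> makes all of them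
  vanish.\<close>

lemma right_free:
  assumes "finite F" "F \<subseteq> B" "(\<Sum>b\<in>F. right_mult (\<alpha> b) * left_mult b) = 0" "b \<in> F"
  shows "\<alpha> b = 0"
proof -
  have coord: "representation B (\<alpha> b) j = 0" if j: "j \<in> B" for j
  proof -
    let ?u = "\<lambda>i. if i = j then 1 else 0 :: 'h"
    have ev: "evB (\<lambda>i. h * ?u i) v = representation B v j *s h" for h v
      by (rule evB_eq[OF linear_coord]) (simp add: representation_basis indep)
    have "0 = endo_apply (\<Sum>b\<in>F. right_mult (\<alpha> b) * left_mult b) ?u 1"
      by (simp add: assms(3) zero_endo.rep_eq)
    also have "\<dots> = (\<Sum>b\<in>F. representation B (\<alpha> b) j *s b)"
      unfolding endo_apply_sum
      by (rule sum.cong) (simp_all add: times_endo.rep_eq right_mult_apply one_B ev left_mult_apply[abs_def])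
    finally show ?thesis
      using independentD[OF indep assms(1,2) _ assms(4), of "\<lambda>b. representation B (\<alpha> b) j"] by simp
  qed
  have "representation B (\<alpha> b) j = 0" for j
    using coord[of j] representation_ne_zero[of B "\<alpha> b" j] by blast
  moreover have "(\<Sum>j | representation B (\<alpha> b) j \<noteq> 0. representation B (\<alpha> b) j *s j) = \<alpha> b"
    by (rule sum_nonzero_representation_eq) (simp_all add: indep span_B)
  ultimately show ?thesis by simp
qed

text \<open>The embedding of the tensor square. Its injectivity is not stated as such;
  \<open>left_free\<close> and \<open>right_free\<close> express it for expansions along a basis of
  either factor.\<close>

definition Phi :: "('h \<times> 'h \<Rightarrow>\<^sub>0 'k) \<Rightarrow> 'h endo" where
  "Phi t = lin_ext endo_scale (\<lambda>(a, b). left_mult a * right_mult b) t"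

lemma left_mult_scale: "left_mult (c *s a) = endo_scale c (left_mult a)"
  and right_mult_scale: "right_mult (c *s a) = endo_scale c (right_mult a)"
proof -
  have "left_mult (c *s a) = left_mult ((c *s 1) * a)" "right_mult (c *s a) = right_mult ((c *s 1) * a)"
    by simp_all
  then show "left_mult (c *s a) = endo_scale c (left_mult a)"
    "right_mult (c *s a) = endo_scale c (right_mult a)"
    by (simp_all only: endo_scale_def left_mult_hom right_mult_hom right_mult_scalar)
qed

lemma endo_scale_mult:
  "endo_scale c (left_mult a) * right_mult b = endo_scale c (left_mult a * right_mult b)"
  "left_mult a * endo_scale c (right_mult b) = endo_scale c (left_mult a * right_mult b)"
  by (simp_all add: endo_scale_def mult.assoc)
    (simp flip: mult.assoc left_mult_hom(2))

lemma bilinear_left_right: "bilinear_map scale endo_scale (\<lambda>a b. left_mult a * right_mult b)"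
  by (rule bilinear_mapI)
    (simp_all add: vector_space_axioms vector_space_endo_scale left_mult_hom(1) right_mult_hom(1)
      left_mult_scale right_mult_scale endo_scale_mult ring_distribs)

lemma Phi_eqI: "tensor2_eq scale s t \<Longrightarrow> Phi s = Phi t"
  unfolding Phi_def by (rule lin_ext_tensor2_eq[OF bilinear_left_right])

lemma linear_Phi: "Vector_Spaces.linear fscale endo_scale Phi"
  unfolding Phi_def[abs_def] by (rule vector_space.linear_lin_ext[OF vector_space_endo_scale])

lemma Phi_pure: "Phi (pure (a, b)) = left_mult a * right_mult b"
  by (simp add: Phi_def vector_space.lin_ext_pure[OF vector_space_endo_scale])

text \<open>Both sides are bilinear in \<open>s\<close> and \<open>t\<close>, and for pure tensors
  the claim is that left and right multiplications commute.\<close>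

lemma Phi_tensor2_mult: "Phi (tensor2_mult s t) = Phi s * Phi t"
proof -
  have lin: "Vector_Spaces.linear endo_scale endo_scale (\<lambda>e. e * e')" for e'
    by (rule linearI') (simp_all add: vector_space_endo_scale distrib_right endo_scale_def mult.assoc)
  have lin': "Vector_Spaces.linear endo_scale endo_scale (\<lambda>e. left_mult a * right_mult b * e)" for a b
  proof (rule linearI')
    fix c e
    have "left_mult a * right_mult b * left_mult (c *s 1) = left_mult (c *s 1) * (left_mult a * right_mult b)"
      by (simp add: mult.assoc right_left_commute) (simp flip: mult.assoc left_mult_hom(2))
    then show "left_mult a * right_mult b * endo_scale c e = endo_scale c (left_mult a * right_mult b * e)"
      by (simp add: endo_scale_def flip: mult.assoc)
  qed (simp_all add: vector_space_endo_scale distrib_left)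
  have eq: "left_mult (a * a') * right_mult (b * b') = left_mult a * right_mult b * (left_mult a' * right_mult b')"
    for a a' b b'
    using right_left_commute[of b a'] by (simp add: left_mult_hom right_mult_hom mult.assoc) (simp flip: mult.assoc)
  have inner: "Phi (lin_ext fscale (\<lambda>(c, d). pure (a * c, b * d)) t) = left_mult a * right_mult b * Phi t" for a b
  proof -
    have "Phi (lin_ext fscale (\<lambda>(c, d). pure (a * c, b * d)) t) =
        lin_ext endo_scale (\<lambda>x. Phi (case x of (c, d) \<Rightarrow> pure (a * c, b * d))) t"
      by (rule linear_lin_ext_comp[OF linear_Phi])
    also have "\<dots> = lin_ext endo_scale
        (\<lambda>x. left_mult a * right_mult b * (case x of (c, d) \<Rightarrow> left_mult c * right_mult d)) t"
      by (rule vector_space.lin_ext_cong[OF vector_space_endo_scale]) (auto simp: Phi_pure eq)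
    also have "\<dots> = left_mult a * right_mult b * Phi t"
      unfolding Phi_def by (rule linear_lin_ext_comp[OF lin', symmetric])
    finally show ?thesis .
  qed
  show ?thesis
    unfolding tensor2_mult_def linear_lin_ext_comp[OF linear_Phi]
    unfolding Phi_def[of s] linear_lin_ext_comp[OF lin]
    by (intro arg_cong2[where f = "lin_ext endo_scale"]) (auto simp: inner)
qed

end

context hopf_algebra
begin

text \<open>With 1 in the basis, the coefficient belonging to 1 in the other tensor factor is just
  the one at \<open>b = 1\<close>.\<close>

definition unit_basis :: "'h set" where
  "unit_basis = extend_basis {1}"

sublocale U: pointed_algebra scale unit_basis \<epsilon>
proof
  have "independent {1 :: 'h}" by simp
  then show "independent unit_basis" "span unit_basis = UNIV" "1 \<in> unit_basis"
    using extend_basis_superset[of "{1}"] by (auto simp: unit_basis_def independent_extend_basis)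
qed (rule counit_add counit_mult counit_scale counit_one)+

abbreviation coord :: "'h \<Rightarrow> 'h \<Rightarrow> 'k" where
  "coord b v \<equiv> representation unit_basis v b"

lemma coord_linear:
  "coord b (x + y) = coord b x + coord b y" "coord b (c *s x) = c * coord b x"
  by (simp_all add: representation_add representation_scale U.indep U.span_B)

definition D :: "'h \<Rightarrow> 'h endo" where
  "D h = U.Phi (\<Delta> h)"

text \<open>The coordinate of \<open>b\<close> is applied to the second factor of \<Delta>(h);
  \<open>cL\<close> applies it to the first.\<close>

definition cR :: "'h \<Rightarrow> 'h \<Rightarrow> 'h" where
  "cR b h = tcoef unit_basis fst snd b (\<Delta> h)"

definition cL :: "'h \<Rightarrow> 'h \<Rightarrow> 'h" where
  "cL b h = tcoef unit_basis snd fst b (\<Delta> h)"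

text \<open>These slices depend only on the tensor, so any representative may be used; for a Hopf
  subalgebra one takes a representative supported in it.\<close>

lemma cR_eq: "tensor2_eq scale (\<Delta> h) t \<Longrightarrow> cR b h = lin_ext scale (\<lambda>(p, q). coord b q *s p) t"
proof -
  have "bilinear_map scale scale (\<lambda>p q. coord b q *s p)"
    by (rule bilinear_mapI) (simp_all add: vector_space_axioms coord_linear algebra_simps)
  then show "tensor2_eq scale (\<Delta> h) t \<Longrightarrow> ?thesis"
    using lin_ext_tensor2_eq by (fastforce simp: cR_def tcoef_def case_prod_unfold)
qed

lemma cL_eq: "tensor2_eq scale (\<Delta> h) t \<Longrightarrow> cL b h = lin_ext scale (\<lambda>(p, q). coord b p *s q) t"
proof -
  have "bilinear_map scale scale (\<lambda>p q. coord b p *s q)"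
    by (rule bilinear_mapI) (simp_all add: vector_space_axioms coord_linear algebra_simps)
  then show "tensor2_eq scale (\<Delta> h) t \<Longrightarrow> ?thesis"
    using lin_ext_tensor2_eq by (fastforce simp: cL_def tcoef_def case_prod_unfold)
qed

lemma tensor2_eq_refl: "tensor2_eq scale t t"
  by (simp add: tensor2_eq_def tensor2_null_def free_vs.span_zero)

lemma linear_cR: "Vector_Spaces.linear scale scale (cR b)"
proof (rule linearI')
  fix x y c
  show "cR b (x + y) = cR b x + cR b y"
    by (subst cR_eq[OF comult_add]) (simp add: lin_ext_add cR_eq[OF tensor2_eq_refl])
  show "cR b (c *s x) = c *s cR b x"
    by (subst cR_eq[OF comult_scale]) (simp add: lin_ext_fscale cR_eq[OF tensor2_eq_refl])
qed (rule vector_space_axioms)+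

lemma linear_cL: "Vector_Spaces.linear scale scale (cL b)"
proof (rule linearI')
  fix x y c
  show "cL b (x + y) = cL b x + cL b y"
    by (subst cL_eq[OF comult_add]) (simp add: lin_ext_add cL_eq[OF tensor2_eq_refl])
  show "cL b (c *s x) = c *s cL b x"
    by (subst cL_eq[OF comult_scale]) (simp add: lin_ext_fscale cL_eq[OF tensor2_eq_refl])
qed (rule vector_space_axioms)+

lemma expand_R:
  "bilinear_map scale s' \<beta> \<Longrightarrow>
    lin_ext s' (\<lambda>(p, q). \<beta> p q) (\<Delta> h) = (\<Sum>b | cR b h \<noteq> 0. \<beta> (cR b h) b)"
  using lin_ext_tcoef[OF U.indep U.span_B, of s' \<beta> fst snd "\<Delta> h"] by (simp add: cR_def case_prod_unfold)

lemma expand_L: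
  assumes "bilinear_map scale s' \<beta>"
  shows "lin_ext s' (\<lambda>(p, q). \<beta> p q) (\<Delta> h) = (\<Sum>b | cL b h \<noteq> 0. \<beta> b (cL b h))"
proof -
  have "bilinear_map scale s' (\<lambda>p q. \<beta> q p)" using assms by (simp add: bilinear_map_def)
  then show ?thesis
    using lin_ext_tcoef[OF U.indep U.span_B, of s' "\<lambda>p q. \<beta> q p" snd fst "\<Delta> h"]
    by (simp add: cL_def case_prod_unfold)
qed

lemma lin_ext_triple:
  "lin_ext scale (\<lambda>(a, b, c). \<beta> a b c)
      (lin_ext fscale (\<lambda>(a, b). lin_ext fscale (\<lambda>(a1, a2). pure (a1, a2, b)) (\<Delta> a)) s) =
    lin_ext scale (\<lambda>(a, b). lin_ext scale (\<lambda>(a1, a2). \<beta> a1 a2 b) (\<Delta> a)) s"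
  "lin_ext scale (\<lambda>(a, b, c). \<beta> a b c)
      (lin_ext fscale (\<lambda>(a, b). lin_ext fscale (\<lambda>(b1, b2). pure (a, b1, b2)) (\<Delta> b)) s) =
    lin_ext scale (\<lambda>(a, b). lin_ext scale (\<lambda>(b1, b2). \<beta> a b1 b2) (\<Delta> b)) s"
  by (simp_all add: linear_lin_ext_comp[OF linear_lin_ext] case_prod_unfold)

text \<open>Both sides apply the coordinates of \<open>b'\<close> and \<open>b\<close> to the last
  two factors of the threefold coproduct of \<open>h\<close>: once it is formed by splitting the
  first factor again, once by splitting the second.\<close>

lemma coassoc_R:
  "cR b' (cR b h) = (\<Sum>b'' | cR b'' h \<noteq> 0. coord b' (cR b b'') *s cR b'' h)"
proof -
  let ?\<beta> = "\<lambda>p q r. (coord b' q * coord b r) *s p"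
  have "cR b' (cR b h) = lin_ext scale (\<lambda>(p, q). cR b' (coord b q *s p)) (\<Delta> h)"
    by (simp add: cR_eq[OF tensor2_eq_refl, of b h] linear_lin_ext_comp[OF linear_cR] case_prod_unfold)
  also have "\<dots> = lin_ext scale (\<lambda>(p, q). lin_ext scale (\<lambda>(p1, p2). ?\<beta> p1 p2 q) (\<Delta> p)) (\<Delta> h)"
    by (intro lin_ext_cong)
      (auto simp: linearD(2)[OF linear_cR] cR_eq[OF tensor2_eq_refl, of b'] case_prod_unfold
        intro!: lin_ext_scaled[symmetric])
  also have "\<dots> = lin_ext scale (\<lambda>(p, q). lin_ext scale (\<lambda>(q1, q2). ?\<beta> p q1 q2) (\<Delta> q)) (\<Delta> h)"
    unfolding lin_ext_triple[symmetric]
    by (rule lin_ext_tensor3_eq[OF vector_space_axioms _ _ _ coassoc])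
      (auto intro!: linearI' simp: vector_space_axioms coord_linear algebra_simps)
  also have "\<dots> = lin_ext scale (\<lambda>(p, q). coord b' (cR b q) *s p) (\<Delta> h)"
  proof (intro lin_ext_cong, clarify)
    fix p q
    have "Vector_Spaces.linear scale scale (\<lambda>v. coord b' v *s p)"
      by (rule linearI') (simp_all add: vector_space_axioms coord_linear algebra_simps)
    note linear_lin_ext_comp[OF this, simp]
    show "lin_ext scale (\<lambda>(q1, q2). ?\<beta> p q1 q2) (\<Delta> q) = coord b' (cR b q) *s p"
      by (simp add: cR_eq[OF tensor2_eq_refl, of b q] coord_linear case_prod_unfold mult.commute)
  qed
  also have "\<dots> = (\<Sum>b'' | cR b'' h \<noteq> 0. coord b' (cR b b'') *s cR b'' h)"
    by (rule expand_R)
      (rule bilinear_mapI, simp_all add: vector_space_axioms coord_linear linearD[OF linear_cR] algebra_simps)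
  finally show ?thesis .
qed

lemma coassoc_L:
  "cL b' (cL b h) = (\<Sum>b'' | cL b'' h \<noteq> 0. coord b' (cL b b'') *s cL b'' h)"
proof -
  let ?\<beta> = "\<lambda>p q r. (coord b p * coord b' q) *s r"
  have "cL b' (cL b h) = lin_ext scale (\<lambda>(p, q). cL b' (coord b p *s q)) (\<Delta> h)"
    by (simp add: cL_eq[OF tensor2_eq_refl, of b h] linear_lin_ext_comp[OF linear_cL] case_prod_unfold)
  also have "\<dots> = lin_ext scale (\<lambda>(p, q). lin_ext scale (\<lambda>(q1, q2). ?\<beta> p q1 q2) (\<Delta> q)) (\<Delta> h)"
    by (intro lin_ext_cong)
      (auto simp: linearD(2)[OF linear_cL] cL_eq[OF tensor2_eq_refl, of b'] case_prod_unfold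
        intro!: lin_ext_scaled[symmetric])
  also have "\<dots> = lin_ext scale (\<lambda>(p, q). lin_ext scale (\<lambda>(p1, p2). ?\<beta> p1 p2 q) (\<Delta> p)) (\<Delta> h)"
    unfolding lin_ext_triple[symmetric]
    by (rule lin_ext_tensor3_eq[OF vector_space_axioms _ _ _ coassoc, symmetric])
      (auto intro!: linearI' simp: vector_space_axioms coord_linear algebra_simps)
  also have "\<dots> = lin_ext scale (\<lambda>(p, q). coord b' (cL b p) *s q) (\<Delta> h)"
  proof (intro lin_ext_cong, clarify)
    fix p q
    have "Vector_Spaces.linear scale scale (\<lambda>v. coord b' v *s q)"
      by (rule linearI') (simp_all add: vector_space_axioms coord_linear algebra_simps)
    note linear_lin_ext_comp[OF this, simp]
    show "lin_ext scale (\<lambda>(p1, p2). ?\<beta> p1 p2 q) (\<Delta> p) = coord b' (cL b p) *s q"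
      by (simp add: cL_eq[OF tensor2_eq_refl, of b p] coord_linear case_prod_unfold mult.commute)
  qed
  also have "\<dots> = (\<Sum>b'' | cL b'' h \<noteq> 0. coord b' (cL b b'') *s cL b'' h)"
    by (rule expand_L)
      (rule bilinear_mapI, simp_all add: vector_space_axioms coord_linear linearD[OF linear_cL] algebra_simps)
  finally show ?thesis .
qed

lemma bilinear_antipode: "bilinear_map scale scale (\<lambda>p q. p * S q)"
  by (rule bilinear_mapI)
    (simp_all add: vector_space_axioms antipode_add antipode_scale ring_distribs scale_mult_left scale_mult_right)

lemma bilinear_counit_right: "bilinear_map scale scale (\<lambda>p q. \<epsilon> q *s p)"
  and bilinear_counit_left: "bilinear_map scale scale (\<lambda>p q. \<epsilon> p *s q)"
  by (rule bilinear_mapI; simp add: vector_space_axioms counit_add counit_scale algebra_simps)+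

text \<open>With either slice the hypothesis amounts to \<Delta>(y) = y \<otimes> y, a symmetric
  tensor. The counit then gives \<epsilon>(y) = 1, and the antipode gives y S(y) = 1.\<close>

lemma grouplike_invertible:
  assumes y: "y \<noteq> 0" and c: "c = cR \<or> c = cL" and gl: "\<And>b. b \<in> unit_basis \<Longrightarrow> c b y = coord b y *s y"
  shows "\<exists>z. y * z = 1"
proof -
  have notin: "c b y = 0" "coord b y = 0" if "b \<notin> unit_basis" for b
    using c tcoef_notin[OF that] representation_ne_zero[of unit_basis y b] that
    by (auto simp: cR_def cL_def)
  then have gl: "c b y = coord b y *s y" for b using gl by (cases "b \<in> unit_basis") auto
  then have supp: "{b. c b y \<noteq> 0} = {b. coord b y \<noteq> 0}" using y by auto
  have y_eq: "(\<Sum>b | coord b y \<noteq> 0. coord b y *s b) = y"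
    by (rule sum_nonzero_representation_eq) (simp_all add: U.indep U.span_B)
  have expand: "lin_ext scale (\<lambda>(p, q). \<beta> p q) (\<Delta> y) = \<beta> y y" if "bilinear_map scale scale \<beta>" for \<beta>
  proof -
    have lin: "Vector_Spaces.linear scale scale (\<beta> a)" "Vector_Spaces.linear scale scale (\<lambda>a. \<beta> a b)" for a b
      using that by (auto simp: bilinear_map_def)
    interpret l: Vector_Spaces.linear scale scale "\<beta> a" for a by (rule lin)
    interpret r: Vector_Spaces.linear scale scale "\<lambda>a. \<beta> a b" for b by (rule lin)
    let ?Z = "\<Sum>b | coord b y \<noteq> 0. coord b y *s b"
    have "lin_ext scale (\<lambda>(p, q). \<beta> p q) (\<Delta> y) = \<beta> y ?Z \<or> lin_ext scale (\<lambda>(p, q). \<beta> p q) (\<Delta> y) = \<beta> ?Z y"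
      using c expand_R[OF that, of y] expand_L[OF that, of y] gl supp
      by (auto simp: l.sum r.sum l.scale r.scale)
    then show ?thesis by (simp add: y_eq)
  qed
  have "\<epsilon> y *s y = y" using expand[OF bilinear_counit_right] counit_right by simp
  then have "(\<epsilon> y - 1) *s y = 0" by (simp add: scale_left_diff_distrib)
  then have "\<epsilon> y = 1" using y by simp
  then have "y * S y = 1" using expand[OF bilinear_antipode] antipode_right by simp
  then show ?thesis by blast
qed

lemma D_hom: "D (x + y) = D x + D y" "D (x * y) = D x * D y" "D 1 = 1" "D (a *s 1) = left_mult (a *s 1)"
proof -
  have one: "U.Phi (\<Delta> 1) = 1"
    using U.Phi_eqI[OF comult_one] by (simp add: U.Phi_pure left_mult_hom U.right_mult_hom)
  show "D (x + y) = D x + D y"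
    using U.Phi_eqI[OF comult_add] linearD(1)[OF U.linear_Phi] by (simp add: D_def)
  show "D (x * y) = D x * D y"
    using U.Phi_eqI[OF comult_mult] by (simp add: D_def U.Phi_tensor2_mult)
  show "D 1 = 1" by (simp add: D_def one)
  show "D (a *s 1) = left_mult (a *s 1)"
    using U.Phi_eqI[OF comult_scale, of a 1] linearD(2)[OF U.linear_Phi] one
    by (simp add: D_def endo_scale_def)
qed

lemma comult_model_R: "comult_model scale unit_basis left_mult U.right_mult D cR \<epsilon>"
proof
  fix h b
  show "finite {b. cR b h \<noteq> 0}" unfolding cR_def by (rule finite_tcoef[OF U.indep U.span_B])
  show "cR b h \<noteq> 0 \<Longrightarrow> b \<in> unit_basis" using tcoef_notin unfolding cR_def by blast
  show "D h = (\<Sum>b | cR b h \<noteq> 0. left_mult (cR b h) * U.right_mult b)"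
    unfolding D_def U.Phi_def by (rule expand_R[OF U.bilinear_left_right])
  show "(\<Sum>b | cR b h \<noteq> 0. \<epsilon> b *s cR b h) = h"
    using expand_R[OF bilinear_counit_right, of h] counit_right[of h] by simp
  fix y :: 'h assume "\<And>b. b \<in> unit_basis \<Longrightarrow> cR b y = coord b y *s y" "y \<noteq> 0"
  then show "\<exists>z. y * z = 1" using grouplike_invertible[of y cR] by blast
next
  fix b b' h
  show "cR b' (cR b h) = (\<Sum>b'' | cR b'' h \<noteq> 0. coord b' (cR b b'') *s cR b'' h)"
    by (rule coassoc_R)
qed (erule (3) U.left_free | simp add: U.one_B U.indep U.span_B left_mult_hom U.right_mult_hom D_hom
    U.right_mult_scalar U.right_left_commute counit_one)+

lemma comult_model_L: "comult_model scale unit_basis U.right_mult left_mult D cL \<epsilon>"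
proof
  fix h b
  show "finite {b. cL b h \<noteq> 0}" unfolding cL_def by (rule finite_tcoef[OF U.indep U.span_B])
  show "cL b h \<noteq> 0 \<Longrightarrow> b \<in> unit_basis" using tcoef_notin unfolding cL_def by blast
  show "D h = (\<Sum>b | cL b h \<noteq> 0. U.right_mult (cL b h) * left_mult b)"
    unfolding D_def U.Phi_def by (subst expand_L[OF U.bilinear_left_right]) (simp add: U.right_left_commute)
  show "(\<Sum>b | cL b h \<noteq> 0. \<epsilon> b *s cL b h) = h"
    using expand_L[OF bilinear_counit_left, of h] counit_left[of h] by simp
  fix y :: 'h assume "\<And>b. b \<in> unit_basis \<Longrightarrow> cL b y = coord b y *s y" "y \<noteq> 0"
  then show "\<exists>z. y * z = 1" using grouplike_invertible[of y cL] by blast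
next
  fix b b' h
  show "cL b' (cL b h) = (\<Sum>b'' | cL b'' h \<noteq> 0. coord b' (cL b b'') *s cL b'' h)"
    by (rule coassoc_L)
qed (erule (3) U.right_free | simp add: U.one_B U.indep U.span_B left_mult_hom U.right_mult_hom D_hom
    U.right_mult_scalar U.right_left_commute counit_one)+

end

section \<open>Triangularity of the automorphisms of an iterated Hopf Ore extension\<close>

context ihoe
begin

text \<open>The first variable is adjoined with the identity and the zero derivation, which gives
  all steps of the tower the same shape.\<close>

definition \<sigma>' :: "nat \<Rightarrow> 'h \<Rightarrow> 'h" where
  "\<sigma>' i = (if i = 1 then (\<lambda>r. r) else \<sigma> i)"

definition \<delta>' :: "nat \<Rightarrow> 'h \<Rightarrow> 'h" where
  "\<delta>' i = (if i = 1 then (\<lambda>r. 0) else \<delta> i)"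

lemma H_sub_0: "H_sub 0 = span {1}"
  by (simp add: H_sub_def gen_subalgebra_empty)

lemma ore_extension_H_sub:
  assumes "i < n"
  shows "ore_extension (H_sub i) (X (Suc i)) (\<sigma>' (Suc i)) (\<delta>' (Suc i)) (H_sub (Suc i))"
proof (cases "i = 0")
  case True
  then show ?thesis using polynomial_1 assms by (simp add: \<sigma>'_def[abs_def] \<delta>'_def[abs_def])
next
  case False
  then show ?thesis using ore_step[of "Suc i"] assms by (simp add: \<sigma>'_def[abs_def] \<delta>'_def[abs_def])
qed

lemma H_sub_comult:
  assumes "i \<le> n" "h \<in> H_sub i"
  obtains t where "Poly_Mapping.keys t \<subseteq> H_sub i \<times> H_sub i" "tensor2_eq scale (\<Delta> h) t"
proof (cases "i = 0")
  \<comment> \<open>The scalars are not among the assumed Hopf subalgebras, but the coproduct of a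
    scalar is a multiple of 1 \<otimes> 1.\<close>
  case True
  have one: "1 \<in> H_sub 0" by (simp add: H_sub_0 span_base)
  obtain a where a: "h = a *s 1" using assms(2) True by (auto simp: H_sub_0 span_singleton)
  have "tensor2_eq scale (\<Delta> h) (fscale a (pure (1, 1)))"
  proof -
    have "\<Delta> (a *s 1) - fscale a (\<Delta> 1) + fscale a (\<Delta> 1 - pure (1, 1)) \<in> tensor2_null scale"
      using comult_scale[of a 1] comult_one unfolding tensor2_eq_def tensor2_null_def
      by (intro free_vs.span_add free_vs.span_scale)
    then show ?thesis by (simp add: a tensor2_eq_def free_vs.scale_right_diff_distrib)
  qed
  moreover have "Poly_Mapping.keys (fscale a (pure (1 :: 'h, 1 :: 'h))) \<subseteq> {(1, 1)}"
    by (auto simp: in_keys_iff lookup_single when_def split: if_splits)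
  then have "Poly_Mapping.keys (fscale a (pure (1, 1))) \<subseteq> H_sub i \<times> H_sub i"
    using one True by auto
  ultimately show thesis using that by blast
next
  case False
  then show thesis using that H_sub_hopf[of i] assms unfolding hopf_subalgebra_def by force
qed

lemma subspace_H_sub: "subspace (H_sub i)"
  using subalgebra_gen_subalgebra subalgebraD(1) by (simp add: H_sub_def)

sublocale right: comult_chain scale unit_basis left_mult U.right_mult D cR \<epsilon> n X \<sigma>' \<delta>' H_sub
proof (intro comult_chain.intro comult_model_R comult_chain_axioms.intro)
  fix i h b assume "i \<le> n" "h \<in> H_sub i"
  then obtain t where "Poly_Mapping.keys t \<subseteq> H_sub i \<times> H_sub i" "tensor2_eq scale (\<Delta> h) t"
    by (rule H_sub_comult)
  then show "cR b h \<in> H_sub i"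
    using subspace_H_sub
    by (auto simp: cR_eq intro!: lin_ext_mem_subspace subspace_scale)
qed (simp_all add: H_sub_0 H_sub_n ore_extension_H_sub)

sublocale left: comult_chain scale unit_basis U.right_mult left_mult D cL \<epsilon> n X \<sigma>' \<delta>' H_sub
proof (intro comult_chain.intro comult_model_L comult_chain_axioms.intro)
  fix i h b assume "i \<le> n" "h \<in> H_sub i"
  then obtain t where "Poly_Mapping.keys t \<subseteq> H_sub i \<times> H_sub i" "tensor2_eq scale (\<Delta> h) t"
    by (rule H_sub_comult)
  then show "cL b h \<in> H_sub i"
    using subspace_H_sub
    by (auto simp: cL_eq intro!: lin_ext_mem_subspace subspace_scale)
qed (simp_all add: H_sub_0 H_sub_n ore_extension_H_sub)

text \<open>
  \<open>\<sigma>(r) = (\<chi> \<otimes> 1)(\<Delta> r)\<close> for an extension \<open>\<chi>\<close> of \<open>\<epsilon> \<circ> \<sigma>\<close>; the left-hand side of this identity is expanded along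
  the basis in the second factor, the right-hand side along the basis in the first one.
\<close>

lemma sigma_triangular:
  assumes "j < i" "i < n"
  shows "\<sigma>' (Suc i) (X (Suc j)) - X (Suc j) \<in> H_sub j"
proof -
  let ?s = "\<sigma>' (Suc i)" and ?r = "X (Suc j)"
  let ?A = "insert 1 {b. cL b ?r \<noteq> 0}"
  have K: "subalgebra (H_sub k)" for k by (simp add: H_sub_def subalgebra_gen_subalgebra)
  note ore = ore_extension_H_sub[OF assms(2)]
  have aut: "algebra_automorphism (H_sub i) ?s" using ore by (simp add: ore_extension_def)
  have r: "?r \<in> H_sub i"
    using ore_extension_H_sub[of j] assms right.K_mono[of "Suc j" i] by (auto simp: ore_extension_def)
  obtain \<chi> where \<chi>: "Vector_Spaces.linear scale (*) \<chi>" "\<And>v. v \<in> H_sub i \<Longrightarrow> \<chi> v = \<epsilon> (?s v)"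
    by (rule linear_extension[OF subspace_H_sub[of i], of "\<lambda>v. \<epsilon> (?s v)"])
      (use aut in \<open>auto simp: algebra_automorphism_def linear_on_sub_def counit_add counit_scale\<close>)
  have \<chi>1: "\<chi> 1 = 1"
    using \<chi>(2)[of 1] subalgebraD(2)[OF K] aut counit_one by (simp add: algebra_automorphism_def)
  have bil: "bilinear_map scale scale (\<lambda>p q. \<chi> p *s q)"
    by (rule bilinear_mapI) (simp_all add: vector_space_axioms linearD[OF \<chi>(1)] algebra_simps)
  have cR_r: "cR b ?r \<in> H_sub i" for b using right.c_K[of i ?r b] r assms(2) by simp
  \<comment> \<open>The counit in the first factor recovers \<open>?s ?r\<close>, and
    \<open>comult_sigma\<close> moves the automorphism onto the slices of \<open>?r\<close>, where
    \<chi> is its composite with \<epsilon>.\<close>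
  have "?s ?r = (\<Sum>b | cR b (?s ?r) \<noteq> 0. \<epsilon> (cR b (?s ?r)) *s b)"
    using expand_R[OF bilinear_counit_left, of "?s ?r"] counit_left[of "?s ?r"] by simp
  also have "\<dots> = (\<Sum>b | cR b ?r \<noteq> 0. \<chi> (cR b ?r) *s b)"
    using cR_r by (intro sum.cong)
      (simp_all add: right.comult_sigma[OF assms(2) r] ore_extension_sigma_eq_0[OF ore] \<chi>(2))
  also have "\<dots> = lin_ext scale (\<lambda>(p, q). \<chi> p *s q) (\<Delta> ?r)"
    by (rule expand_R[OF bil, symmetric])
  also have "\<dots> = (\<Sum>b | cL b ?r \<noteq> 0. \<chi> b *s cL b ?r)"
    by (rule expand_L[OF bil])
  \<comment> \<open>The index 1 is added explicitly so that \<open>?r\<close> can be split off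
    there.\<close>
  also have "\<dots> = (\<Sum>b\<in>insert 1 {b. cL b ?r \<noteq> 0}. \<chi> b *s cL b ?r)"
    by (rule sum.mono_neutral_left) (auto simp: left.c_finite)
  finally have s_eq: "?s ?r = (\<Sum>b\<in>?A. \<chi> b *s cL b ?r)" .
  have "(\<Sum>b\<in>?A. \<chi> b *s (if b = 1 then ?r else 0)) = (\<Sum>b\<in>?A. if b = 1 then ?r else 0)"
    by (rule sum.cong) (auto simp: \<chi>1)
  also have "\<dots> = ?r" by (simp add: left.c_finite)
  finally have "?s ?r - ?r = (\<Sum>b\<in>?A. \<chi> b *s (cL b ?r - (if b = 1 then ?r else 0)))"
    by (simp only: s_eq scale_right_diff_distrib sum_subtractf)
  \<comment> \<open>In the exchanged model, \<open>comult_X\<close> puts every bracket into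
    \<open>H_sub j\<close>.\<close>
  also have "\<dots> \<in> H_sub j"
    using left.comult_X[of j] assms by (intro subspace_sum subspace_scale subspace_H_sub) simp
  finally show ?thesis .
qed

end

section \<open>Filtrations with commutative associated graded algebra\<close>

locale almost_commuting = k_algebra scale
  for scale :: "'k::field \<Rightarrow> 'h::ring_1 \<Rightarrow> 'h" (infixr \<open>*s\<close> 75) +
  fixes n :: nat and X :: "nat \<Rightarrow> 'h" and d :: "nat \<Rightarrow> nat"
  assumes d_pos: "i \<in> {1..n} \<Longrightarrow> d i > 0"
    and commutator: "i \<in> {1..n} \<Longrightarrow> j \<in> {1..n} \<Longrightarrow> j < i \<Longrightarrow>
      X i * X j - X j * X i \<in> pbw_filtration n X d (d i + d j - 1)"
begin

abbreviation C :: "nat \<Rightarrow> 'h set" where "C \<equiv> pbw_filtration n X d"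

definition word :: "nat list \<Rightarrow> 'h" where "word xs = prod_list (map X xs)"

definition weight :: "nat list \<Rightarrow> nat" where "weight xs = sum_list (map d xs)"

text \<open>Unlike the span of the ordered monomials, the span of all words is visibly multiplicative.\<close>

definition W :: "nat \<Rightarrow> 'h set" where
  "W r = span {word xs | xs. set xs \<subseteq> {1..n} \<and> weight xs \<le> r}"

definition std_word :: "(nat \<Rightarrow> nat) \<Rightarrow> nat list" where
  "std_word m = concat (map (\<lambda>i. replicate (m i) i) [1..<Suc n])"

lemma word_append: "word (xs @ ys) = word xs * word ys"
  by (simp add: word_def)

lemma word_Cons: "word (x # xs) = X x * word xs"
  by (simp add: word_def)

lemma weight_append: "weight (xs @ ys) = weight xs + weight ys"
  by (simp add: weight_def)

lemma weight_Cons: "weight (x # xs) = d x + weight xs"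
  by (simp add: weight_def)

lemma word_std_word: "word (std_word m) = ordered_monomial n X m"
proof -
  have "prod_list (map X (replicate k i)) = X i ^ k" for k i by (induction k) auto
  then have "prod_list (map X (concat (map (\<lambda>i. replicate (m i) i) is))) = prod_list (map (\<lambda>i. X i ^ m i) is)" for "is"
    by (induction "is") auto
  then show ?thesis by (simp add: word_def std_word_def ordered_monomial_def del: upt_Suc)
qed

lemma weight_std_word: "weight (std_word m) = (\<Sum>i=1..n. m i * d i)"
proof -
  have "sum_list (map d (concat (map (\<lambda>i. replicate (m i) i) is))) = sum_list (map (\<lambda>i. m i * d i) is)" for "is"
    by (induction "is") (auto simp: sum_list_replicate)
  then have "weight (std_word m) = sum_list (map (\<lambda>i. m i * d i) [1..<Suc n])"
    by (simp add: weight_def std_word_def del: upt_Suc)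
  also have "\<dots> = (\<Sum>i=1..n. m i * d i)"
    by (simp add: interv_sum_list_conv_sum_set_nat atLeastLessThanSuc_atLeastAtMost del: upt_Suc)
  finally show ?thesis .
qed

lemma set_std_word: "set (std_word m) \<subseteq> {1..n}"
  by (auto simp: std_word_def)

lemma sorted_std_word: "sorted (std_word m)"
proof -
  have "sorted (concat (map (\<lambda>i. replicate (m i) i) [1..<k]))" for k
    by (induction k) (auto simp: sorted_append)
  then show ?thesis by (simp add: std_word_def del: upt_Suc)
qed

lemma count_std_word: "i \<in> {1..n} \<Longrightarrow> count (mset (std_word m)) i = m i"
proof -
  have "count (mset (concat (map (\<lambda>i. replicate (m i) i) [1..<k]))) i = (if 1 \<le> i \<and> i < k then m i else 0)" for k
    by (induction k) (auto simp: not_less le_Suc_eq)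
  then show "i \<in> {1..n} \<Longrightarrow> ?thesis" by (simp add: std_word_def del: upt_Suc)
qed

lemma sort_eq_std_word:
  assumes "set xs \<subseteq> {1..n}"
  shows "sort xs = std_word (count (mset xs))"
proof (rule properties_for_sort)
  show "mset (std_word (count (mset xs))) = mset xs"
  proof (rule multiset_eqI)
    fix i
    show "count (mset (std_word (count (mset xs)))) i = count (mset xs) i"
    proof (cases "i \<in> {1..n}")
      case False
      then have "i \<notin> set (std_word (count (mset xs)))" "i \<notin> set xs"
        using set_std_word assms by blast+
      then show ?thesis by (metis count_eq_zero_iff set_mset_mset)
    qed (simp add: count_std_word)
  qed
qed (rule sorted_std_word)

lemma W_I: "set xs \<subseteq> {1..n} \<Longrightarrow> weight xs \<le> r \<Longrightarrow> word xs \<in> W r"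
  unfolding W_def by (rule span_base) blast

lemma subspace_W: "subspace (W r)"
  by (simp add: W_def)

lemma W_mono: "r \<le> s \<Longrightarrow> W r \<subseteq> W s"
  unfolding W_def by (rule span_mono) auto

lemma W_mult: "a \<in> W r \<Longrightarrow> b \<in> W s \<Longrightarrow> a * b \<in> W (r + s)"
proof -
  assume a: "a \<in> W r" and b: "b \<in> W s"
  have *: "word xs * b \<in> W (r + s)" if xs: "set xs \<subseteq> {1..n}" "weight xs \<le> r" for xs
    using b unfolding W_def[of s]
  proof (induction rule: span_induct_alt)
    case base
    then show ?case by (simp add: subspace_0 subspace_W)
  next
    case (step c x y)
    then obtain ys where "x = word ys" "set ys \<subseteq> {1..n}" "weight ys \<le> s" by blast
    then have "word xs * x \<in> W (r + s)"
      using W_I[of "xs @ ys" "r + s"] xs by (simp add: word_append weight_append)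
    with step show ?case
      by (simp add: distrib_left scale_mult_right subspace_add subspace_scale subspace_W)
  qed
  show ?thesis
    using a unfolding W_def[of r]
  proof (induction rule: span_induct_alt)
    case base
    then show ?case by (simp add: subspace_0 subspace_W)
  next
    case (step c x y)
    then have "x * b \<in> W (r + s)" using * by blast
    with step show ?case
      by (simp add: distrib_right scale_mult_left subspace_add subspace_scale subspace_W)
  qed
qed

lemma C_subset_W: "C r \<subseteq> W r"
proof -
  have "ordered_monomial n X m = word (std_word m) \<and> set (std_word m) \<subseteq> {1..n} \<and> weight (std_word m) \<le> r"
    if "(\<Sum>i=1..n. m i * d i) \<le> r" for m
    using that set_std_word[of m] by (simp add: word_std_word weight_std_word)
  then show ?thesis unfolding pbw_filtration_def W_def by (intro span_mono) blast
qed

lemma subspace_filt_below_W: "subspace (filt_below W r)"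
  using subspace_W by (simp add: filt_below_def subspace_single_0)

lemma filt_below_W_mult:
  assumes "a \<in> W r" "b \<in> filt_below W s"
  shows "a * b \<in> filt_below W (r + s)" "b * a \<in> filt_below W (s + r)"
  using assms W_mult[of a r b "s - 1"] W_mult[of b "s - 1" a r] subspace_0[OF subspace_W]
  by (auto simp: filt_below_def split: if_splits)

lemma X_in_W: "i \<in> {1..n} \<Longrightarrow> X i \<in> W (d i)"
  using W_I[of "[i]" "d i"] by (simp add: word_def weight_def)

lemma commutator_W:
  assumes "i \<in> {1..n}" "j \<in> {1..n}"
  shows "X i * X j - X j * X i \<in> filt_below W (d i + d j)"
proof -
  \<comment> \<open>Degrees are positive, so \<open>filt_below W\<close> at \<open>d i + d j\<close>
    is the stage one lower and not the exceptional zero space.\<close>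
  have *: "X i * X j - X j * X i \<in> filt_below W (d i + d j)"
    if "i \<in> {1..n}" "j \<in> {1..n}" "j < i" for i j
    using commutator[OF that] C_subset_W d_pos[of i] that by (auto simp: filt_below_def)
  show ?thesis
  proof (cases i j rule: linorder_cases)
    case less
    then show ?thesis
      using subspace_neg[OF subspace_filt_below_W *[OF assms(2,1)]] by (simp add: add.commute)
  qed (use * assms subspace_0[OF subspace_filt_below_W] in auto)
qed

text \<open>Moving \<open>X a\<close> past a smaller letter costs a commutator, which pushes the
  whole word below its weight.\<close>

lemma word_insort:
  "a \<in> {1..n} \<Longrightarrow> set xs \<subseteq> {1..n} \<Longrightarrow>
    X a * word xs - word (insort a xs) \<in> filt_below W (d a + weight xs)"
proof (induction xs)
  case Nil
  then show ?case using subspace_0[OF subspace_filt_below_W] by (simp add: word_def)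
next
  case (Cons x xs)
  show ?case
  proof (cases "a \<le> x")
    case True
    then show ?thesis using subspace_0[OF subspace_filt_below_W] by (simp add: word_Cons)
  next
    case False
    have "(X a * X x - X x * X a) * word xs \<in> filt_below W (d a + d x + weight xs)"
      using Cons.prems W_I[of xs "weight xs"] by (intro filt_below_W_mult(2) commutator_W) auto
    moreover have "X x * (X a * word xs - word (insort a xs)) \<in> filt_below W (d x + (d a + weight xs))"
      using Cons by (intro filt_below_W_mult(1) X_in_W) auto
    ultimately have "(X a * X x - X x * X a) * word xs + X x * (X a * word xs - word (insort a xs))
        \<in> filt_below W (d a + weight (x # xs))"
      by (intro subspace_add[OF subspace_filt_below_W]) (simp_all add: weight_Cons add_ac)
    then show ?thesis using False by (simp add: word_Cons algebra_simps)
  qed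
qed

lemma weight_sort: "weight (sort xs) = weight xs"
  using mset_map[of d "sort xs"] mset_map[of d xs]
  unfolding weight_def by (metis mset_sort sum_mset_sum_list)

lemma word_sort: "set xs \<subseteq> {1..n} \<Longrightarrow> word xs - word (sort xs) \<in> filt_below W (weight xs)"
proof (induction xs)
  case Nil
  then show ?case using subspace_0[OF subspace_filt_below_W] by simp
next
  case (Cons x xs)
  have "X x * (word xs - word (sort xs)) \<in> filt_below W (d x + weight xs)"
    using Cons by (intro filt_below_W_mult(1) X_in_W) auto
  moreover have "X x * word (sort xs) - word (insort x (sort xs)) \<in> filt_below W (d x + weight xs)"
    using word_insort[of x "sort xs"] Cons.prems by (simp add: weight_sort)
  ultimately have "X x * (word xs - word (sort xs)) + (X x * word (sort xs) - word (insort x (sort xs)))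
      \<in> filt_below W (d x + weight xs)"
    by (intro subspace_add[OF subspace_filt_below_W])
  then show ?case by (simp add: word_Cons weight_Cons algebra_simps)
qed

text \<open>Sorting turns a word into an ordered monomial up to an element of a smaller stage of
  \<open>W\<close>, which lies in \<open>C\<close> by induction. In this way \<open>C\<close>
  inherits the multiplicativity of \<open>W\<close>.\<close>

lemma W_subset_C: "W r \<subseteq> C r"
proof (induction r rule: less_induct)
  case (less r)
  have sub: "subspace (C r)" by (simp add: pbw_filtration_def)
  have "word xs \<in> C r" if xs: "set xs \<subseteq> {1..n}" "weight xs \<le> r" for xs
  proof -
    have "(\<Sum>i=1..n. count (mset xs) i * d i) \<le> r"
      using weight_std_word[of "count (mset xs)"] sort_eq_std_word[OF xs(1)] weight_sort[of xs] xs(2) by simp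
    then have "word (sort xs) \<in> C r"
      unfolding sort_eq_std_word[OF xs(1)] word_std_word pbw_filtration_def
      by (intro span_base) blast
    moreover have "word xs - word (sort xs) \<in> C r"
    proof (cases "weight xs = 0")
      \<comment> \<open>In weight 0 the stage below is zero, so sorting changes nothing.\<close>
      case True
      then show ?thesis using word_sort[OF xs(1)] sub by (simp add: filt_below_def subspace_0)
    next
      case False
      then have "word xs - word (sort xs) \<in> W (weight xs - 1)"
        using word_sort[OF xs(1)] by (simp add: filt_below_def)
      also have "\<dots> \<subseteq> W (r - 1)" using xs(2) by (intro W_mono) simp
      also have "\<dots> \<subseteq> C (r - 1)" using False xs(2) by (intro less) simp
      also have "\<dots> \<subseteq> C r" unfolding pbw_filtration_def by (rule span_mono) auto
      finally show ?thesis .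
    qed
    ultimately show ?thesis using subspace_add[OF sub] by fastforce
  qed
  then show ?case unfolding W_def by (intro span_minimal sub) auto
qed

lemma C_eq_W: "C = W"
  using C_subset_W W_subset_C by blast

lemma algebra_filtration_C: "algebra_filtration C"
  unfolding algebra_filtration_def C_eq_W using W_mult by blast

text \<open>Concatenating the two ordered words and sorting the result adds the exponents, with an
  error of lower weight. So the leading parts multiply like commuting monomials.\<close>

lemma ordered_monomial_mult:
  "ordered_monomial n X m * ordered_monomial n X m' - ordered_monomial n X (\<lambda>i. m i + m' i)
     \<in> filt_below C ((\<Sum>i=1..n. m i * d i) + (\<Sum>i=1..n. m' i * d i))"
proof -
  let ?xs = "std_word m @ std_word m'"
  have set: "set ?xs \<subseteq> {1..n}" using set_std_word by auto
  have "std_word (count (mset ?xs)) = std_word (\<lambda>i. m i + m' i)"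
    unfolding std_word_def by (intro arg_cong[where f = concat] map_cong)
      (use count_std_word[of _ m] count_std_word[of _ m'] in \<open>auto simp: std_word_def simp del: upt_Suc\<close>)
  then show ?thesis
    using word_sort[OF set] sort_eq_std_word[OF set]
    by (simp add: C_eq_W word_append word_std_word weight_append weight_std_word)
qed

end

section \<open>Arithmetic with cosets of a subspace\<close>

context vector_space
begin

lemma coset_eq_iff: "subspace U \<Longrightarrow> a +o U = b +o U \<longleftrightarrow> a - b \<in> U"
proof
  assume U: "subspace U" and "a +o U = b +o U"
  moreover have "a \<in> a +o U" using subspace_0[OF U] by (auto simp: elt_set_plus_def)
  ultimately show "a - b \<in> U" by (auto simp: elt_set_plus_def)
next
  assume U: "subspace U" and ab: "a - b \<in> U"
  have "x \<in> b +o U" if "x \<in> a +o U" for x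
  proof -
    obtain u where "u \<in> U" "x = a + u" using \<open>x \<in> a +o U\<close> by (auto simp: elt_set_plus_def)
    then have "x = b + (a - b + u)" "a - b + u \<in> U" using subspace_add[OF U ab] by auto
    then show ?thesis unfolding elt_set_plus_def by blast
  qed
  moreover have "x \<in> a +o U" if "x \<in> b +o U" for x
  proof -
    obtain u where "u \<in> U" "x = b + u" using \<open>x \<in> b +o U\<close> by (auto simp: elt_set_plus_def)
    then have "x = a + (u - (a - b))" "u - (a - b) \<in> U" using subspace_diff[OF U _ ab] by auto
    then show ?thesis unfolding elt_set_plus_def by blast
  qed
  ultimately show "a +o U = b +o U" by blast
qed

text \<open>Adding \<open>U\<close> fills up a coset from any nonempty part of it. This turns the
  operations of \<open>gr_algebra\<close>, defined on whole cosets, into operations on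
  representatives.\<close>

lemma set_plus_coset:
  assumes U: "subspace U" and A: "A \<noteq> {}" "A \<subseteq> a +o U"
  shows "A + U = a +o U"
proof
  show "A + U \<subseteq> a +o U"
  proof
    fix x assume "x \<in> A + U"
    then obtain y u where "y \<in> A" "u \<in> U" "x = y + u" by (auto simp: set_plus_def)
    moreover from \<open>y \<in> A\<close> A obtain v where "v \<in> U" "y = a + v" by (auto simp: elt_set_plus_def)
    ultimately have "x = a + (v + u)" "v + u \<in> U" using subspace_add[OF U] by (auto simp: add.assoc)
    then show "x \<in> a +o U" by (auto simp: elt_set_plus_def)
  qed
  show "a +o U \<subseteq> A + U"
  proof
    fix x assume "x \<in> a +o U"
    then obtain u where u: "u \<in> U" "x = a + u" by (auto simp: elt_set_plus_def)
    obtain y where "y \<in> A" using A by blast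
    then obtain v where y: "y \<in> A" "v \<in> U" "y = a + v" using A by (auto simp: elt_set_plus_def)
    have "x = y + (u - v)" "u - v \<in> U" using u y subspace_diff[OF U] by auto
    then show "x \<in> A + U" using y(1) unfolding set_plus_def by blast
  qed
qed

lemma coset_add: "subspace U \<Longrightarrow> (a +o U) + (b +o U) = (a + b) +o U"
proof -
  assume U: "subspace U"
  have "U + U = U"
    using set_plus_coset[OF U, of U 0] subspace_0[OF U] by auto
  then show ?thesis by (simp add: set_plus_rearrange)
qed

end

section \<open>The associated graded algebra as a polynomial algebra\<close>

locale pbw_commuting = almost_commuting scale n X d
  for scale :: "'k::field \<Rightarrow> 'h::ring_1 \<Rightarrow> 'h" (infixr \<open>*s\<close> 75)
    and n :: nat and X :: "nat \<Rightarrow> 'h" and d :: "nat \<Rightarrow> nat" +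
  assumes pbw_independent: "(\<forall>\<mu>\<in>Poly_Mapping.keys P. Poly_Mapping.keys \<mu> \<subseteq> {1..n}) \<Longrightarrow>
      lin_ext scale (\<lambda>\<mu>. ordered_monomial n X (Poly_Mapping.lookup \<mu>)) P = 0 \<Longrightarrow> P = 0"
begin

abbreviation V :: "((nat \<Rightarrow>\<^sub>0 nat) \<Rightarrow>\<^sub>0 'k) set" where
  "V \<equiv> {P. \<forall>\<mu>\<in>Poly_Mapping.keys P. Poly_Mapping.keys \<mu> \<subseteq> {1..n}}"

abbreviation mon :: "(nat \<Rightarrow>\<^sub>0 nat) \<Rightarrow> 'h" where
  "mon \<mu> \<equiv> ordered_monomial n X (Poly_Mapping.lookup \<mu>)"

abbreviation FB :: "nat \<Rightarrow> 'h set" where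
  "FB \<equiv> filt_below C"

definition wt :: "(nat \<Rightarrow>\<^sub>0 nat) \<Rightarrow> nat" where
  "wt \<mu> = (\<Sum>i=1..n. Poly_Mapping.lookup \<mu> i * d i)"

text \<open>The part of \<open>P\<close> of weight \<open>r\<close>, as a polynomial, is
  \<open>restr r P\<close>; \<open>component r P\<close> evaluates it in H and represents its class
  in the graded piece \<open>r\<close>.\<close>

definition component :: "nat \<Rightarrow> ((nat \<Rightarrow>\<^sub>0 nat) \<Rightarrow>\<^sub>0 'k) \<Rightarrow> 'h" where
  "component r P = lin_ext scale (\<lambda>\<mu>. if wt \<mu> = r then mon \<mu> else 0) P"

definition restr :: "nat \<Rightarrow> ((nat \<Rightarrow>\<^sub>0 nat) \<Rightarrow>\<^sub>0 'k) \<Rightarrow> ((nat \<Rightarrow>\<^sub>0 nat) \<Rightarrow>\<^sub>0 'k)" where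
  "restr r P = lin_ext fscale (\<lambda>\<mu>. if wt \<mu> = r then pure \<mu> else 0) P"

lemma lookup_restr: "Poly_Mapping.lookup (restr r P) \<mu> = (if wt \<mu> = r then Poly_Mapping.lookup P \<mu> else 0)"
proof -
  have "Poly_Mapping.lookup (restr r P) \<mu> =
      (\<Sum>\<nu>\<in>Poly_Mapping.keys P. if \<nu> = \<mu> then (if wt \<mu> = r then Poly_Mapping.lookup P \<mu> else 0) else 0)"
    unfolding restr_def lin_ext_def lookup_sum
    by (rule sum.cong) (auto simp: lookup_single when_def)
  then show ?thesis by (simp add: in_keys_iff)
qed

lemma keys_restr: "Poly_Mapping.keys (restr r P) = {\<mu> \<in> Poly_Mapping.keys P. wt \<mu> = r}"
  by (auto simp: in_keys_iff lookup_restr split: if_splits)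

lemma component_restr: "component r P = lin_ext scale mon (restr r P)"
  unfolding restr_def component_def linear_lin_ext_comp[OF linear_lin_ext]
  by (rule lin_ext_cong) simp

lemma component_add: "component r (P + Q) = component r P + component r Q"
  and component_diff: "component r (P - Q) = component r P - component r Q"
  and component_fscale: "component r (fscale a P) = a *s component r P"
  by (simp_all add: component_def lin_ext_add lin_ext_diff lin_ext_fscale)

lemma component_0 [simp]: "component r 0 = 0"
  by (simp add: component_def)

lemma component_sum: "component r (sum f A) = (\<Sum>i\<in>A. component r (f i))"
  by (induction A rule: infinite_finite_induct) (simp_all add: component_add)

lemma component_single: "component r (Poly_Mapping.single \<mu> a) = (if wt \<mu> = r then a *s mon \<mu> else 0)"
proof -
  have "Poly_Mapping.single \<mu> a = fscale a (pure \<mu>)"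
    by (rule poly_mapping_eqI) (simp add: lookup_single when_def)
  then show ?thesis by (simp add: component_fscale) (simp add: component_def)
qed

lemma component_restr_restr: "component s (restr r P) = (if s = r then component r P else 0)"
proof -
  have "restr s (restr r P) = (if s = r then restr r P else 0)"
    by (rule poly_mapping_eqI) (simp add: lookup_restr)
  then show ?thesis by (simp add: component_restr)
qed

lemma subspace_C: "subspace (C r)"
  by (simp add: pbw_filtration_def)

lemma subspace_FB: "subspace (FB r)"
  using subspace_C by (simp add: filt_below_def subspace_single_0)

lemma C_mono: "r \<le> s \<Longrightarrow> C r \<subseteq> C s"
  unfolding pbw_filtration_def by (rule span_mono) auto

lemma FB_subset_C: "FB r \<subseteq> C r"
  using C_mono[of "r - 1" r] subspace_0[OF subspace_C] by (auto simp: filt_below_def)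

lemma mon_C: "wt \<mu> \<le> r \<Longrightarrow> mon \<mu> \<in> C r"
  unfolding pbw_filtration_def wt_def by (rule span_base) blast

lemma component_C: "component r P \<in> C r"
  unfolding component_def by (rule lin_ext_mem_subspace[OF subspace_C]) (auto intro: mon_C subspace_0[OF subspace_C])

lemma C_repr:
  assumes "h \<in> C r"
  shows "\<exists>R\<in>V. (\<forall>\<mu>\<in>Poly_Mapping.keys R. wt \<mu> \<le> r) \<and> h = lin_ext scale mon R"
  using assms unfolding pbw_filtration_def
proof (induction rule: span_induct_alt)
    case base
    then show ?case by (intro bexI[of _ 0]) simp_all
  next
    case (step c x y)
    then obtain m R where m: "x = ordered_monomial n X m" "(\<Sum>i=1..n. m i * d i) \<le> r"
      and R: "R \<in> V" "\<forall>\<mu>\<in>Poly_Mapping.keys R. wt \<mu> \<le> r" "y = lin_ext scale mon R" by blast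
    \<comment> \<open>\<open>m\<close> may be nonzero outside \<open>{1..n}\<close>, even infinitely
      often, so it is truncated; monomial and weight only see \<open>{1..n}\<close>.\<close>
    define \<mu> where "\<mu> = (\<Sum>i=1..n. Poly_Mapping.single i (m i))"
    have look: "Poly_Mapping.lookup \<mu> i = (if i \<in> {1..n} then m i else 0)" for i
      by (simp add: \<mu>_def lookup_sum lookup_single when_def)
    have "mon \<mu> = x"
      unfolding m(1) ordered_monomial_def by (rule arg_cong[where f = prod_list], rule map_cong) (auto simp: look)
    moreover have "wt \<mu> \<le> r" using m(2) by (simp add: wt_def look)
    moreover have "Poly_Mapping.keys \<mu> \<subseteq> {1..n}" by (auto simp: in_keys_iff look split: if_splits)
    moreover have "Poly_Mapping.keys (fscale c (pure \<mu>) + R) \<subseteq> insert \<mu> (Poly_Mapping.keys R)"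
      by (auto simp: in_keys_iff lookup_add lookup_single when_def split: if_splits)
    ultimately show ?case
      using R by (intro bexI[of _ "fscale c (pure \<mu>) + R"]) (auto simp: lin_ext_add lin_ext_fscale)
qed

text \<open>An element of the stage below is a combination of ordered monomials of weight less than
  \<open>r\<close>. By independence it cannot equal a combination of monomials of weight
  \<open>r\<close> unless both vanish.\<close>

lemma component_FB_imp_0:
  assumes P: "P \<in> V" and "component r P \<in> FB r"
  shows "restr r P = 0"
proof -
  have restr_V: "restr r P \<in> V" using P by (auto simp: keys_restr)
  show ?thesis
  proof (cases "r = 0")
    case True
    then show ?thesis
      using assms(2) restr_V pbw_independent[of "restr r P"] by (simp add: filt_below_def component_restr)
  next
    case False
    then have "component r P \<in> C (r - 1)" using assms(2) by (simp add: filt_below_def)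
    then obtain R where R: "R \<in> V" "\<forall>\<mu>\<in>Poly_Mapping.keys R. wt \<mu> \<le> r - 1"
      "component r P = lin_ext scale mon R" using C_repr by blast
    have "Poly_Mapping.keys (restr r P - R) \<subseteq> Poly_Mapping.keys (restr r P) \<union> Poly_Mapping.keys R"
      by (auto simp: in_keys_iff lookup_minus)
    then have "restr r P - R = 0"
      using restr_V R by (intro pbw_independent) (auto simp: lin_ext_diff component_restr)
    then have "Poly_Mapping.keys (restr r P) = Poly_Mapping.keys R" by simp
    then have "Poly_Mapping.keys (restr r P) = {}" using R(2) False by (fastforce simp: keys_restr)
    then show ?thesis by simp
  qed
qed

lemma mult_FB: "a \<in> C r \<Longrightarrow> b \<in> FB s \<Longrightarrow> a * b \<in> FB (r + s)" "a \<in> C r \<Longrightarrow> b \<in> FB s \<Longrightarrow> b * a \<in> FB (s + r)"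
  using filt_below_W_mult by (simp_all add: C_eq_W)

lemma wt_add: "wt (\<mu> + \<nu>) = wt \<mu> + wt \<nu>"
  by (simp add: wt_def lookup_add sum.distrib distrib_right)

lemma mon_mult: "mon \<mu> * mon \<nu> - mon (\<mu> + \<nu>) \<in> FB (wt \<mu> + wt \<nu>)"
  using ordered_monomial_mult[of "Poly_Mapping.lookup \<mu>" "Poly_Mapping.lookup \<nu>"]
  by (simp add: wt_def lookup_add[abs_def])

lemma sum_singles: "P = (\<Sum>\<mu>\<in>Poly_Mapping.keys P. Poly_Mapping.single \<mu> (Poly_Mapping.lookup P \<mu>))"
  by (rule poly_mapping_eqI) (simp add: lookup_sum lookup_single when_def in_keys_iff)

text \<open>The difference is additive in \<open>P\<close> and in \<open>Q\<close>, so single terms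
  suffice, where it reduces to \<open>mon_mult\<close>.\<close>

lemma component_mult: "component r (P * Q) - (\<Sum>i\<le>r. component i P * component (r - i) Q) \<in> FB r"
proof -
  let ?E = "\<lambda>P Q. component r (P * Q) - (\<Sum>i\<le>r. component i P * component (r - i) Q)"
  have single: "?E (Poly_Mapping.single \<mu> a) (Poly_Mapping.single \<nu> b) \<in> FB r" for \<mu> a \<nu> b
  proof -
    have "(\<Sum>i\<le>r. component i (Poly_Mapping.single \<mu> a) * component (r - i) (Poly_Mapping.single \<nu> b)) =
        (\<Sum>i\<le>r. if i = wt \<mu> then (if wt \<mu> + wt \<nu> = r then (a * b) *s (mon \<mu> * mon \<nu>) else 0) else 0)"
      by (rule sum.cong) (auto simp: component_single scale_mult_left scale_mult_right mult.commute)
    then have "?E (Poly_Mapping.single \<mu> a) (Poly_Mapping.single \<nu> b) =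
        (if wt \<mu> + wt \<nu> = r then - ((a * b) *s (mon \<mu> * mon \<nu> - mon (\<mu> + \<nu>))) else 0)"
      by (auto simp: mult_single component_single wt_add scale_right_diff_distrib)
    also have "\<dots> \<in> FB r"
      using mon_mult[of \<mu> \<nu>] subspace_scale[OF subspace_FB] subspace_neg[OF subspace_FB] subspace_0[OF subspace_FB]
      by auto
    finally show ?thesis .
  qed
  have left: "?E (sum f A) Q = (\<Sum>i\<in>A. ?E (f i) Q)" for f :: "(nat \<Rightarrow>\<^sub>0 nat) \<Rightarrow> _" and A Q
    by (induction A rule: infinite_finite_induct) (simp_all add: component_add algebra_simps sum.distrib)
  have right: "?E P (sum f A) = (\<Sum>i\<in>A. ?E P (f i))" for f :: "(nat \<Rightarrow>\<^sub>0 nat) \<Rightarrow> _" and A P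
    by (induction A rule: infinite_finite_induct) (simp_all add: component_add algebra_simps sum.distrib)
  have "?E (\<Sum>\<mu>\<in>Poly_Mapping.keys P. Poly_Mapping.single \<mu> (Poly_Mapping.lookup P \<mu>))
      (\<Sum>\<nu>\<in>Poly_Mapping.keys Q. Poly_Mapping.single \<nu> (Poly_Mapping.lookup Q \<nu>)) \<in> FB r"
    unfolding left right by (intro subspace_sum[OF subspace_FB] single)
  then show ?thesis by (simp only: sum_singles[symmetric])
qed

definition gr_map :: "((nat \<Rightarrow>\<^sub>0 nat) \<Rightarrow>\<^sub>0 'k) \<Rightarrow> nat \<Rightarrow> 'h set" where
  "gr_map P r = component r P +o FB r"

lemma gr_map_carrier: "gr_map P \<in> carrier (gr_algebra C)"
proof -
  have "gr_map P r = FB r" if "r \<notin> wt ` Poly_Mapping.keys P" for r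
  proof -
    have "component r P = 0"
      unfolding component_def lin_ext_def using that by (intro sum.neutral) auto
    then show ?thesis by (simp add: gr_map_def)
  qed
  then have "{r. gr_map P r \<noteq> FB r} \<subseteq> wt ` Poly_Mapping.keys P" by blast
  then have "finite {r. gr_map P r \<noteq> FB r}" by (rule finite_subset) simp
  then show ?thesis using component_C by (auto simp: gr_algebra_def gr_map_def)
qed

lemma gr_map_add: "gr_map (P + Q) = gr_map P \<oplus>\<^bsub>gr_algebra C\<^esub> gr_map Q"
  by (rule ext) (simp add: gr_algebra_def gr_map_def component_add coset_add[OF subspace_FB])

lemma gr_map_scale: "gr_map (fscale a P) = a \<odot>\<^bsub>gr_algebra C\<^esub> gr_map P"
proof
  fix r
  have "scale a ` (component r P +o FB r) + FB r = (a *s component r P) +o FB r"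
    using subspace_0[OF subspace_FB] subspace_scale[OF subspace_FB]
    by (intro set_plus_coset[OF subspace_FB]) (auto simp: elt_set_plus_def scale_right_distrib)
  then show "gr_map (fscale a P) r = (a \<odot>\<^bsub>gr_algebra C\<^esub> gr_map P) r"
    by (simp add: gr_algebra_def gr_map_def component_fscale)
qed

lemma gr_map_one: "gr_map 1 = \<one>\<^bsub>gr_algebra C\<^esub>"
proof
  fix r
  have "wt 0 = 0" "mon 0 = 1" by (simp_all add: wt_def ordered_monomial_def del: upt_Suc) (induction n, auto)
  then have "component r 1 = (if r = 0 then 1 else 0)"
    unfolding single_one[symmetric] component_single by simp
  then show "gr_map 1 r = \<one>\<^bsub>gr_algebra C\<^esub> r" by (simp add: gr_algebra_def gr_map_def)
qed

lemma sum_cosets: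
  assumes U: "subspace U"
  shows "finite A \<Longrightarrow> A \<noteq> {} \<Longrightarrow> (\<Sum>i\<in>A. f i +o U) = sum f A +o U"
proof (induction A rule: finite_ne_induct)
  case (insert i A)
  then show ?case by (simp add: coset_add[OF U])
qed simp

lemma gr_map_mult: "gr_map (P * Q) = gr_map P \<otimes>\<^bsub>gr_algebra C\<^esub> gr_map Q"
proof
  fix r
  let ?F = "\<lambda>i. gr_map P i * gr_map Q (r - i)" and ?f = "\<lambda>i. component i P * component (r - i) Q"
  have mem: "component i P \<in> gr_map P i" for i P
    using subspace_0[OF subspace_FB] by (auto simp: gr_map_def elt_set_plus_def)
  \<comment> \<open>Changing representatives alters a product only by terms with a factor in a lower
    stage.\<close>
  have sub: "?F i \<subseteq> ?f i +o FB r" if i: "i \<le> r" for i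
  proof
    fix z assume "z \<in> ?F i"
    then obtain u v where uv: "u \<in> FB i" "v \<in> FB (r - i)" "z = (component i P + u) * (component (r - i) Q + v)"
      by (auto simp: gr_map_def elt_set_plus_def set_times_def)
    have "component i P * v + (u * component (r - i) Q + u * v) \<in> FB r"
      using mult_FB(1)[OF component_C uv(2), of i P] mult_FB(2)[OF component_C uv(1), of "r - i" Q]
        mult_FB(1)[of u i v "r - i"] uv(1,2) FB_subset_C i
      by (intro subspace_add[OF subspace_FB]) auto
    then show "z \<in> ?f i +o FB r"
      unfolding uv(3) elt_set_plus_def by (auto simp: algebra_simps)
  qed
  have "?F i + FB r = ?f i +o FB r" if "i \<le> r" for i
    using set_times_intro[OF mem mem, of i P "r - i" Q] sub[OF that]
    by (intro set_plus_coset subspace_FB) auto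
  then have "(\<Sum>i\<le>r. ?F i + FB r) = (\<Sum>i\<le>r. ?f i +o FB r)" by (intro sum.cong) auto
  also have "\<dots> = (\<Sum>i\<le>r. ?f i) +o FB r" by (rule sum_cosets[OF subspace_FB]) auto
  also have "\<dots> = component r (P * Q) +o FB r"
    using component_mult[of r P Q] subspace_neg[OF subspace_FB, of "component r (P * Q) - (\<Sum>i\<le>r. ?f i)" r]
    by (simp add: coset_eq_iff[OF subspace_FB])
  finally show "gr_map (P * Q) r = (gr_map P \<otimes>\<^bsub>gr_algebra C\<^esub> gr_map Q) r"
    by (simp add: gr_algebra_def gr_map_def)
qed

lemma gr_map_inj: "inj_on gr_map V"
proof (rule inj_onI)
  fix P Q assume "P \<in> V" "Q \<in> V" and eq: "gr_map P = gr_map Q"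
  have "Poly_Mapping.keys (P - Q) \<subseteq> Poly_Mapping.keys P \<union> Poly_Mapping.keys Q"
    by (auto simp: in_keys_iff lookup_minus)
  then have V: "P - Q \<in> V" using \<open>P \<in> V\<close> \<open>Q \<in> V\<close> by blast
  have "restr r (P - Q) = 0" for r
  proof (rule component_FB_imp_0[OF V])
    have "component r P +o FB r = component r Q +o FB r" using fun_cong[OF eq, of r] by (simp add: gr_map_def)
    then show "component r (P - Q) \<in> FB r" by (simp add: component_diff coset_eq_iff[OF subspace_FB])
  qed
  then have "Poly_Mapping.lookup (P - Q) \<mu> = 0" for \<mu>
    using lookup_restr[of "wt \<mu>" "P - Q" \<mu>] by simp
  then have "P - Q = 0" by (intro poly_mapping_eqI) simp
  then show "P = Q" by simp
qed

lemma gr_map_surj: "carrier (gr_algebra C) \<subseteq> gr_map ` V"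
proof
  fix g assume g: "g \<in> carrier (gr_algebra C)"
  have "\<exists>R. R \<in> V \<and> g r = component r R +o FB r" for r
  proof -
    obtain a where a: "a \<in> C r" "g r = a +o FB r" using g by (auto simp: gr_algebra_def)
    then obtain R where R: "R \<in> V" "\<forall>\<mu>\<in>Poly_Mapping.keys R. wt \<mu> \<le> r" "a = lin_ext scale mon R"
      using C_repr by blast
    have "a - component r R = lin_ext scale mon (R - restr r R)" by (simp add: R(3) component_restr lin_ext_diff)
    also have "\<dots> \<in> FB r"
    proof (rule lin_ext_mem_subspace[OF subspace_FB])
      fix \<mu> assume "\<mu> \<in> Poly_Mapping.keys (R - restr r R)"
      then have "wt \<mu> \<noteq> r" "\<mu> \<in> Poly_Mapping.keys R"
        by (auto simp: in_keys_iff lookup_minus lookup_restr split: if_splits)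
      then have "wt \<mu> < r" using R(2) by force
      then show "mon \<mu> \<in> FB r" using mon_C[of \<mu> "r - 1"] by (simp add: filt_below_def)
    qed
    finally show ?thesis using a(2) R(1) coset_eq_iff[OF subspace_FB] by blast
  qed
  then have "\<forall>r. \<exists>R. R \<in> V \<and> g r = component r R +o FB r" ..
  from choice[OF this] obtain R where "\<forall>r. R r \<in> V \<and> g r = component r (R r) +o FB r" ..
  then have R: "\<And>r. R r \<in> V" "\<And>r. g r = component r (R r) +o FB r" by blast+
  let ?F = "{r. g r \<noteq> FB r}"
  have fin: "finite ?F" using g by (simp add: gr_algebra_def)
  \<comment> \<open>\<open>R r\<close> may contain terms of weight below \<open>r\<close>. Only its
    part of weight \<open>r\<close> is used, so that the summands do not disturb each other's
    components.\<close>
  let ?P = "\<Sum>r\<in>?F. restr r (R r)"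
  have P_eq: "gr_map ?P = g"
  proof
    fix s
    have "component s ?P = (\<Sum>r\<in>?F. if r = s then component s (R s) else 0)"
      unfolding component_sum by (rule sum.cong) (auto simp: component_restr_restr)
    then have "component s ?P = (if s \<in> ?F then component s (R s) else 0)" using fin by simp
    then show "gr_map ?P s = g s" using R(2)[of s] by (auto simp: gr_map_def)
  qed
  have "?P \<in> V"
  proof -
    have "Poly_Mapping.keys ?P \<subseteq> (\<Union>r\<in>?F. Poly_Mapping.keys (restr r (R r)))"
      by (rule Poly_Mapping.keys_sum)
    then show ?thesis using R(1) by (fastforce simp: keys_restr)
  qed
  then have "gr_map ?P \<in> gr_map ` V" by (rule imageI)
  then show "g \<in> gr_map ` V" by (simp only: P_eq)
qed

theorem gr_map_iso: "gr_map \<in> algebra_iso (mpoly_algebra {1..n}) (gr_algebra C)"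
proof -
  have "gr_map \<in> ring_hom (mpoly_algebra {1..n}) (gr_algebra C)"
    by (rule ring_hom_memI)
      (simp_all add: gr_map_carrier gr_map_mult gr_map_add gr_map_one mpoly_algebra_def)
  moreover have "bij_betw gr_map V (carrier (gr_algebra C))"
    using gr_map_inj gr_map_surj gr_map_carrier by (auto simp: bij_betw_def)
  ultimately show ?thesis
    by (simp add: algebra_iso_def ring_iso_def mpoly_algebra_def gr_map_scale)
qed

end

section \<open>The PBW basis and the choice of degrees\<close>

context k_algebra
begin

lemma ordered_monomial_0: "ordered_monomial 0 X m = 1"
  by (simp add: ordered_monomial_def)

lemma ordered_monomial_Suc:
  "ordered_monomial (Suc k) X m = ordered_monomial k X m * X (Suc k) ^ m (Suc k)"
  by (simp add: ordered_monomial_def)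

lemma ordered_monomial_cong:
  "(\<And>i. i \<in> {1..k} \<Longrightarrow> m i = m' i) \<Longrightarrow> ordered_monomial k X m = ordered_monomial k X m'"
  unfolding ordered_monomial_def by (rule arg_cong[where f = prod_list], rule map_cong) auto

lemma ordered_monomial_extend:
  "k \<le> l \<Longrightarrow> (\<And>i. k < i \<Longrightarrow> i \<le> l \<Longrightarrow> m i = 0) \<Longrightarrow> ordered_monomial l X m = ordered_monomial k X m"
  by (induction l rule: dec_induct) (simp_all add: ordered_monomial_Suc)

text \<open>Plain total degree instead of weight, because these bounds must be known before
  \<open>b\<close> is chosen.\<close>

definition bounded_span :: "nat \<Rightarrow> (nat \<Rightarrow> 'h) \<Rightarrow> nat \<Rightarrow> 'h set" where
  "bounded_span k X N = span {ordered_monomial k X m | m. (\<Sum>i=1..k. m i) \<le> N}"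

lemma bounded_span_mono: "N \<le> N' \<Longrightarrow> bounded_span k X N \<subseteq> bounded_span k X N'"
  unfolding bounded_span_def by (rule span_mono) auto

lemma bounded_span_mult:
  assumes "v \<in> bounded_span k X N"
  shows "v * X (Suc k) ^ i \<in> bounded_span (Suc k) X (N + i)"
  using assms unfolding bounded_span_def[of k]
proof (induction rule: span_induct_alt)
  case base
  then show ?case by (simp add: bounded_span_def span_zero)
next
  case (step c x y)
  then obtain m where m: "x = ordered_monomial k X m" "(\<Sum>i=1..k. m i) \<le> N" by blast
  let ?m = "m(Suc k := i)"
  have "ordered_monomial (Suc k) X ?m = x * X (Suc k) ^ i"
    unfolding m(1) ordered_monomial_Suc
    by (intro arg_cong2[where f = "(*)"] ordered_monomial_cong) auto
  moreover have "(\<Sum>i=1..Suc k. ?m i) \<le> N + i" using m(2) by simp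
  ultimately have "x * X (Suc k) ^ i \<in> bounded_span (Suc k) X (N + i)"
    unfolding bounded_span_def by (intro span_base) (metis (mono_tags, lifting) mem_Collect_eq)
  with step.IH show ?case
    by (simp add: bounded_span_def distrib_right scale_mult_left span_add span_scale)
qed

end

text \<open>Fewer than \<open>b\<close> factors, each of weight at most \<open>b ^ k\<close>,
  together weigh less than \<open>b ^ Suc k\<close>, the degree of the next variable.\<close>

lemma weight_less:
  assumes "(\<Sum>i=1..k. m i) < (b :: nat)"
  shows "(\<Sum>i=1..k. m i * b ^ i) < b ^ Suc k"
proof -
  have "(\<Sum>i=1..k. m i * b ^ i) \<le> (\<Sum>i=1..k. m i * b ^ k)"
    using assms by (intro sum_mono mult_le_mono2 power_increasing) auto
  also have "\<dots> = (\<Sum>i=1..k. m i) * b ^ k" by (simp add: sum_distrib_right)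
  also have "\<dots> < b * b ^ k" using assms by (intro mult_strict_right_mono) auto
  finally show ?thesis by simp
qed

context ihoe
begin

lemma ordered_monomial_mem: "k \<le> n \<Longrightarrow> ordered_monomial k X m \<in> H_sub k"
proof (induction k)
  case 0
  then show ?case by (simp add: ordered_monomial_0 H_sub_0 span_base)
next
  case (Suc k)
  have "subalgebra (H_sub (Suc k))" by (simp add: H_sub_def subalgebra_gen_subalgebra)
  moreover have "X (Suc k) \<in> H_sub (Suc k)" "H_sub k \<subseteq> H_sub (Suc k)"
    using ore_extension_subalgebra[OF ore_extension_H_sub[of k]] Suc.prems by auto
  ultimately show ?case
    using Suc by (auto simp: ordered_monomial_Suc intro!: subalgebraD(3) subalgebra_power)
qed

lemma pbw_spanning: "k \<le> n \<Longrightarrow> h \<in> H_sub k \<Longrightarrow> \<exists>N. h \<in> bounded_span k X N"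
proof (induction k arbitrary: h)
  case 0
  then show ?case by (auto simp: H_sub_0 bounded_span_def ordered_monomial_0)
next
  case (Suc k)
  interpret S: comult_ore_step scale unit_basis left_mult U.right_mult D cR \<epsilon>
    "H_sub k" "X (Suc k)" "\<sigma>' (Suc k)" "\<delta>' (Suc k)" "H_sub (Suc k)"
    using Suc.prems by (intro right.step) simp
  obtain d where "h \<in> S.H.Pl d" using Suc.prems by (auto simp: S.H_polys[symmetric] S.H.polys_def)
  then obtain f where f: "\<And>i. f i \<in> H_sub k" "h = (\<Sum>i<d. f i * X (Suc k) ^ i)"
    by (auto simp: S.H.Pl_def)
  have "\<exists>N. f i \<in> bounded_span k X N" for i using Suc f(1) by simp
  then obtain N where N: "\<And>i. f i \<in> bounded_span k X (N i)" by metis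
  have "f i * X (Suc k) ^ i \<in> bounded_span (Suc k) X (\<Sum>i<d. N i + i)" if "i < d" for i
  proof -
    have "N i + i \<le> (\<Sum>i<d. N i + i)" using that by (intro member_le_sum) auto
    then show ?thesis using bounded_span_mult[OF N] bounded_span_mono by blast
  qed
  then have "h \<in> bounded_span (Suc k) X (\<Sum>i<d. N i + i)"
    unfolding f(2) by (auto simp: bounded_span_def intro!: span_sum)
  then show ?case by blast
qed

text \<open>Group the relation by the exponent of the last variable; freeness over
  \<open>H_sub k\<close> makes each group vanish. Exponents vanish off \<open>{1..k}\<close> so that
  different functions in \<open>M\<close> give different monomials.\<close>

lemma pbw_independence:
  "k \<le> n \<Longrightarrow> finite M \<Longrightarrow> (\<And>m i. m \<in> M \<Longrightarrow> i \<notin> {1..k} \<Longrightarrow> m i = 0) \<Longrightarrow>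
    (\<Sum>m\<in>M. a m *s ordered_monomial k X m) = 0 \<Longrightarrow> m \<in> M \<Longrightarrow> a m = 0"
proof (induction k arbitrary: M a m)
  case 0
  then have "M = {m}" by (auto simp: fun_eq_iff) (metis ext)
  then show ?case using 0 by (simp add: ordered_monomial_0)
next
  case (Suc k)
  interpret S: comult_ore_step scale unit_basis left_mult U.right_mult D cR \<epsilon>
    "H_sub k" "X (Suc k)" "\<sigma>' (Suc k)" "\<delta>' (Suc k)" "H_sub (Suc k)"
    using Suc.prems by (intro right.step) simp
  define f where "f i = (\<Sum>m | m \<in> M \<and> m (Suc k) = i. a m *s ordered_monomial k X m)" for i
  define d where "d = Suc (\<Sum>m\<in>M. m (Suc k))"
  have d: "m (Suc k) < d" if "m \<in> M" for m
    using member_le_sum[of m M "\<lambda>m. m (Suc k)"] that Suc.prems(2) by (simp add: d_def)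
  have "f i \<in> H_sub k" for i
    unfolding f_def using Suc.prems(1) ordered_monomial_mem
    by (intro subspace_sum subspace_scale subspace_H_sub) simp
  moreover have "(\<Sum>i<d. f i * X (Suc k) ^ i) = 0"
  proof -
    have "(\<Sum>i<d. f i * X (Suc k) ^ i) =
        (\<Sum>i<d. \<Sum>m | m \<in> M \<and> m (Suc k) = i. a m *s ordered_monomial (Suc k) X m)"
      by (auto simp: f_def sum_distrib_right scale_mult_left ordered_monomial_Suc intro!: sum.cong)
    also have "\<dots> = (\<Sum>m\<in>M. a m *s ordered_monomial (Suc k) X m)"
      by (rule sum.group) (use d Suc.prems(2) in auto)
    finally show ?thesis using Suc.prems(4) by simp
  qed
  ultimately have f0: "f (m (Suc k)) = 0" using S.H.free d Suc.prems(5) by blast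
  let ?i = "m (Suc k)"
  \<comment> \<open>Within one group the last exponent is constant, so resetting it to 0 is
    injective and produces the support that the induction hypothesis asks for.\<close>
  let ?M = "{m \<in> M. m (Suc k) = ?i}" and ?g = "\<lambda>m. m(Suc k := 0)"
  have inj: "inj_on ?g ?M"
    by (rule inj_on_inverseI[of _ "\<lambda>m. m(Suc k := ?i)"]) auto
  have restore: "(?g m')(Suc k := ?i) = m'" if "m' \<in> ?M" for m'
    using that by auto
  have "(\<Sum>m'\<in>?g ` ?M. a (m'(Suc k := ?i)) *s ordered_monomial k X m') =
      (\<Sum>m'\<in>?M. a m' *s ordered_monomial k X m')"
    unfolding sum.reindex[OF inj] o_def
  proof (rule sum.cong[OF refl])
    fix m' assume "m' \<in> ?M"
    have "ordered_monomial k X (?g m') = ordered_monomial k X m'"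
      by (rule ordered_monomial_cong) simp
    then show "a ((?g m')(Suc k := ?i)) *s ordered_monomial k X (?g m') = a m' *s ordered_monomial k X m'"
      by (simp only: restore[OF \<open>m' \<in> ?M\<close>])
  qed
  also have "\<dots> = 0" using f0 by (simp add: f_def)
  finally have sum0: "(\<Sum>m'\<in>?g ` ?M. a (m'(Suc k := ?i)) *s ordered_monomial k X m') = 0" .
  have "a ((?g m)(Suc k := ?i)) = 0"
  proof (rule Suc.IH[OF _ _ _ sum0])
    show "?g m \<in> ?g ` ?M" using Suc.prems(5) by (intro imageI) simp
  qed (use Suc.prems in \<open>auto simp: le_Suc_eq\<close>)
  then show ?case using Suc.prems(5) restore[of m] by simp
qed

lemma ordered_monomials_independent:
  assumes "\<forall>\<mu>\<in>Poly_Mapping.keys P. Poly_Mapping.keys \<mu> \<subseteq> {1..n}"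
    and "lin_ext scale (\<lambda>\<mu>. ordered_monomial n X (Poly_Mapping.lookup \<mu>)) P = 0"
  shows "P = 0"
proof -
  let ?K = "Poly_Mapping.keys P"
  let ?a = "\<lambda>m. Poly_Mapping.lookup P (Poly_Mapping.Abs_poly_mapping m)"
  have inj: "inj_on Poly_Mapping.lookup ?K" by (auto intro: inj_onI poly_mapping_eqI)
  have sum0: "(\<Sum>m\<in>Poly_Mapping.lookup ` ?K. ?a m *s ordered_monomial n X m) = 0"
    unfolding sum.reindex[OF inj] using assms(2) by (simp add: lin_ext_def Poly_Mapping.lookup_inverse)
  have 0: "?a (Poly_Mapping.lookup \<mu>) = 0" if "\<mu> \<in> ?K" for \<mu>
  proof (rule pbw_independence[of n "Poly_Mapping.lookup ` ?K" ?a])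
    show "(\<Sum>m\<in>Poly_Mapping.lookup ` ?K. ?a m *s ordered_monomial n X m) = 0" by (rule sum0)
    show "Poly_Mapping.lookup \<mu> \<in> Poly_Mapping.lookup ` ?K" using that by (rule imageI)
    fix m i assume "m \<in> Poly_Mapping.lookup ` ?K" "i \<notin> {1..n}"
    then obtain \<nu> where "m = Poly_Mapping.lookup \<nu>" "i \<notin> Poly_Mapping.keys \<nu>" using assms(1) by blast
    then show "m i = 0" by (simp add: in_keys_iff)
  qed simp_all
  have "Poly_Mapping.lookup P \<mu> = 0" for \<mu>
    using 0[of \<mu>] by (cases "\<mu> \<in> ?K") (simp_all add: Poly_Mapping.lookup_inverse in_keys_iff)
  then have "?K = {}" by (simp add: in_keys_iff set_eq_iff)
  then show ?thesis by simp
qed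

lemma bounded_span_filtration:
  assumes "v \<in> bounded_span k X N" "N < b" "k \<le> n"
  shows "v \<in> pbw_filtration n X ((^) b) (b ^ Suc k - 1)"
proof -
  have "ordered_monomial k X m \<in> pbw_filtration n X ((^) b) (b ^ Suc k - 1)"
    if m: "(\<Sum>i=1..k. m i) \<le> N" for m
  proof -
    let ?m = "\<lambda>i. if i \<le> k then m i else 0"
    have "ordered_monomial k X m = ordered_monomial k X ?m" by (rule ordered_monomial_cong) simp
    also have "\<dots> = ordered_monomial n X ?m"
      using assms(3) by (intro ordered_monomial_extend[symmetric]) auto
    finally have eq: "ordered_monomial k X m = ordered_monomial n X ?m" .
    have "(\<Sum>i=1..n. ?m i * b ^ i) = (\<Sum>i=1..k. ?m i * b ^ i)"
      using assms(3) by (intro sum.mono_neutral_right) auto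
    also have "\<dots> = (\<Sum>i=1..k. m i * b ^ i)" by (rule sum.cong) auto
    also have "\<dots> < b ^ Suc k" using m assms(2) by (intro weight_less) simp
    finally show ?thesis unfolding eq pbw_filtration_def by (intro span_base) fastforce
  qed
  then have "bounded_span k X N \<subseteq> pbw_filtration n X ((^) b) (b ^ Suc k - 1)"
    unfolding bounded_span_def by (intro span_minimal) (auto simp: pbw_filtration_def)
  with assms(1) show ?thesis by blast
qed

text \<open>As j < i, a monomial in the first \<open>j\<close> variables stays ordered after right
  multiplication by \<open>X (Suc i)\<close>, and \<open>weight_less\<close> bounds what it
  contributes to the weight.\<close>

lemma bounded_span_mult_filtration:
  assumes "v \<in> bounded_span j X N" "N < b" "j < i" "i < n"
  shows "v * X (Suc i) \<in> pbw_filtration n X ((^) b) (b ^ Suc i + b ^ Suc j - 1)"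
  using assms(1) unfolding bounded_span_def
proof (induction rule: span_induct_alt)
  case base
  then show ?case by (simp add: pbw_filtration_def span_zero)
next
  case (step c x y)
  then obtain m where m: "x = ordered_monomial j X m" "(\<Sum>i=1..j. m i) \<le> N" by blast
  let ?m = "\<lambda>l. if l \<le> j then m l else if l = Suc i then 1 else 0"
  have "x = ordered_monomial j X ?m" unfolding m(1) by (rule ordered_monomial_cong) simp
  also have "\<dots> = ordered_monomial i X ?m"
    using assms(3) by (intro ordered_monomial_extend[symmetric]) auto
  finally have "x * X (Suc i) = ordered_monomial (Suc i) X ?m"
    using assms(3) by (simp add: ordered_monomial_Suc)
  also have "\<dots> = ordered_monomial n X ?m"
    using assms(3,4) by (intro ordered_monomial_extend[symmetric]) auto
  finally have eq: "x * X (Suc i) = ordered_monomial n X ?m" .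
  have "(\<Sum>l=1..n. ?m l * b ^ l) =
      (\<Sum>l=1..n. (if l \<le> j then m l * b ^ l else 0) + (if l = Suc i then b ^ l else 0))"
    using assms(3) by (intro sum.cong) auto
  also have "\<dots> = (\<Sum>l=1..n. if l \<le> j then m l * b ^ l else 0) + b ^ Suc i"
    using assms(3,4) by (simp add: sum.distrib)
  finally have sum_eq: "(\<Sum>l=1..n. ?m l * b ^ l) =
      (\<Sum>l=1..n. if l \<le> j then m l * b ^ l else 0) + b ^ Suc i" .
  have "(\<Sum>l=1..n. if l \<le> j then m l * b ^ l else 0) = (\<Sum>l=1..j. m l * b ^ l)"
    using assms(3,4) by (intro sum.mono_neutral_cong_right) auto
  also have "\<dots> < b ^ Suc j"
    using m(2) assms(2) by (intro weight_less) simp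
  finally have "(\<Sum>l=1..n. ?m l * b ^ l) \<le> b ^ Suc i + b ^ Suc j - 1"
    unfolding sum_eq by linarith
  then have "x * X (Suc i) \<in> pbw_filtration n X ((^) b) (b ^ Suc i + b ^ Suc j - 1)"
    unfolding eq pbw_filtration_def by (intro span_base) blast
  with step.IH show ?case
    by (simp add: pbw_filtration_def distrib_right scale_mult_left span_add span_scale)
qed

lemma pbw_commuting_exists: "\<exists>b > 0. pbw_commuting scale n X ((^) b)"
proof -
  \<comment> \<open>For j < i the commutator is \<open>?s i j * X (Suc i) + ?t i j\<close>.\<close>
  let ?s = "\<lambda>i j. \<sigma>' (Suc i) (X (Suc j)) - X (Suc j)" and ?t = "\<lambda>i j. \<delta>' (Suc i) (X (Suc j))"
  have rule: "X (Suc i) * X (Suc j) = \<sigma>' (Suc i) (X (Suc j)) * X (Suc i) + ?t i j" "?t i j \<in> H_sub i"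
    if "j < i" "i < n" for i j
  proof -
    have "X (Suc j) \<in> H_sub i"
      using ore_extension_subalgebra(4)[OF ore_extension_H_sub[of j]] right.K_mono[of "Suc j" i] that by auto
    then show "X (Suc i) * X (Suc j) = \<sigma>' (Suc i) (X (Suc j)) * X (Suc i) + ?t i j" "?t i j \<in> H_sub i"
      using ore_extension_rule[OF ore_extension_H_sub[OF that(2)]] by auto
  qed
  define Q where "Q i j N \<longleftrightarrow> ?s i j \<in> bounded_span j X N \<and> ?t i j \<in> bounded_span i X N" for i j N
  have Q_ex: "\<exists>N. j < i \<longrightarrow> i < n \<longrightarrow> Q i j N" for i j
  proof (cases "j < i \<and> i < n")
    case True
    then obtain N N' where "?s i j \<in> bounded_span j X N" "?t i j \<in> bounded_span i X N'"
      using pbw_spanning[of j "?s i j"] pbw_spanning[of i "?t i j"] sigma_triangular rule(2) by fastforce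
    then show ?thesis
      using bounded_span_mono[of N "N + N'" j X] bounded_span_mono[of N' "N + N'" i X]
      by (intro exI[of _ "N + N'"]) (auto simp: Q_def)
  qed auto
  define N where "N i j = (SOME N. j < i \<longrightarrow> i < n \<longrightarrow> Q i j N)" for i j
  have "j < i \<longrightarrow> i < n \<longrightarrow> Q i j (N i j)" for i j
    unfolding N_def by (rule someI_ex[OF Q_ex])
  then have N: "?s i j \<in> bounded_span j X (N i j)" "?t i j \<in> bounded_span i X (N i j)"
    if "j < i" "i < n" for i j
    using that by (simp_all add: Q_def)
  \<comment> \<open>Larger than every bound that occurs: the sum stands in for a maximum, and
    \<open>Suc\<close> also makes \<open>b\<close> positive.\<close>
  define b where "b = Suc (\<Sum>i<n. \<Sum>j<n. N i j)"
  have N_less: "N i j < b" if "j < i" "i < n" for i j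
  proof -
    have "N i j \<le> (\<Sum>j<n. N i j)" using that by (intro member_le_sum) auto
    also have "\<dots> \<le> (\<Sum>i<n. \<Sum>j<n. N i j)"
      using that by (intro member_le_sum[of i "{..<n}" "\<lambda>i. \<Sum>j<n. N i j"]) auto
    finally show ?thesis by (simp add: b_def)
  qed
  have "pbw_commuting scale n X ((^) b)"
  proof
    fix i' j' assume "i' \<in> {1..n}" "j' \<in> {1..n}" "j' < i'"
    then obtain i j where ij: "i' = Suc i" "j' = Suc j" "j < i" "i < n"
      by (cases i'; cases j') auto
    let ?C = "pbw_filtration n X ((^) b) (b ^ Suc i + b ^ Suc j - 1)"
    have "?s i j * X (Suc i) \<in> ?C"
      by (rule bounded_span_mult_filtration[OF N(1)[OF ij(3,4)] N_less[OF ij(3,4)] ij(3,4)])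
    moreover have "?t i j \<in> pbw_filtration n X ((^) b) (b ^ Suc i - 1)"
      by (rule bounded_span_filtration[OF N(2)[OF ij(3,4)] N_less[OF ij(3,4)]]) (use ij(4) in simp)
    moreover have "pbw_filtration n X ((^) b) (b ^ Suc i - 1) \<subseteq> ?C"
      unfolding pbw_filtration_def by (rule span_mono) auto
    ultimately have "?s i j * X (Suc i) + ?t i j \<in> ?C"
      by (auto simp: pbw_filtration_def intro: span_add)
    then show "X i' * X j' - X j' * X i' \<in> pbw_filtration n X ((^) b) (b ^ i' + b ^ j' - 1)"
      using rule(1)[OF ij(3,4)] by (simp add: ij(1,2) algebra_simps)
  qed (use ordered_monomials_independent in \<open>auto simp: b_def\<close>)
  then show ?thesis by (intro exI[of _ b]) (simp add: b_def)
qed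

end

theorem theorem0p2:
  fixes scale :: "'k::alg_closed_field \<Rightarrow> 'h::ring_1 \<Rightarrow> 'h"
    and \<Delta> :: "'h \<Rightarrow> ('h \<times> 'h \<Rightarrow>\<^sub>0 'k)"
    and \<epsilon> :: "'h \<Rightarrow> 'k"
    and S :: "'h \<Rightarrow> 'h"
    and n p :: nat
    and X :: "nat \<Rightarrow> 'h"
    and \<sigma> \<delta> :: "nat \<Rightarrow> 'h \<Rightarrow> 'h"
  assumes "prime p" and "CHAR('k) = p"
    and "ihoe scale \<Delta> \<epsilon> S n X \<sigma> \<delta>"
  shows "\<exists>d :: nat \<Rightarrow> nat.
    (\<forall>i\<in>{1..n}. d i > 0) \<and>
    k_algebra.algebra_filtration (k_algebra.pbw_filtration scale n X d) \<and>
    (\<exists>\<phi>. \<phi> \<in> algebra_iso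
       (mpoly_algebra {1..n} :: ('k, (nat \<Rightarrow>\<^sub>0 nat) \<Rightarrow>\<^sub>0 'k) module)
       (k_algebra.gr_algebra scale (k_algebra.pbw_filtration scale n X d)))"
proof -
  interpret ihoe scale \<Delta> \<epsilon> S n X \<sigma> \<delta> "\<lambda>i. k_algebra.gen_subalgebra scale (X ` {1..i})"
    by (rule assms(3)) (rule reflexive)
  obtain b where "b > 0" "pbw_commuting scale n X ((^) b)"
    using pbw_commuting_exists by blast
  then interpret pbw_commuting scale n X "(^) b" by simp
  show ?thesis
    using algebra_filtration_C gr_map_iso d_pos by blast
qed

end
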